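(* Let $\{\mathbf{u}^\mu\}_{\mu>0}$ be a family of periodic weak solutions of the incompressible Navier–Stokes equations with viscosity $\mu$, with common initial data $\mathbf{u}_0$ and common external force $\mathbf{f}$ (as specified in the context), and suppose that this family satisfies Assumption (K41w) with exponent $\beta>0$ (as defined in the context). Let $\alpha\in(0,\beta/2)$. Then, for any $T>0$, there exists $M_T>0$, depending on $\mathbf{u}_0$, $\mathbf{f}$ and $T$ but independent of $\mu>0$, such that, for all sufficiently small $\triangle t>0$ and all $\mu>0$, $$\int_0^{T-\triangle t}\int_{\mathbb{T}_P}|\mathbf{u}^\mu(t+\triangle t,\mathbf{x})-\mathbf{u}^\mu(t,\mathbf{x})|^2\,d\mathbf{x}\,dt\le M_T(\triangle t)^{\frac{2\alpha}{5+2\alpha}},$$ and the right-hand side tends to $0$ as $\triangle t\to0$.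
   Context: Let $P>0$ and $\mathbb{T}_P=[-P/2,P/2]^3\subset\mathbb{R}^3$. A function of $\mathbf{x}\in\mathbb{R}^3$ is periodic with period $\mathbb{T}_P$ if it is invariant under $\mathbf{x}\mapsto \mathbf{x}+P\mathbf{e}_i$, $i=1,2,3$, with $(\mathbf{e}_i)$ the canonical basis. All spaces in $\mathbf{x}$ are spaces of periodic functions on $\mathbb{T}_P$. Navier–Stokes system: $\partial_t\mathbf{u}+\nabla\cdot(\mathbf{u}\otimes\mathbf{u})+\nabla p=\mu\Delta\mathbf{u}+\mathbf{f}$, $\nabla\cdot\mathbf{u}=0$ in $\mathbb{R}^3$, $\mathbf{u}|_{t=0}=\mathbf{u}_0$, where $\mathbf{u}\otimes\mathbf{u}=(u_iu_j)$, $\mathbf{u}_0\in L^2(\mathbb{T}_P)$ is periodic and $\mathbf{f}$ is periodic in $\mathbf{x}$ with $\mathbf{f}\in L^2(0,T;L^2(\mathbb{T}_P))$ for every $T>0$; $\mathbf{u}_0$ and $\mathbf{f}$ do not depend on $\mu$. Weak solutions: for each $\mu>0$, $\mathbf{u}^\mu$ is periodic, with a corresponding periodic pressure $p^\mu$, such that for every $T>0$ the equations hold in the sense of distributions in $[0,T)\times\mathbb{R}^3$ (test functions in $C_c^\infty([0,T)\times\mathbb{R}^3)$, the initial data entering through the term at $t=0$), and: (1) $\mathbf{u}^\mu\in L^2(0,T;H^1)\cap C([0,T];L^2_w)\cap C([0,T];L^{s_1})$; (2) $\partial_t\mathbf{u}^\mu\in L^2(0,T;H^{-1})+\big(L^{s_2}(0,T;W^{-1,\frac{3s_2}{3s_2-2}})\cap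 L^q(0,T;L^r)\big)$; (3) $p^\mu\in L^2((0,T)\times\mathbb{T}_P)+L^{s_2}(0,T;L^{\frac{3s_2}{3s_2-2}})$; (4) $\nabla p^\mu\in L^2(0,T;H^{-1})+L^q(0,T;L^r)$, for $1\le s_1<2$, $1\le s_2<\infty$, $1\le q<2$, $r=\frac{3q}{2(2q-1)}$; (5) in the sense of distributions in $[0,T)\times\mathbb{R}^3$, $\partial_t(\tfrac12|\mathbf{u}^\mu|^2)+\nabla\cdot\big(\mathbf{u}^\mu(\tfrac12|\mathbf{u}^\mu|^2+p^\mu)\big)+\mu|\nabla\mathbf{u}^\mu|^2-\mu\Delta(\tfrac12|\mathbf{u}^\mu|^2)\le\mathbf{f}\cdot\mathbf{u}^\mu$. Here $\mathbf{v}\in C([0,T];L^2_w)$ means $\mathbf{v}\in L^\infty(0,T;L^2(\mathbb{T}_P))$ and $\mathbf{v}$ is continuous in $t$ with values in $L^2(\mathbb{T}_P)$ with the weak topology. In particular, for every $T>0$ there is $C'_T>0$ independent of $\mu$ with $$\|\mathbf{u}^\mu-\bar{\mathbf{u}}\|_{L^\infty(0,T;L^2(\mathbb{T}_P))}^2+\|\sqrt{\mu}\,\nabla\mathbf{u}^\mu\|^2_{L^2([0,T)\times\mathbb{T}_P)}\le C'_T\big(\|\mathbf{u}_0-\bar{\mathbf{u}}\|^2_{L^2(\mathbb{T}_P)}+\|\mathbf{f}-\bar{\mathbf{f}}\|^2_{L^2([0,T)\times\mathbb{T}_P)}\big),$$ where bars denote spatial means over $\mathbb{T}_P$ (the mean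 $\bar{\mathbf{u}}(t)=\frac1{|\mathbb{T}_P|}\int_{\mathbb{T}_P}\mathbf{u}_0\,d\mathbf{x}+\int_0^t\bar{\mathbf{f}}(s)\,ds$ is independent of $\mu$). Fourier coefficients: $\hat{\mathbf{u}}(t,\mathbf{k})=\frac{1}{|\mathbb{T}_P|}\int_{\mathbb{T}_P}\mathbf{u}(t,\mathbf{x})e^{-i\mathbf{k}\cdot\mathbf{x}}d\mathbf{x}$ for $\mathbf{k}\in\frac{2\pi}{P}\mathbb{Z}^3$. Assumption (K41w) with exponent $\beta>0$ ($\beta$ independent of $\mu$): for any $T>0$, there exist $C_T>0$ and $k_*$ (sufficiently large), depending on $\mathbf{u}_0$ and $\mathbf{f}$ but independent of the viscosity $\mu$, such that for all $\mu>0$ $$\sup_{|\mathbf{k}|\ge k_*}\Big(|\mathbf{k}|^{3+\beta}\int_0^T|\hat{\mathbf{u}}^\mu(t,\mathbf{k})|^2dt\Big)\le C_T .$$ *)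

theory Defs
  imports "HOL-Analysis.Analysis"
begin

section \<open>Smooth functions and test functions\<close>

definition pd :: "'a::real_normed_vector \<Rightarrow> ('a \<Rightarrow> 'b::real_normed_vector) \<Rightarrow> 'a \<Rightarrow> 'b" where
  "pd v g = (\<lambda>x. frechet_derivative g (at x) v)"

primrec Ck :: "nat \<Rightarrow> ('a::real_normed_vector \<Rightarrow> 'b::real_normed_vector) \<Rightarrow> bool" where
  "Ck 0 g \<longleftrightarrow> continuous_on UNIV g"
| "Ck (Suc n) g \<longleftrightarrow> (\<forall>x. g differentiable (at x)) \<and> (\<forall>v. Ck n (pd v g))"

definition smooth :: "('a::real_normed_vector \<Rightarrow> 'b::real_normed_vector) \<Rightarrow> bool" where
  "smooth g \<longleftrightarrow> (\<forall>n. Ck n g)"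

definition test_fun :: "'a set \<Rightarrow> ('a::real_normed_vector \<Rightarrow> 'b::real_normed_vector) \<Rightarrow> bool" where
  "test_fun \<Omega> g \<longleftrightarrow> smooth g \<and> (\<exists>K. compact K \<and> K \<subseteq> \<Omega> \<and> (\<forall>z. z \<notin> K \<longrightarrow> g z = 0))"

text \<open>
  Test functions on \<open>[0,T) \<times> \<real>\<^sup>3\<close> are smooth up to and including \<open>t = 0\<close>, where they need not
  vanish. They are the restrictions to \<open>t \<ge> 0\<close> of the test functions on \<open>(-\<infinity>,T) \<times> \<real>\<^sup>3\<close>,
  and are represented by the latter.
\<close>

abbreviation spacetime :: "real \<Rightarrow> (real \<times> (real^3)) set" where
  "spacetime T \<equiv> {..<T} \<times> UNIV"

abbreviation d_t :: "(real \<times> (real^3) \<Rightarrow> 'b::real_normed_vector) \<Rightarrow> real \<times> (real^3) \<Rightarrow> 'b" where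
  "d_t \<equiv> pd (1, 0)"

abbreviation d_x :: "3 \<Rightarrow> (real \<times> (real^3) \<Rightarrow> 'b::real_normed_vector) \<Rightarrow> real \<times> (real^3) \<Rightarrow> 'b" where
  "d_x j \<equiv> pd (0, axis j 1)"

definition laplace_x :: "(real \<times> (real^3) \<Rightarrow> 'b::real_normed_vector) \<Rightarrow> real \<times> (real^3) \<Rightarrow> 'b" where
  "laplace_x \<phi> z = (\<Sum>j\<in>UNIV. d_x j (d_x j \<phi>) z)"


section \<open>Spaces of periodic functions\<close>

text \<open>
  Elements of Lebesgue spaces are represented by Borel functions that are periodic everywhere;
  every class that is invariant under the translations almost everywhere has such a
  representative.
\<close>

definition torus :: "real \<Rightarrow> (real^3) set" where
  "torus P = cbox (\<chi> i. - P / 2) (\<chi> i. P / 2)"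

definition periodic :: "real \<Rightarrow> (real^3 \<Rightarrow> 'b) \<Rightarrow> bool" where
  "periodic P g \<longleftrightarrow> (\<forall>x i. g (x + P *\<^sub>R axis i 1) = g x)"

definition Lp_per :: "real \<Rightarrow> real \<Rightarrow> (real^3 \<Rightarrow> 'b::euclidean_space) \<Rightarrow> bool" where
  "Lp_per P r g \<longleftrightarrow> periodic P g \<and> g \<in> borel_measurable borel \<and>
     set_integrable lborel (torus P) (\<lambda>x. norm (g x) powr r)"

definition Lq_Lp :: "real \<Rightarrow> real \<Rightarrow> real \<Rightarrow> real \<Rightarrow> (real \<Rightarrow> real^3 \<Rightarrow> 'b::euclidean_space) \<Rightarrow> bool" where
  \<comment> \<open>\<open>L\<^sup>q(0,T;L\<^sup>r)\<close>\<close>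
  "Lq_Lp P T q r g \<longleftrightarrow>
     (\<forall>t\<in>{0<..<T}. periodic P (g t)) \<and>
     set_borel_measurable borel ({0<..<T} \<times> UNIV) (\<lambda>(t, x). g t x) \<and>
     (AE t in lborel. t \<in> {0<..<T} \<longrightarrow>
        set_integrable lborel (torus P) (\<lambda>x. norm (g t x) powr r)) \<and>
     set_integrable lborel {0<..<T}
       (\<lambda>t. (LINT x:torus P|lborel. norm (g t x) powr r) powr (q / r))"

definition weak_gradient :: "(real^3 \<Rightarrow> real^3) \<Rightarrow> (real^3 \<Rightarrow> real^3^3) \<Rightarrow> bool" where
  \<comment> \<open>\<open>G x $ i $ j\<close> is the \<open>j\<close>-th partial derivative of the \<open>i\<close>-th component\<close>
  "weak_gradient v G \<longleftrightarrow>
     (\<forall>\<eta> :: real^3 \<Rightarrow> real. test_fun UNIV \<eta> \<longrightarrow>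
        (\<forall>i j. (LINT x|lborel. v x $ i * pd (axis j 1) \<eta> x)
             = - (LINT x|lborel. G x $ i $ j * \<eta> x)))"

definition L2_H1 :: "real \<Rightarrow> real \<Rightarrow> (real \<Rightarrow> real^3 \<Rightarrow> real^3) \<Rightarrow> (real \<Rightarrow> real^3 \<Rightarrow> real^3^3) \<Rightarrow> bool" where
  \<comment> \<open>\<open>v \<in> L\<^sup>2(0,T;H\<^sup>1)\<close> with spatial gradient \<open>Dv\<close>\<close>
  "L2_H1 P T v Dv \<longleftrightarrow> Lq_Lp P T 2 2 v \<and> Lq_Lp P T 2 2 Dv \<and>
     (AE t in lborel. t \<in> {0<..<T} \<longrightarrow> weak_gradient (v t) (Dv t))"

definition C_L2w :: "real \<Rightarrow> real \<Rightarrow> (real \<Rightarrow> real^3 \<Rightarrow> real^3) \<Rightarrow> bool" where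
  "C_L2w P T v \<longleftrightarrow>
     (\<forall>t\<in>{0..T}. Lp_per P 2 (v t)) \<and>
     (\<exists>C. AE t in lborel. t \<in> {0<..<T} \<longrightarrow> (LINT x:torus P|lborel. (norm (v t x))\<^sup>2) \<le> C) \<and>
     (\<forall>w. Lp_per P 2 w \<longrightarrow> continuous_on {0..T} (\<lambda>t. LINT x:torus P|lborel. v t x \<bullet> w x))"

definition C_Ls :: "real \<Rightarrow> real \<Rightarrow> real \<Rightarrow> (real \<Rightarrow> real^3 \<Rightarrow> real^3) \<Rightarrow> bool" where
  "C_Ls P T s v \<longleftrightarrow>
     (\<forall>t\<in>{0..T}. Lp_per P s (v t)) \<and>
     (\<forall>t\<in>{0..T}. ((\<lambda>\<tau>. LINT x:torus P|lborel. norm (v \<tau> x - v t x) powr s) \<longlongrightarrow> 0)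
                    (at t within {0..T}))"


section \<open>Negative Sobolev spaces\<close>

text \<open>
  \<open>W\<^bsup>-1,s\<^esup>\<close>, for \<open>1 < s < \<infinity>\<close>, is the dual of the periodic space \<open>W\<^bsup>1,s'\<^esup>\<close> with
  \<open>s' = s / (s - 1)\<close>. Since smooth periodic fields are dense in \<open>W\<^bsup>1,s'\<^esup>\<close>, its elements are
  the linear functionals on smooth periodic fields that are bounded for the norm of
  \<open>W\<^bsup>1,s'\<^esup>\<close>; and \<open>H\<^bsup>-1\<^esup> = W\<^bsup>-1,2\<^esup>\<close>.
\<close>

definition smooth_per :: "real \<Rightarrow> (real^3 \<Rightarrow> real^3) set" where
  "smooth_per P = {\<phi>. smooth \<phi> \<and> periodic P \<phi>}"

definition jacobian :: "(real^3 \<Rightarrow> real^3) \<Rightarrow> real^3 \<Rightarrow> real^3^3" where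
  "jacobian \<phi> x = matrix (frechet_derivative \<phi> (at x))"

definition W1_norm :: "real \<Rightarrow> real \<Rightarrow> (real^3 \<Rightarrow> real^3) \<Rightarrow> real" where
  "W1_norm P s \<phi> =
     (LINT x:torus P|lborel. norm (\<phi> x) powr s + norm (jacobian \<phi> x) powr s) powr (1 / s)"

definition W_neg :: "real \<Rightarrow> real \<Rightarrow> ((real^3 \<Rightarrow> real^3) \<Rightarrow> real) \<Rightarrow> bool" where
  "W_neg P s F \<longleftrightarrow>
     (\<forall>\<phi>\<in>smooth_per P. \<forall>\<psi>\<in>smooth_per P. \<forall>a b.
        F (\<lambda>x. a *\<^sub>R \<phi> x + b *\<^sub>R \<psi> x) = a * F \<phi> + b * F \<psi>) \<and>
     (\<exists>C. \<forall>\<phi>\<in>smooth_per P. \<bar>F \<phi>\<bar> \<le> C * W1_norm P (s / (s - 1)) \<phi>)"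

definition W_neg_norm :: "real \<Rightarrow> real \<Rightarrow> ((real^3 \<Rightarrow> real^3) \<Rightarrow> real) \<Rightarrow> real" where
  "W_neg_norm P s F = Sup {\<bar>F \<phi>\<bar> | \<phi>. \<phi> \<in> smooth_per P \<and> W1_norm P (s / (s - 1)) \<phi> \<le> 1}"

definition Lq_W_neg :: "real \<Rightarrow> real \<Rightarrow> real \<Rightarrow> real \<Rightarrow> (real \<Rightarrow> (real^3 \<Rightarrow> real^3) \<Rightarrow> real) \<Rightarrow> bool" where
  \<comment> \<open>\<open>L\<^sup>q(0,T;W\<^bsup>-1,s\<^esup>)\<close>; weak and strong measurability agree, the space being separable\<close>
  "Lq_W_neg P T q s F \<longleftrightarrow>
     (\<forall>\<phi>\<in>smooth_per P. set_borel_measurable borel {0<..<T} (\<lambda>t. F t \<phi>)) \<and>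
     (\<forall>t\<in>{0<..<T}. W_neg P s (F t)) \<and>
     set_integrable lborel {0<..<T} (\<lambda>t. W_neg_norm P s (F t) powr q)"

definition functional_of :: "real \<Rightarrow> (real^3 \<Rightarrow> real^3) \<Rightarrow> (real^3 \<Rightarrow> real^3) \<Rightarrow> real" where
  "functional_of P g \<phi> = (LINT x:torus P|lborel. g x \<bullet> \<phi> x)"

definition time_derivative :: "real \<Rightarrow> real \<Rightarrow> (real \<Rightarrow> real^3 \<Rightarrow> real^3) \<Rightarrow>
    (real \<Rightarrow> (real^3 \<Rightarrow> real^3) \<Rightarrow> real) \<Rightarrow> bool" where
  "time_derivative P T v F \<longleftrightarrow>
     (\<forall>\<psi> :: real \<Rightarrow> real. \<forall>\<phi>\<in>smooth_per P. test_fun {0<..<T} \<psi> \<longrightarrow>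
        (LINT t:{0<..<T}|lborel. deriv \<psi> t * (LINT x:torus P|lborel. v t x \<bullet> \<phi> x))
        = - (LINT t:{0<..<T}|lborel. \<psi> t * F t \<phi>))"

definition pressure_gradient :: "real \<Rightarrow> real \<Rightarrow> (real \<Rightarrow> real^3 \<Rightarrow> real) \<Rightarrow>
    (real \<Rightarrow> (real^3 \<Rightarrow> real^3) \<Rightarrow> real) \<Rightarrow> bool" where
  "pressure_gradient P T p F \<longleftrightarrow>
     (\<forall>\<psi> :: real \<Rightarrow> real. \<forall>\<phi>\<in>smooth_per P. test_fun {0<..<T} \<psi> \<longrightarrow>
        (LINT t:{0<..<T}|lborel. \<psi> t * (LINT x:torus P|lborel. p t x * trace (jacobian \<phi> x)))
        = - (LINT t:{0<..<T}|lborel. \<psi> t * F t \<phi>))"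


section \<open>Weak solutions of the Navier--Stokes equations\<close>

definition momentum_eq :: "real \<Rightarrow> real \<Rightarrow> (real^3 \<Rightarrow> real^3) \<Rightarrow> (real \<Rightarrow> real^3 \<Rightarrow> real^3) \<Rightarrow>
    (real \<Rightarrow> real^3 \<Rightarrow> real^3) \<Rightarrow> (real \<Rightarrow> real^3 \<Rightarrow> real) \<Rightarrow> bool" where
  "momentum_eq T \<mu> u0 f u p \<longleftrightarrow>
     (\<forall>\<Phi> :: real \<times> (real^3) \<Rightarrow> real^3. test_fun (spacetime T) \<Phi> \<longrightarrow>
        (LINT (t, x):{0<..<T} \<times> UNIV|lborel.
            u t x \<bullet> d_t \<Phi> (t, x)
          + (\<Sum>i\<in>UNIV. \<Sum>j\<in>UNIV. u t x $ i * u t x $ j * d_x j \<Phi> (t, x) $ i)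
          + p t x * (\<Sum>i\<in>UNIV. d_x i \<Phi> (t, x) $ i)
          + \<mu> * (u t x \<bullet> laplace_x \<Phi> (t, x))
          + f t x \<bullet> \<Phi> (t, x))
        + (LINT x|lborel. u0 x \<bullet> \<Phi> (0, x)) = 0)"

definition divergence_free :: "real \<Rightarrow> (real \<Rightarrow> real^3 \<Rightarrow> real^3) \<Rightarrow> bool" where
  "divergence_free T u \<longleftrightarrow>
     (\<forall>\<phi> :: real \<times> (real^3) \<Rightarrow> real. test_fun (spacetime T) \<phi> \<longrightarrow>
        (LINT (t, x):{0<..<T} \<times> UNIV|lborel. \<Sum>j\<in>UNIV. u t x $ j * d_x j \<phi> (t, x)) = 0)"

definition energy_flux :: "(real \<Rightarrow> real^3 \<Rightarrow> real^3) \<Rightarrow> (real \<Rightarrow> real^3 \<Rightarrow> real) \<Rightarrow>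
    real \<Rightarrow> real^3 \<Rightarrow> real^3" where
  "energy_flux u p t x = ((norm (u t x))\<^sup>2 / 2 + p t x) *\<^sub>R u t x"

text \<open>
  For the local energy inequality to make sense as an inequality between distributions, the
  energy flux must be locally integrable on \<open>[0,T) \<times> \<real>\<^sup>3\<close>. This is recorded explicitly, because
  the Lebesgue integral of a non-integrable function is \<open>0\<close> by convention; for the other terms,
  and for those of the momentum equation, it is immediate from the function spaces.
  The norm on \<^typ>\<open>real^3^3\<close> is the Frobenius norm.
\<close>

definition energy_ineq :: "real \<Rightarrow> real \<Rightarrow> (real^3 \<Rightarrow> real^3) \<Rightarrow> (real \<Rightarrow> real^3 \<Rightarrow> real^3) \<Rightarrow>
    (real \<Rightarrow> real^3 \<Rightarrow> real^3) \<Rightarrow> (real \<Rightarrow> real^3 \<Rightarrow> real^3^3) \<Rightarrow> (real \<Rightarrow> real^3 \<Rightarrow> real) \<Rightarrow> bool" where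
  "energy_ineq T \<mu> u0 f u Du p \<longleftrightarrow>
     (\<forall>K. compact K \<and> K \<subseteq> spacetime T \<longrightarrow>
        set_integrable lborel (K \<inter> ({0<..} \<times> UNIV)) (\<lambda>(t, x). energy_flux u p t x)) \<and>
     (\<forall>\<phi> :: real \<times> (real^3) \<Rightarrow> real. test_fun (spacetime T) \<phi> \<and> (\<forall>z. \<phi> z \<ge> 0) \<longrightarrow>
        - (LINT (t, x):{0<..<T} \<times> UNIV|lborel. (norm (u t x))\<^sup>2 / 2 * d_t \<phi> (t, x))
        - (LINT x|lborel. (norm (u0 x))\<^sup>2 / 2 * \<phi> (0, x))
        - (LINT (t, x):{0<..<T} \<times> UNIV|lborel.
             \<Sum>j\<in>UNIV. energy_flux u p t x $ j * d_x j \<phi> (t, x))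
        + \<mu> * (LINT (t, x):{0<..<T} \<times> UNIV|lborel. (norm (Du t x))\<^sup>2 * \<phi> (t, x))
        - \<mu> * (LINT (t, x):{0<..<T} \<times> UNIV|lborel. (norm (u t x))\<^sup>2 / 2 * laplace_x \<phi> (t, x))
        \<le> (LINT (t, x):{0<..<T} \<times> UNIV|lborel. (f t x \<bullet> u t x) * \<phi> (t, x)))"

definition weak_solution_on :: "real \<Rightarrow> real \<Rightarrow> real \<Rightarrow> (real^3 \<Rightarrow> real^3) \<Rightarrow>
    (real \<Rightarrow> real^3 \<Rightarrow> real^3) \<Rightarrow> (real \<Rightarrow> real^3 \<Rightarrow> real^3) \<Rightarrow> (real \<Rightarrow> real^3 \<Rightarrow> real) \<Rightarrow> bool" where
  "weak_solution_on P T \<mu> u0 f u p \<longleftrightarrow>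
     momentum_eq T \<mu> u0 f u p \<and> divergence_free T u \<and>
     (\<exists>Du. L2_H1 P T u Du \<and> energy_ineq T \<mu> u0 f u Du p) \<and>
     C_L2w P T u \<and>
     (\<forall>s1. 1 \<le> s1 \<and> s1 < 2 \<longrightarrow> C_Ls P T s1 u) \<and>
     (\<forall>s2 q. 1 \<le> s2 \<and> 1 \<le> q \<and> q < 2 \<longrightarrow>
        (\<exists>F g. Lq_W_neg P T 2 2 F \<and>
               Lq_W_neg P T s2 (3 * s2 / (3 * s2 - 2)) (\<lambda>t. functional_of P (g t)) \<and>
               Lq_Lp P T q (3 * q / (2 * (2 * q - 1))) g \<and>
               time_derivative P T u (\<lambda>t \<phi>. F t \<phi> + functional_of P (g t) \<phi>))) \<and>
     (\<forall>s2. 1 \<le> s2 \<longrightarrow>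
        (\<exists>p1 p2. Lq_Lp P T 2 2 p1 \<and> Lq_Lp P T s2 (3 * s2 / (3 * s2 - 2)) p2 \<and>
                 (\<forall>t\<in>{0<..<T}. \<forall>x. p t x = p1 t x + p2 t x))) \<and>
     (\<forall>q. 1 \<le> q \<and> q < 2 \<longrightarrow>
        (\<exists>F g. Lq_W_neg P T 2 2 F \<and>
               Lq_Lp P T q (3 * q / (2 * (2 * q - 1))) g \<and>
               pressure_gradient P T p (\<lambda>t \<phi>. F t \<phi> + functional_of P (g t) \<phi>)))"

definition weak_solution :: "real \<Rightarrow> real \<Rightarrow> (real^3 \<Rightarrow> real^3) \<Rightarrow>
    (real \<Rightarrow> real^3 \<Rightarrow> real^3) \<Rightarrow> (real \<Rightarrow> real^3 \<Rightarrow> real^3) \<Rightarrow> (real \<Rightarrow> real^3 \<Rightarrow> real) \<Rightarrow> bool" where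
  "weak_solution P \<mu> u0 f u p \<longleftrightarrow> (\<forall>T>0. weak_solution_on P T \<mu> u0 f u p)"


section \<open>Fourier coefficients and Assumption (K41w)\<close>

definition fourier_coeff :: "real \<Rightarrow> (real^3 \<Rightarrow> real^3) \<Rightarrow> real^3 \<Rightarrow> complex^3" where
  "fourier_coeff P v k =
     (\<chi> j. complex_of_real (1 / measure lborel (torus P)) *
        (CLINT x:torus P|lborel. complex_of_real (v x $ j) * exp (- (\<i> * complex_of_real (k \<bullet> x)))))"

definition wave_vectors :: "real \<Rightarrow> (real^3) set" where
  "wave_vectors P = {(2 * pi / P) *\<^sub>R (\<chi> i. real_of_int (n i)) | n :: 3 \<Rightarrow> int. True}"

definition K41w :: "real \<Rightarrow> real \<Rightarrow> (real \<Rightarrow> real \<Rightarrow> real^3 \<Rightarrow> real^3) \<Rightarrow> bool" where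
  "K41w P \<beta> u \<longleftrightarrow>
     (\<forall>T>0. \<exists>C>0. \<exists>kstar>0. \<forall>\<mu>>0.
        (SUP k\<in>{k \<in> wave_vectors P. norm k \<ge> kstar}.
           ennreal (norm k powr (3 + \<beta>)) *
           (\<integral>\<^sup>+t\<in>{0..T}. ennreal ((norm (fourier_coeff P (u \<mu> t) k))\<^sup>2) \<partial>lborel)) \<le> ennreal C)"

end

(*
  A mode u^(k) with k . u^ = 0 solves w' + mu |k|^2 w = g, where the L^1 norm in time of g is at most
  a multiple of 1 + |k|, because the energy inequality bounds the space-time L^2 norm of u
  independently of mu. The total variation of w is bounded by the data whatever the damping, so
  the squared increment of w over a time h integrates to O((1 + |k|)^2 h). The modes with |k| < K
  thus contribute O(h K^5), those with |k| >= K contribute O(K^(-2 alpha)) by Assumption (K41w), and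
  K is chosen so as to balance the two. The test functions on the whole space required by the weak
  formulations are products of a periodic function with a smooth partition of unity subordinate to
  the lattice of periods; integrating a periodic function against such a product unfolds the torus.
*)
theory Submission
  imports Defs
begin

section \<open>Calculus of smooth functions\<close>

text \<open>No bound on the pressure that is uniform in \<mu> is available. Each mode is therefore
  tested only in directions orthogonal to its wave vector, where the pressure term vanishes
  identically. Weak continuity in time upgrades incompressibility from a distributional identity to
  one at every positive time, so the projection does not change the coefficient. The frequency sum
  is not done by counting lattice points: both ranges are compared with the convergent series of
  (1+|k|)^(-(3+\<delta>)). This costs a little, h K^(5+\<delta>1) in place of h K^5 at low frequency
  and K^(-\<gamma>) in place of K^(-\<beta>) at high frequency, and the strict inequality \<alpha> <
  \<beta>/2 pays for both losses. Solutions are used on intervals longer than [0,T], because test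
  functions have to vanish before the end of the interval. Only the inequality of Parseval that
  bounds a function by its coefficients is used; it is proved by duality against trigonometric
  polynomials, so that the increments need only be integrable beforehand.\<close>

lemma pd_eqI: "(f has_derivative D) (at x) \<Longrightarrow> pd v f x = D v"
  unfolding pd_def using frechet_derivative_at by metis

lemma Ck_differentiable: "Ck (Suc n) f \<Longrightarrow> f differentiable (at x)"
  by simp

lemma Ck_Suc_imp: "Ck (Suc n) f \<Longrightarrow> Ck n f"
proof (induction n arbitrary: f)
  case 0
  then show ?case
    by (auto intro!: continuous_at_imp_continuous_on differentiable_imp_continuous_within)
next
  case (Suc n)
  then show ?case by (metis Ck.simps(2))
qed

lemma Ck_const: "Ck n (\<lambda>_. c)"
proof (induction n arbitrary: c)
  case (Suc n)
  have "pd v (\<lambda>_::'a. c) = (\<lambda>_. 0)" for v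
    by (auto intro!: pd_eqI[where D="\<lambda>_. 0"])
  then show ?case using Suc by simp
qed simp

lemma has_derivative_pd: "f differentiable (at x) \<Longrightarrow> (f has_derivative (\<lambda>v. pd v f x)) (at x)"
  by (simp add: pd_def frechet_derivative_works)

lemma pd_add:
  assumes "f differentiable (at x)" "g differentiable (at x)"
  shows "pd v (\<lambda>x. f x + g x) x = pd v f x + pd v g x"
  using pd_eqI[OF has_derivative_add[OF assms[THEN has_derivative_pd]]] .

lemma pd_mult:
  fixes f g :: "'a::real_normed_vector \<Rightarrow> real"
  assumes "f differentiable (at x)" "g differentiable (at x)"
  shows "pd v (\<lambda>x. f x * g x) x = f x * pd v g x + pd v f x * g x"
  using pd_eqI[OF has_derivative_mult[OF assms[THEN has_derivative_pd]]] .

lemma pd_bounded_linear: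
  assumes "bounded_linear L" "f differentiable (at x)"
  shows "pd v (\<lambda>x. L (f x)) x = L (pd v f x)"
  using pd_eqI[OF bounded_linear.has_derivative[OF assms(1) has_derivative_pd[OF assms(2)]]] .

lemma pd_compose_linear:
  assumes "bounded_linear L" "f differentiable (at (L x + c))"
  shows "pd v (\<lambda>x. f (L x + c)) x = pd (L v) f (L x + c)"
proof (rule pd_eqI[where D="\<lambda>v. pd (L v) f (L x + c)", THEN trans])
  have "((\<lambda>x. L x + c) has_derivative L) (at x)"
    using bounded_linear.has_derivative[OF assms(1) has_derivative_ident]
    by (auto intro: has_derivative_add_const)
  then show "((\<lambda>x. f (L x + c)) has_derivative (\<lambda>v. pd (L v) f (L x + c))) (at x)"
    unfolding pd_def
    using has_derivative_compose assms(2)[unfolded frechet_derivative_works] by blast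
qed simp

lemma Ck_add: "Ck n f \<Longrightarrow> Ck n g \<Longrightarrow> Ck n (\<lambda>x. f x + g x)"
proof (induction n arbitrary: f g)
  case (Suc n)
  have "pd v (\<lambda>x. f x + g x) = (\<lambda>x. pd v f x + pd v g x)" for v
    using Suc.prems by (auto intro!: pd_add)
  then show ?case using Suc by (auto intro!: derivative_intros)
qed (auto intro: continuous_intros)

lemma Ck_mult:
  fixes f g :: "'a::real_normed_vector \<Rightarrow> real"
  shows "Ck n f \<Longrightarrow> Ck n g \<Longrightarrow> Ck n (\<lambda>x. f x * g x)"
proof (induction n arbitrary: f g)
  case (Suc n)
  have "pd v (\<lambda>x. f x * g x) = (\<lambda>x. f x * pd v g x + pd v f x * g x)" for v
    using Suc.prems by (auto intro!: pd_mult)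
  then show ?case
    using Suc.IH Suc.prems Ck_Suc_imp[OF Suc.prems(1)] Ck_Suc_imp[OF Suc.prems(2)]
    by (auto intro!: Ck_add differentiable_mult)
qed (auto intro: continuous_intros)

lemma Ck_bounded_linear: "bounded_linear L \<Longrightarrow> Ck n f \<Longrightarrow> Ck n (\<lambda>x. L (f x))"
proof (induction n arbitrary: f)
  case 0
  then show ?case
    using bounded_linear.continuous_on[of L UNIV f] by simp
next
  case (Suc n)
  have "pd v (\<lambda>x. L (f x)) = (\<lambda>x. L (pd v f x))" for v
    using Suc.prems by (auto intro!: pd_bounded_linear)
  moreover have "(\<lambda>x. L (f x)) differentiable (at x)" for x
    using Suc.prems by (simp add: differentiable_def) (blast intro: bounded_linear.has_derivative)
  ultimately show ?case using Suc by auto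
qed

lemma Ck_compose_linear: "bounded_linear L \<Longrightarrow> Ck n f \<Longrightarrow> Ck n (\<lambda>x. f (L x + c))"
proof (induction n arbitrary: f)
  case 0
  then have "continuous_on UNIV (\<lambda>x. L x + c)"
    by (intro continuous_intros bounded_linear.continuous_on[OF 0(1)])
  then show ?case
    using 0 continuous_on_compose2[of UNIV f UNIV "\<lambda>x. L x + c"] by simp
next
  case (Suc n)
  have "pd v (\<lambda>x. f (L x + c)) = (\<lambda>x. pd (L v) f (L x + c))" for v
    using Suc.prems by (auto intro!: pd_compose_linear)
  moreover have "(\<lambda>x. f (L x + c)) differentiable (at x)" for x
  proof -
    have "(\<lambda>x. L x + c) differentiable (at x)"
      using bounded_linear.has_derivative[OF Suc.prems(1) has_derivative_ident]
      by (simp add: differentiable_def) (blast intro: has_derivative_add_const)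
    then show ?thesis
      using Suc.prems differentiable_compose[of f "\<lambda>x. L x + c" x UNIV] by simp
  qed
  ultimately show ?case using Suc by auto
qed

lemma Ck_uminus: "Ck n f \<Longrightarrow> Ck n (\<lambda>x. - f x)"
  by (rule Ck_bounded_linear[OF bounded_linear_minus[OF bounded_linear_ident]])

lemma Ck_inverse:
  fixes f :: "'a::real_normed_vector \<Rightarrow> real"
  assumes "\<And>x. f x \<noteq> 0"
  shows "Ck n f \<Longrightarrow> Ck n (\<lambda>x. inverse (f x))"
proof (induction n)
  case 0
  then show ?case using assms by (auto intro: continuous_intros)
next
  case (Suc n)
  have D: "((\<lambda>x. inverse (f x)) has_derivative
      (\<lambda>v. - (inverse (f x) * pd v f x * inverse (f x)))) (at x)" for x
    unfolding pd_def using Suc.prems assms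
    by (intro Deriv.has_derivative_inverse) (auto simp: frechet_derivative_works)
  have "pd v (\<lambda>x. inverse (f x)) = (\<lambda>x. - (inverse (f x) * pd v f x * inverse (f x)))" for v
    using pd_eqI[OF D] by auto
  moreover have "Ck n (\<lambda>x. inverse (f x))"
    using Suc Ck_Suc_imp by blast
  ultimately show ?case
    using D Suc.prems
    by (auto simp: differentiable_def intro!: Ck_uminus Ck_mult)
qed

lemma pd_real: "(f has_real_derivative f') (at x) \<Longrightarrow> pd v f x = v * f'"
  unfolding has_field_derivative_def using pd_eqI by (metis mult.commute)

lemma Ck_Suc_real:
  fixes f :: "real \<Rightarrow> real"
  assumes "\<And>x. (f has_real_derivative f' x) (at x)" "Ck n f'"
  shows "Ck (Suc n) f"
proof -
  have "pd v f = (\<lambda>x. v * f' x)" for v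
    using pd_real[OF assms(1)] by auto
  moreover have "Ck n (\<lambda>x. v * f' x)" for v
    by (rule Ck_mult[OF Ck_const assms(2)])
  moreover have "f differentiable (at x)" for x
    using assms(1) unfolding differentiable_def has_field_derivative_def by blast
  ultimately show ?thesis by simp
qed

lemma smooth_differentiable: "smooth f \<Longrightarrow> f differentiable (at x)"
  unfolding smooth_def using Ck_differentiable by blast

lemma smooth_pd: "smooth f \<Longrightarrow> smooth (pd v f)"
  unfolding smooth_def using Ck.simps(2) by blast

lemma smooth_continuous: "smooth f \<Longrightarrow> continuous_on UNIV f"
  unfolding smooth_def using Ck.simps(1) by blast

lemma smooth_add: "smooth f \<Longrightarrow> smooth g \<Longrightarrow> smooth (\<lambda>x. f x + g x)"
  unfolding smooth_def using Ck_add by blast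

lemma smooth_const: "smooth (\<lambda>_. c)"
  unfolding smooth_def using Ck_const by blast

lemma smooth_mult:
  fixes f g :: "'a::real_normed_vector \<Rightarrow> real"
  shows "smooth f \<Longrightarrow> smooth g \<Longrightarrow> smooth (\<lambda>x. f x * g x)"
  unfolding smooth_def using Ck_mult by blast

lemma smooth_inverse:
  fixes f :: "'a::real_normed_vector \<Rightarrow> real"
  shows "(\<And>x. f x \<noteq> 0) \<Longrightarrow> smooth f \<Longrightarrow> smooth (\<lambda>x. inverse (f x))"
  by (simp add: smooth_def Ck_inverse)

lemma smooth_prod:
  fixes f :: "'i \<Rightarrow> 'a::real_normed_vector \<Rightarrow> real"
  shows "(\<And>i. i \<in> I \<Longrightarrow> smooth (f i)) \<Longrightarrow> smooth (\<lambda>x. \<Prod>i\<in>I. f i x)"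
  by (induction I rule: infinite_finite_induct) (auto intro: smooth_const smooth_mult)

lemma smooth_bounded_linear: "bounded_linear L \<Longrightarrow> smooth f \<Longrightarrow> smooth (\<lambda>x. L (f x))"
  unfolding smooth_def using Ck_bounded_linear by blast

lemma smooth_compose_linear: "bounded_linear L \<Longrightarrow> smooth f \<Longrightarrow> smooth (\<lambda>x. f (L x + c))"
  unfolding smooth_def using Ck_compose_linear by blast

lemma smooth_compose_linear0: "bounded_linear L \<Longrightarrow> smooth f \<Longrightarrow> smooth (\<lambda>x. f (L x))"
  using smooth_compose_linear[of L f 0] by simp

lemma smooth_has_real_derivative:
  fixes f :: "real \<Rightarrow> real"
  assumes "smooth f"
  shows "(f has_real_derivative pd 1 f x) (at x)"
proof -
  obtain f' where "(f has_real_derivative f') (at x)"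
    using smooth_differentiable[OF assms] real_differentiable_def by blast
  then show ?thesis using pd_real[of f f' x 1] by simp
qed

lemma pd_sum:
  assumes "\<And>i. i \<in> I \<Longrightarrow> f i differentiable (at x)"
  shows "pd v (\<lambda>x. \<Sum>i\<in>I. f i x) x = (\<Sum>i\<in>I. pd v (f i) x)"
  by (rule pd_eqI[OF has_derivative_sum]) (rule has_derivative_pd[OF assms])

lemma pd_cong_open:
  assumes "open S" "x \<in> S" "\<And>y. y \<in> S \<Longrightarrow> f y = g y"
  shows "pd v f x = pd v g x"
proof -
  have "(f has_derivative D) (at x) \<longleftrightarrow> (g has_derivative D) (at x)" for D
    using has_derivative_transform_within_open[OF _ assms(1,2)] assms(3) by metis
  then show ?thesis unfolding pd_def frechet_derivative_def by simp
qed

subsection \<open>A smooth step\<close>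

text \<open>The factor \<open>1 / s ^ k\<close> makes the family closed under differentiation up to
  linear combinations, so that smoothness follows by an induction over all \<open>k\<close> at once.
  \<open>flat 0\<close> is the classical smooth function that vanishes to infinite order at the
  origin.\<close>

definition flat :: "nat \<Rightarrow> real \<Rightarrow> real" where
  "flat k s = (if s \<le> 0 then 0 else exp (- (1 / s)) / s ^ k)"

lemma flat_nonneg: "flat k s \<ge> 0"
  by (simp add: flat_def)

text \<open>Keep only the term of order \<open>k + 2\<close> in the series of
  \<open>exp (1 / s)\<close>. The quadratic rate leaves a spare power of \<open>s\<close> for the
  difference quotient at 0.\<close>

lemma flat_bound:
  assumes "s > 0"
  shows "flat k s \<le> fact (k + 2) * s\<^sup>2"
proof -
  have "(1 / s) ^ (k + 2) /\<^sub>R fact (k + 2) \<le> (\<Sum>n. (1 / s) ^ n /\<^sub>R fact n)"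
    using sum_le_suminf[OF summable_exp_generic[of "1 / s"], of "{k + 2}"] assms by simp
  then have "(1 / s) ^ (k + 2) / fact (k + 2) \<le> exp (1 / s)"
    by (simp add: exp_def divide_inverse_commute)
  then have "1 \<le> exp (1 / s) * fact (k + 2) * s ^ (k + 2)"
    using assms by (simp add: field_simps del: fact_Suc add_2_eq_Suc')
  then have "exp (- (1 / s)) \<le> fact (k + 2) * s ^ (k + 2)"
    by (simp add: exp_minus field_simps del: fact_Suc add_2_eq_Suc')
  then show ?thesis
    using assms by (simp add: flat_def field_simps power_add del: fact_Suc add_2_eq_Suc')
qed

lemma flat_deriv:
  "(flat k has_real_derivative flat (k + 2) s - real k * flat (k + 1) s) (at s)"
proof (cases s "0::real" rule: linorder_cases)
  case less
  have "((\<lambda>_. 0) has_real_derivative flat (k + 2) s - real k * flat (k + 1) s) (at s)"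
    using less by (simp add: flat_def)
  then show ?thesis
    by (rule has_field_derivative_transform_within_open[of _ _ _ "{..<0}"]) (use less in \<open>auto simp: flat_def\<close>)
next
  case equal
  \<comment> \<open>At the junction the difference quotient is estimated directly: it is zero on the
    left and at most a multiple of \<open>s\<close> on the right.\<close>
  have "((\<lambda>s. flat k s / s) \<longlongrightarrow> 0) (at 0)"
  proof (rule Lim_null_comparison[of _ "\<lambda>s. fact (k + 2) * \<bar>s\<bar>"])
    show "\<forall>\<^sub>F s in at 0. norm (flat k s / s) \<le> fact (k + 2) * \<bar>s\<bar>"
    proof (rule always_eventually, rule allI)
      fix s :: real
      show "norm (flat k s / s) \<le> fact (k + 2) * \<bar>s\<bar>"
      proof (cases "s > 0")
        case True
        then show ?thesis
          using flat_bound[OF True, of k] flat_nonneg[of k s]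
          by (simp add: field_simps power2_eq_square del: fact_Suc)
      next
        case False
        then have "flat k s = 0" by (simp add: flat_def)
        moreover have "0 \<le> fact (k + 2) * \<bar>s\<bar>" by (intro mult_nonneg_nonneg) auto
        ultimately show ?thesis by simp
      qed
    qed
    show "((\<lambda>s::real. fact (k + 2) * \<bar>s\<bar>) \<longlongrightarrow> 0) (at 0)"
      by (auto intro!: tendsto_eq_intros)
  qed
  then have "(flat k has_real_derivative 0) (at 0)"
    by (simp add: has_field_derivative_iff flat_def)
  then show ?thesis using equal by (simp add: flat_def)
next
  case greater
  have "((\<lambda>s. exp (- (1 / s)) / s ^ k) has_real_derivative
      (exp (- (1 / s)) * (1 / s\<^sup>2) * s ^ k - exp (- (1 / s)) * (real k * s ^ (k - 1))) / (s ^ k * s ^ k))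
      (at s)"
    using greater by (auto intro!: derivative_eq_intros simp: power2_eq_square)
  also have "(exp (- (1 / s)) * (1 / s\<^sup>2) * s ^ k - exp (- (1 / s)) * (real k * s ^ (k - 1))) / (s ^ k * s ^ k)
      = flat (k + 2) s - real k * flat (k + 1) s"
    using greater by (cases k) (auto simp: flat_def field_simps power2_eq_square)
  finally have "((\<lambda>s. exp (- (1 / s)) / s ^ k) has_real_derivative
      flat (k + 2) s - real k * flat (k + 1) s) (at s)" .
  then show ?thesis
    by (rule has_field_derivative_transform_within_open[of _ _ _ "{0<..}"]) (use greater in \<open>auto simp: flat_def\<close>)
qed

lemma smooth_flat: "smooth (flat k)"
proof -
  have "Ck n (flat k)" for n
  proof (induction n arbitrary: k)
    case 0
    show ?case
      using flat_deriv by (auto intro!: DERIV_continuous_on)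
  next
    case (Suc n)
    have "Ck n (\<lambda>s. flat (k + 2) s + (- real k) * flat (k + 1) s)"
      by (intro Ck_add Ck_mult Ck_const Suc)
    then show ?case
      by (intro Ck_Suc_real[OF flat_deriv]) simp
  qed
  then show ?thesis by (simp add: smooth_def)
qed

text \<open>The standard smooth transition from 0 to 1 across the unit interval. The denominator
  cannot vanish, since \<open>s\<close> or \<open>1 - s\<close> is positive. The time cut-offs and
  the partition of unity are made of it.\<close>

definition step :: "real \<Rightarrow> real" where
  "step s = flat 0 s / (flat 0 s + flat 0 (1 - s))"

lemma flat_pos: "s > 0 \<Longrightarrow> flat k s > 0"
  by (simp add: flat_def)

lemma flat0_mono: "s \<le> t \<Longrightarrow> flat 0 s \<le> flat 0 t"
  by (auto simp: flat_def frac_le)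

lemma step_denom_pos: "flat 0 s + flat 0 (1 - s) > 0"
proof (cases "s > 0")
  case True
  show ?thesis using flat_pos[OF True, of 0] flat_nonneg[of 0 "1 - s"] by linarith
next
  case False
  then have "flat 0 (1 - s) > 0" by (intro flat_pos) simp
  then show ?thesis using flat_nonneg[of 0 s] by linarith
qed

lemma smooth_step: "smooth step"
proof -
  have L: "bounded_linear (\<lambda>s::real. - s)"
    by (intro bounded_linear_minus bounded_linear_ident)
  have "smooth (\<lambda>s. flat 0 (1 - s))"
    using smooth_compose_linear[OF L smooth_flat, of 0 1] by simp
  from smooth_add[OF smooth_flat[of 0] this] have "smooth (\<lambda>s. flat 0 s + flat 0 (1 - s))" .
  from smooth_inverse[OF _ this] have "smooth (\<lambda>s. inverse (flat 0 s + flat 0 (1 - s)))"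
    using step_denom_pos by (simp add: less_imp_neq[symmetric])
  from smooth_mult[OF smooth_flat[of 0] this] show ?thesis
    by (simp add: step_def[abs_def] divide_inverse)
qed

lemma step_0: "s \<le> 0 \<Longrightarrow> step s = 0"
  by (simp add: step_def flat_def)

lemma step_1: "s \<ge> 1 \<Longrightarrow> step s = 1"
  by (simp add: step_def flat_def)

lemma step_mono:
  assumes "s \<le> t"
  shows "step s \<le> step t"
proof -
  \<comment> \<open>After cross multiplication the common product \<open>flat 0 s * flat 0 t\<close>
    cancels, and two products of monotone factors remain to be compared.\<close>
  have "flat 0 s * flat 0 (1 - t) \<le> flat 0 t * flat 0 (1 - s)"
    by (intro mult_mono flat0_mono flat_nonneg) (use assms in auto)
  then have "flat 0 s * (flat 0 t + flat 0 (1 - t)) \<le> flat 0 t * (flat 0 s + flat 0 (1 - s))"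
    by (simp add: distrib_left mult.commute)
  then show ?thesis
    unfolding step_def using step_denom_pos[of s] step_denom_pos[of t]
    by (simp add: divide_le_eq le_divide_eq mult.commute)
qed

lemma step_range: "0 \<le> step s" "step s \<le> 1"
  using step_denom_pos[of s] flat_nonneg[of 0 s] flat_nonneg[of 0 "1 - s"]
  by (simp_all add: step_def)

lemma smooth_affine_real: "smooth f \<Longrightarrow> smooth (\<lambda>s::real. f (a * s + c))"
  using smooth_compose_linear[OF bounded_linear_mult_right[of a], of f c] .

section \<open>Unfolding integrals of periodic functions\<close>

lemma borel_measurable_translate:
  fixes f :: "'a::euclidean_space \<Rightarrow> 'b::topological_space"
  assumes "f \<in> borel_measurable borel"
  shows "(\<lambda>x. f (c + x)) \<in> borel_measurable borel"
  using measurable_compose[OF _ assms, of "\<lambda>x. c + x" borel] by simp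

lemma lborel_integrable_translate:
  fixes f :: "'a::euclidean_space \<Rightarrow> 'b::{banach, second_countable_topology}"
  assumes "f \<in> borel_measurable borel"
  shows "integrable lborel (\<lambda>x. f (c + x)) \<longleftrightarrow> integrable lborel f"
  using integrable_distr_eq[of "(+) c" lborel borel f] assms
  by (simp add: lborel_distr_plus)

lemma lborel_integral_translate:
  fixes f :: "'a::euclidean_space \<Rightarrow> 'b::{banach, second_countable_topology}"
  assumes "f \<in> borel_measurable borel"
  shows "integral\<^sup>L lborel (\<lambda>x. f (c + x)) = integral\<^sup>L lborel f"
  using integral_distr[of "(+) c" lborel borel f] assms
  by (simp add: lborel_distr_plus)

lemma integrable_bounded_mult:
  fixes f g :: "'a \<Rightarrow> real"
  assumes "integrable M f" "g \<in> borel_measurable M" "\<And>x. \<bar>g x\<bar> \<le> B"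
  shows "integrable M (\<lambda>x. f x * g x)"
proof (rule Bochner_Integration.integrable_bound)
  show "integrable M (\<lambda>x. B * f x)" using assms(1) by simp
  show "AE x in M. norm (f x * g x) \<le> norm (B * f x)"
  proof (rule AE_I2)
    fix x
    have "\<bar>g x\<bar> \<le> \<bar>B\<bar>" using assms(3)[of x] by linarith
    then show "norm (f x * g x) \<le> norm (B * f x)"
      using mult_right_mono[of "\<bar>g x\<bar>" "\<bar>B\<bar>" "\<bar>f x\<bar>"] by (simp add: abs_mult mult.commute)
  qed
qed (use assms in auto)


text \<open>On the support of \<open>\<zeta>\<close> the translates of the cell \<open>Q\<close> by
  the \<open>s i\<close> cover almost every point exactly once. Splitting the integral accordingly
  and shifting every piece back to \<open>Q\<close> leaves \<open>G\<close> unchanged by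
  periodicity, while the translates of \<open>\<zeta>\<close> add up. A finite \<open>I\<close> is
  enough because only the support of \<open>\<zeta>\<close> has to be covered.\<close>

lemma unfold_integral:
  fixes G \<zeta> :: "'a::euclidean_space \<Rightarrow> real"
  assumes fin: "finite I" and Q[measurable]: "Q \<in> sets borel"
    and G[measurable]: "G \<in> borel_measurable borel"
    and per: "\<And>i x. i \<in> I \<Longrightarrow> G (s i + x) = G x"
    and tile: "AE x in lborel. \<zeta> x \<noteq> 0 \<longrightarrow> (\<Sum>i\<in>I. indicat_real Q (x - s i)) = 1"
    and int: "set_integrable lborel Q G"
    and \<zeta>[measurable]: "\<zeta> \<in> borel_measurable borel" and B: "\<And>x. \<bar>\<zeta> x\<bar> \<le> B"
  shows "integrable lborel (\<lambda>x. G x * \<zeta> x)" (is ?int)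
    and "(LINT x|lborel. G x * \<zeta> x) = (LINT x:Q|lborel. G x * (\<Sum>i\<in>I. \<zeta> (s i + x)))" (is ?eq)
proof -
  define F where "F i x = indicat_real Q (x - s i) * G x * \<zeta> x" for i x
  have F[measurable]: "F i \<in> borel_measurable borel" for i
    unfolding F_def by measurable
  have FT: "F i (s i + x) = indicator Q x * G x * \<zeta> (s i + x)" if "i \<in> I" for i x
    using per[OF that] by (simp add: F_def)
  have I0: "integrable lborel (\<lambda>x. indicator Q x * G x * \<zeta> (s i + x))" for i
    by (rule integrable_bounded_mult[where B=B])
       (use int in \<open>simp_all add: set_integrable_def B borel_measurable_translate[OF \<zeta>]\<close>)
  have I: "integrable lborel (F i)" if "i \<in> I" for i
    using lborel_integrable_translate[OF F, of i "s i"] I0 by (simp add: FT[OF that])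
  have L: "integral\<^sup>L lborel (F i) = (LINT x|lborel. indicator Q x * G x * \<zeta> (s i + x))"
    if "i \<in> I" for i
    using lborel_integral_translate[OF F, of i "s i"] by (simp add: FT[OF that])
  have AE: "AE x in lborel. G x * \<zeta> x = (\<Sum>i\<in>I. F i x)"
    using tile by eventually_elim (auto simp: F_def sum_distrib_right[symmetric])
  have S: "integrable lborel (\<lambda>x. \<Sum>i\<in>I. F i x)"
    using I by (rule Bochner_Integration.integrable_sum)
  show ?int
    by (subst integrable_cong_AE[OF _ _ AE]) (use S in auto)
  have "(LINT x|lborel. G x * \<zeta> x) = (LINT x|lborel. (\<Sum>i\<in>I. F i x))"
    by (rule integral_cong_AE[OF _ _ AE]) auto
  also have "\<dots> = (\<Sum>i\<in>I. (LINT x|lborel. indicator Q x * G x * \<zeta> (s i + x)))"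
    by (simp add: I L)
  also have "\<dots> = (LINT x|lborel. (\<Sum>i\<in>I. indicator Q x * G x * \<zeta> (s i + x)))"
    by (simp add: I0)
  finally show ?eq
    by (simp add: set_lebesgue_integral_def sum_distrib_left mult.assoc)
qed

subsection \<open>The lattice of periods\<close>

definition period :: "real \<Rightarrow> (3 \<Rightarrow> int) \<Rightarrow> real^3" where
  "period P n = P *\<^sub>R (\<chi> i. real_of_int (n i))"

lemma period_nth [simp]: "period P n $ i = P * real_of_int (n i)"
  by (simp add: period_def)

text \<open>The index vectors of the cells that meet the cube of points with coordinates at most
  \<open>2 * P\<close> in modulus: there the rounded value of \<open>x $ i / P\<close> lies between
  -2 and 2. The form as a \<open>PiE\<close> lets sums of products over it factor.\<close>

definition near :: "(3 \<Rightarrow> int) set" where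
  "near = PiE UNIV (\<lambda>_. {-2..2})"

lemma finite_near [simp]: "finite near"
  unfolding near_def by (intro finite_PiE) auto

lemma near_iff: "n \<in> near \<longleftrightarrow> (\<forall>i. -2 \<le> n i \<and> n i \<le> 2)"
  by (auto simp: near_def PiE_def extensional_def)

lemma periodic_axis:
  assumes "periodic P g"
  shows "g (x + (P * real_of_int k) *\<^sub>R axis i 1) = g x"
proof (induction k arbitrary: x rule: int_induct[of _ 0])
  case (step1 k)
  have "g (x + (P * real_of_int (k + 1)) *\<^sub>R axis i 1)
      = g ((x + P *\<^sub>R axis i 1) + (P * real_of_int k) *\<^sub>R axis i 1)"
    by (simp add: algebra_simps)
  also have "\<dots> = g x" using assms unfolding step1 by (simp add: periodic_def)
  finally show ?case .
next
  case (step2 k)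
  have "g x = g ((x - P *\<^sub>R axis i 1) + P *\<^sub>R axis i 1)" by simp
  also have "\<dots> = g (x - P *\<^sub>R axis i 1)"
    using assms unfolding periodic_def by blast
  also have "\<dots> = g ((x - P *\<^sub>R axis i 1) + (P * real_of_int k) *\<^sub>R axis i 1)"
    by (rule step2(2)[symmetric])
  finally show ?case by (simp add: algebra_simps)
qed simp

lemma periodic_period:
  assumes "periodic P g"
  shows "g (period P n + x) = g x"
proof -
  have "g (x + (\<Sum>i\<in>A. (P * real_of_int (n i)) *\<^sub>R axis i 1)) = g x" if "finite A" for A
    using that
  proof (induction A)
    case (insert a A)
    have "g (x + (\<Sum>i\<in>insert a A. (P * real_of_int (n i)) *\<^sub>R axis i 1))
        = g ((x + (\<Sum>i\<in>A. (P * real_of_int (n i)) *\<^sub>R axis i 1)) + (P * real_of_int (n a)) *\<^sub>R axis a 1)"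
      using insert by (simp add: algebra_simps)
    then show ?case by (simp only: periodic_axis[OF assms] insert)
  qed simp
  from this[of UNIV] have "g (x + (\<Sum>i\<in>UNIV. (P * real_of_int (n i)) *\<^sub>R axis i 1)) = g x" by simp
  moreover have "(\<Sum>i\<in>UNIV. (P * real_of_int (n i)) *\<^sub>R axis i 1) = period P n"
    by (simp add: vec_eq_iff axis_def if_distrib cong: if_cong)
  ultimately show ?thesis by (simp add: add.commute)
qed

lemma torus_iff: "x \<in> torus P \<longleftrightarrow> (\<forall>i. \<bar>x $ i\<bar> \<le> P / 2)"
proof -
  have "- P / 2 \<le> x $ i \<and> x $ i \<le> P / 2 \<longleftrightarrow> \<bar>x $ i\<bar> \<le> P / 2" for i
    by (auto simp: abs_le_iff)
  then show ?thesis by (simp add: torus_def mem_box_cart)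
qed

lemma torus_borel [measurable]: "torus P \<in> sets borel"
  by (simp add: torus_def)

text \<open>The closed cells overlap on their faces, which the last hypothesis excludes. Off the
  faces, the only cell containing the point is the one indexed by the rounded coordinates, and the
  size restriction puts that index in \<open>near\<close>.\<close>

lemma torus_tile:
  assumes "P > 0" "\<And>i. \<bar>x $ i\<bar> \<le> 2 * P" "\<And>i. x $ i / P - 1 / 2 \<notin> \<int>"
  shows "(\<Sum>n\<in>near. indicat_real (torus P) (x - period P n)) = 1"
proof -
  define n0 where "n0 i = \<lfloor>x $ i / P + 1 / 2\<rfloor>" for i
  have iff: "x - period P n \<in> torus P \<longleftrightarrow> n = n0" for n
  proof -
    have "\<bar>x $ i - P * real_of_int (n i)\<bar> \<le> P / 2 \<longleftrightarrow> n i = n0 i" for i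
    proof -
      have "\<bar>x $ i - P * real_of_int (n i)\<bar> = P * \<bar>x $ i / P - real_of_int (n i)\<bar>"
      proof -
        have "x $ i - P * real_of_int (n i) = P * (x $ i / P - real_of_int (n i))"
          using assms(1) by (simp add: right_diff_distrib)
        then show ?thesis using assms(1) by (simp only: abs_mult abs_of_pos)
      qed
      then have "\<bar>x $ i - P * real_of_int (n i)\<bar> \<le> P / 2 \<longleftrightarrow> \<bar>x $ i / P - real_of_int (n i)\<bar> \<le> 1 / 2"
        using assms(1) by (simp add: field_simps)
      also have "\<dots> \<longleftrightarrow> real_of_int (n i) \<le> x $ i / P + 1 / 2 \<and> x $ i / P + 1 / 2 < real_of_int (n i) + 1"
      proof -
        have "x $ i / P - 1 / 2 \<noteq> real_of_int (n i)"
          using assms(3)[of i] by (metis Ints_of_int)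
        then show ?thesis by linarith
      qed
      also have "\<dots> \<longleftrightarrow> n i = n0 i"
        unfolding n0_def by linarith
      finally show ?thesis .
    qed
    then show ?thesis by (auto simp: torus_iff fun_eq_iff)
  qed
  have "n0 \<in> near"
  proof -
    have "-2 \<le> n0 i \<and> n0 i \<le> 2" for i
    proof -
      have "\<bar>x $ i / P\<bar> \<le> 2" using assms(1) assms(2)[of i] by (simp add: field_simps)
      then show ?thesis unfolding n0_def by linarith
    qed
    then show ?thesis by (simp add: near_iff)
  qed
  then show ?thesis by (simp add: indicator_def iff)
qed

text \<open>A countable union of null hyperplanes. Stated for any Euclidean space so as to serve
  space and space-time alike.\<close>

lemma AE_coordinate_notin_countable:
  assumes "countable C" "b \<in> Basis"
  shows "AE z::'a::euclidean_space in lborel. z \<bullet> b \<notin> C"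
proof -
  have "AE z::'a in lborel. z \<bullet> b \<noteq> c" for c
  proof -
    have "negligible {z::'a. b \<bullet> z = c}"
      using assms(2) by (intro negligible_hyperplane) auto
    then have "{z::'a. b \<bullet> z = c} \<in> null_sets lborel"
      using null_sets_completion_iff[of "{z::'a. b \<bullet> z = c}" lborel] closed_hyperplane
      by (simp add: negligible_iff_null_sets)
    then show ?thesis
      by (rule AE_I'[of _ lborel]) (auto simp: inner_commute)
  qed
  then have "AE z::'a in lborel. \<forall>c\<in>C. z \<bullet> b \<noteq> c"
    using assms(1) by (subst AE_ball_countable) auto
  then show ?thesis by eventually_elim auto
qed

lemma countable_half_integer_points:
  fixes P :: real
  assumes "P > 0"
  shows "countable {y. y / P - 1 / 2 \<in> \<int>}"
proof -
  have eq: "y = P * ((y / P - 1 / 2) + 1 / 2)" for y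
    using assms by simp
  have "{y. y / P - 1 / 2 \<in> \<int>} \<subseteq> (\<lambda>k. P * (k + 1 / 2)) ` \<int>"
    by (rule subsetI, rule image_eqI, rule eq) simp
  then show ?thesis
    by (rule countable_subset) (simp add: countable_image countable_int)
qed

lemma AE_torus_tile:
  assumes "P > 0"
  shows "AE x in lborel. (\<forall>i. \<bar>x $ i\<bar> \<le> 2 * P) \<longrightarrow>
     (\<Sum>n\<in>near. indicat_real (torus P) (x - period P n)) = 1"
proof -
  have "AE x::real^3 in lborel. x $ i / P - 1 / 2 \<notin> \<int>" for i
    using AE_coordinate_notin_countable[OF countable_half_integer_points[OF assms], of "axis i (1::real) :: real^3"]
    by (simp add: inner_axis Basis_real_def)
  then have "AE x::real^3 in lborel. \<forall>i\<in>UNIV. x $ i / P - 1 / 2 \<notin> \<int>"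
    by (subst AE_ball_countable) auto
  then show ?thesis
    by eventually_elim (auto intro: torus_tile[OF assms])
qed

lemma AE_spacetime_torus_tile:
  assumes "P > 0"
  shows "AE z::real \<times> (real^3) in lborel. (\<forall>i. \<bar>snd z $ i\<bar> \<le> 2 * P) \<longrightarrow>
     (\<Sum>n\<in>near. indicat_real (UNIV \<times> torus P) (z - (0, period P n))) = 1"
proof -
  have "AE z::real \<times> (real^3) in lborel. snd z $ i / P - 1 / 2 \<notin> \<int>" for i
  proof -
    have "(0::real, axis i 1::real^3) \<in> Basis"
      by (auto simp: Basis_prod_def axis_in_Basis_iff)
    from AE_coordinate_notin_countable[OF countable_half_integer_points[OF assms] this]
    show ?thesis by eventually_elim (auto simp: inner_prod_def inner_axis)
  qed
  then have "AE z::real \<times> (real^3) in lborel. \<forall>i\<in>UNIV. snd z $ i / P - 1 / 2 \<notin> \<int>"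
    by (subst AE_ball_countable) auto
  then show ?thesis
  proof eventually_elim
    case (elim z)
    have *: "indicat_real (UNIV \<times> torus P) (z - (0, period P n)) = indicator (torus P) (snd z - period P n)" for n
      by (simp add: indicator_def mem_Times_iff)
    show ?case
      unfolding * using elim torus_tile[OF assms, of "snd z"] by blast
  qed
qed

subsection \<open>A smooth partition of unity\<close>

text \<open>In each coordinate the difference of two shifted steps is a bump supported in
  \<open>[- P, P]\<close>, whose translates by multiples of \<open>P\<close> telescope to 1.\<close>

definition tile :: "real \<Rightarrow> real^3 \<Rightarrow> real" where
  "tile P x = (\<Prod>i\<in>UNIV. step (x $ i / P + 1) - step (x $ i / P))"

lemma smooth_tile: "smooth (tile P)"
proof -
  have 1: "smooth (\<lambda>x::real^3. step (x $ i / P + c))" for i c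
  proof -
    have "bounded_linear (\<lambda>x::real^3. x $ i / P)"
      by (rule bounded_linear_compose[OF bounded_linear_divide bounded_linear_vec_nth])
    from smooth_compose_linear[OF this smooth_step, of c] show ?thesis .
  qed
  have "smooth (\<lambda>x::real^3. step (x $ i / P + 1) + - 1 * step (x $ i / P + 0))" for i
    using smooth_add[OF 1[of i 1] smooth_mult[OF smooth_const[of "-1"] 1[of i 0]]] .
  then have "smooth (\<lambda>x::real^3. step (x $ i / P + 1) - step (x $ i / P))" for i
    by simp
  then show ?thesis unfolding tile_def by (rule smooth_prod)
qed

lemma tile_nonneg: "tile P x \<ge> 0"
  unfolding tile_def by (intro prod_nonneg) (auto intro!: step_mono)

lemma tile_support:
  assumes "P > 0" "tile P x \<noteq> 0"
  shows "\<bar>x $ i\<bar> \<le> P"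
proof (rule ccontr)
  assume "\<not> \<bar>x $ i\<bar> \<le> P"
  then have "x $ i / P + 1 \<le> 0 \<or> x $ i / P \<ge> 1"
    using assms(1) by (auto simp: field_simps abs_le_iff)
  then have "step (x $ i / P + 1) - step (x $ i / P) = 0"
    using step_0[of "x $ i / P + 1"] step_0[of "x $ i / P"] step_1[of "x $ i / P + 1"] step_1[of "x $ i / P"]
    by linarith
  then have "tile P x = 0" unfolding tile_def by (intro prod_zero) auto
  then show False using assms(2) by simp
qed

lemma tile_sum:
  assumes "P > 0" "\<And>i. \<bar>x $ i\<bar> \<le> 2 * P"
  shows "(\<Sum>n\<in>near. tile P (period P n + x)) = 1"
proof -
  have "(\<Sum>n\<in>near. tile P (period P n + x))
      = (\<Sum>n\<in>PiE UNIV (\<lambda>_. {-2..2}). \<Prod>i\<in>UNIV. step (real_of_int (n i) + x $ i / P + 1) - step (real_of_int (n i) + x $ i / P))"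
    unfolding near_def tile_def using assms(1) by (simp add: add_divide_distrib)
  also have "\<dots> = (\<Prod>i\<in>UNIV. \<Sum>m\<in>{-2..2}. step (real_of_int m + x $ i / P + 1) - step (real_of_int m + x $ i / P))"
    by (rule prod_sum_PiE[symmetric]) simp_all
  also have "\<dots> = (\<Prod>i\<in>(UNIV::3 set). 1)"
  proof (rule prod.cong)
    fix i :: 3
    have e: "{-2..2} = {-2, -1, 0, 1, 2::int}"
      by (rule set_eqI) (simp, arith)
    have "(\<Sum>m\<in>{-2..2}. step (real_of_int m + x $ i / P + 1) - step (real_of_int m + x $ i / P))
        = step (x $ i / P + 3) - step (x $ i / P - 2)"
      unfolding e by (simp add: add.commute)
    moreover have "\<bar>x $ i / P\<bar> \<le> 2" using assms(1) assms(2)[of i] by (simp add: field_simps)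
    ultimately show "(\<Sum>m\<in>{-2..2}. step (real_of_int m + x $ i / P + 1) - step (real_of_int m + x $ i / P)) = 1"
      using step_1[of "x $ i / P + 3"] step_0[of "x $ i / P - 2"] by linarith
  qed simp
  finally show ?thesis by simp
qed

text \<open>
  The sum over \<^const>\<open>near\<close> contains all translates of the support of \<open>\<zeta>\<close> that matter only near
  the fundamental cell; the open condition lets the identity be differentiated.
\<close>

definition periodization :: "real \<Rightarrow> (real^3 \<Rightarrow> real) \<Rightarrow> (real^3 \<Rightarrow> real) \<Rightarrow> bool" where
  "periodization P \<zeta> \<tau> \<longleftrightarrow> smooth \<zeta> \<and> smooth \<tau> \<and> (\<forall>x. \<zeta> x \<noteq> 0 \<longrightarrow> (\<forall>i. \<bar>x $ i\<bar> \<le> P)) \<and>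
     (\<forall>x. (\<forall>i. \<bar>x $ i\<bar> < 2 * P) \<longrightarrow> (\<Sum>n\<in>near. \<zeta> (period P n + x)) = \<tau> x)"

lemma periodization_tile:
  assumes "P > 0" "smooth \<tau>" "periodic P \<tau>"
  shows "periodization P (\<lambda>x. tile P x * \<tau> x) \<tau>"
proof -
  have "(\<Sum>n\<in>near. tile P (period P n + x) * \<tau> (period P n + x)) = \<tau> x"
    if "\<forall>i. \<bar>x $ i\<bar> < 2 * P" for x
    using tile_sum[OF assms(1), of x] that
    by (simp add: periodic_period[OF assms(3)] sum_distrib_right[symmetric] less_imp_le)
  then show ?thesis
    using smooth_mult[OF smooth_tile assms(2)] assms(2) tile_support[OF assms(1)]
    by (auto simp: periodization_def)
qed

lemma pd_eq_0_outside_closed: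
  assumes "closed K" "\<And>x. x \<notin> K \<Longrightarrow> f x = 0" "x \<notin> K"
  shows "pd v f x = 0"
proof -
  have "pd v f x = pd v (\<lambda>_. 0) x"
    by (rule pd_cong_open[of "- K"]) (use assms in auto)
  also have "\<dots> = 0" by (rule pd_eqI[where D="\<lambda>_. 0"]) simp
  finally show ?thesis .
qed

lemma compact_two_period_box: "compact {x::real^3. \<forall>i. \<bar>x $ i\<bar> \<le> P}"
proof -
  have "{x::real^3. \<forall>i. \<bar>x $ i\<bar> \<le> P} = cbox (\<chi> i. - P) (\<chi> i. P)"
    by (auto simp: mem_box_cart abs_le_iff minus_le_iff)
  then show ?thesis by (simp only: compact_cbox)
qed

text \<open>Finitely many translates are summed and the identity holds on an open set, so it may be
  differentiated term by term. As a result no derivative of the partition of unity survives in the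
  unfolded weak equations.\<close>

lemma periodization_pd:
  assumes "periodization P \<zeta> \<tau>"
  shows "periodization P (pd v \<zeta>) (pd v \<tau>)"
proof -
  have sm: "smooth \<zeta>" "smooth \<tau>" and z: "\<And>x. \<zeta> x \<noteq> 0 \<Longrightarrow> \<forall>i. \<bar>x $ i\<bar> \<le> P"
    and s: "\<And>x. \<forall>i. \<bar>x $ i\<bar> < 2 * P \<Longrightarrow> (\<Sum>n\<in>near. \<zeta> (period P n + x)) = \<tau> x"
    using assms by (auto simp: periodization_def)
  have "(\<Sum>n\<in>near. pd v \<zeta> (period P n + x)) = pd v \<tau> x" if x: "\<forall>i. \<bar>x $ i\<bar> < 2 * P" for x
  proof -
    have sh: "smooth (\<lambda>x. \<zeta> (x + c))" for c
      using smooth_compose_linear[OF bounded_linear_ident sm(1)] .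
    have "pd v \<zeta> (x + c) = pd v (\<lambda>x. \<zeta> (x + c)) x" for c
      using pd_compose_linear[OF bounded_linear_ident smooth_differentiable[OF sm(1)], of v] by simp
    then have "(\<Sum>n\<in>near. pd v \<zeta> (x + period P n)) = (\<Sum>n\<in>near. pd v (\<lambda>x. \<zeta> (x + period P n)) x)"
      by simp
    also have "\<dots> = pd v (\<lambda>x. \<Sum>n\<in>near. \<zeta> (x + period P n)) x"
      using pd_sum[of near "\<lambda>n x. \<zeta> (x + period P n)" x v] smooth_differentiable[OF sh] by simp
    also have "\<dots> = pd v \<tau> x"
    proof (rule pd_cong_open[of "{x. \<forall>i. \<bar>x $ i\<bar> < 2 * P}"])
      have "{x::real^3. \<forall>i. \<bar>x $ i\<bar> < 2 * P} = box (\<chi> i. - (2 * P)) (\<chi> i. 2 * P)"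
        by (auto simp: mem_box_cart abs_less_iff minus_less_iff)
      then show "open {x::real^3. \<forall>i. \<bar>x $ i\<bar> < 2 * P}" by (simp only: open_box)
    qed (use x s in \<open>auto simp: add.commute\<close>)
    finally show ?thesis by (simp add: add.commute)
  qed
  moreover have "pd v \<zeta> x = 0" if "\<not> (\<forall>i. \<bar>x $ i\<bar> \<le> P)" for x
    by (rule pd_eq_0_outside_closed[OF compact_imp_closed[OF compact_two_period_box]])
       (use that z in auto)
  ultimately show ?thesis
    using smooth_pd[OF sm(1)] smooth_pd[OF sm(2)] unfolding periodization_def by blast
qed

lemma bounded_of_compact_support:
  fixes f :: "'a::topological_space \<Rightarrow> real"
  assumes "continuous_on UNIV f" "compact K" "\<And>x. x \<notin> K \<Longrightarrow> f x = 0"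
  obtains B where "\<And>x. \<bar>f x\<bar> \<le> B"
proof -
  have "bounded (f ` K)"
    by (intro compact_imp_bounded compact_continuous_image continuous_on_subset[OF assms(1)] assms) auto
  then obtain B where B: "\<forall>x\<in>K. \<bar>f x\<bar> \<le> B" by (auto simp: bounded_iff)
  have "\<bar>f x\<bar> \<le> max B 0" for x
    using B assms(3)[of x] by (cases "x \<in> K") (auto simp: le_max_iff_disj)
  then show ?thesis by (rule that)
qed

lemma periodization_bounded:
  assumes "periodization P \<zeta> \<tau>"
  obtains B where "\<And>x. \<bar>\<zeta> x\<bar> \<le> B"
  by (rule bounded_of_compact_support[OF _ compact_two_period_box[of P], of \<zeta>])
     (use assms in \<open>auto simp: periodization_def intro: smooth_continuous\<close>)

lemma smooth_borel_measurable:
  fixes f :: "'a::euclidean_space \<Rightarrow> 'b::euclidean_space"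
  shows "smooth f \<Longrightarrow> f \<in> borel_measurable borel"
  by (intro borel_measurable_continuous_onI smooth_continuous)

lemma periodization_support:
  assumes "P > 0" "periodization P \<zeta> \<tau>" "\<zeta> x \<noteq> 0"
  shows "\<bar>x $ i\<bar> \<le> 2 * P"
proof -
  have "\<bar>x $ i\<bar> \<le> P" using assms(2,3) by (auto simp: periodization_def)
  then show ?thesis using assms(1) by simp
qed

lemma periodization_sum_torus:
  assumes "P > 0" "periodization P \<zeta> \<tau>" "x \<in> torus P"
  shows "(\<Sum>n\<in>near. \<zeta> (period P n + x)) = \<tau> x"
proof -
  have "\<bar>x $ i\<bar> < 2 * P" for i
  proof -
    have "\<bar>x $ i\<bar> \<le> P / 2" using assms(3) by (simp add: torus_iff)
    then show ?thesis using assms(1) by linarith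
  qed
  then show ?thesis using assms(2) by (simp add: periodization_def)
qed

lemma unfold_space:
  assumes "P > 0" "g \<in> borel_measurable borel" "periodic P g" "set_integrable lborel (torus P) g"
    and \<zeta>: "periodization P \<zeta> \<tau>"
  shows "integrable lborel (\<lambda>x. g x * \<zeta> x)"
    and "(LINT x|lborel. g x * \<zeta> x) = (LINT x:torus P|lborel. g x * \<tau> x)"
proof -
  obtain B where B: "\<And>x. \<bar>\<zeta> x\<bar> \<le> B" using periodization_bounded[OF \<zeta>] by blast
  have supp: "\<zeta> x \<noteq> 0 \<Longrightarrow> \<forall>i. \<bar>x $ i\<bar> \<le> 2 * P" for x
    using periodization_support[OF assms(1) \<zeta>] by blast
  have ae: "AE x in lborel. \<zeta> x \<noteq> 0 \<longrightarrow> (\<Sum>n\<in>near. indicat_real (torus P) (x - period P n)) = 1"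
    using AE_torus_tile[OF assms(1)] by eventually_elim (use supp in blast)
  have m: "\<zeta> \<in> borel_measurable borel"
    using \<zeta> by (auto simp: periodization_def intro: smooth_borel_measurable)
  note * = unfold_integral[where I=near and Q="torus P" and G=g and \<zeta>=\<zeta> and s="period P" and B=B,
      OF finite_near torus_borel assms(2) periodic_period[OF assms(3)] ae assms(4) m B]
  show "integrable lborel (\<lambda>x. g x * \<zeta> x)" by (rule *(1))
  have "(\<Sum>n\<in>near. \<zeta> (period P n + x)) = \<tau> x" if "x \<in> torus P" for x
    by (rule periodization_sum_torus[OF assms(1) \<zeta> that])
  then show "(LINT x|lborel. g x * \<zeta> x) = (LINT x:torus P|lborel. g x * \<tau> x)"
    unfolding *(2) by (intro set_lebesgue_integral_cong) auto
qed

text \<open>The lattice acts on the space variable alone. Two forms of the unfolded integral are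
  recorded: iterated, for the equations in time of the single modes, and over the slab, for
  combining several terms pointwise before integrating.\<close>

lemma unfold_spacetime:
  fixes \<psi> :: "real \<Rightarrow> real"
  assumes "P > 0" and G: "G \<in> borel_measurable borel" and "\<And>t. periodic P (\<lambda>x. G (t, x))"
    and int: "set_integrable lborel (UNIV \<times> torus P) G"
    and \<zeta>: "periodization P \<zeta> \<tau>"
    and \<psi>: "continuous_on UNIV \<psi>" and B1: "\<And>t. \<bar>\<psi> t\<bar> \<le> B1"
  shows "integrable lborel (\<lambda>z. G z * (\<psi> (fst z) * \<zeta> (snd z)))"
    and "integrable lborel (\<lambda>t. \<psi> t * (LINT x:torus P|lborel. G (t, x) * \<tau> x))"
    and "(LINT z|lborel. G z * (\<psi> (fst z) * \<zeta> (snd z)))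
       = (LINT t|lborel. \<psi> t * (LINT x:torus P|lborel. G (t, x) * \<tau> x))"
    and "set_integrable lborel (UNIV \<times> torus P) (\<lambda>z. G z * (\<psi> (fst z) * \<tau> (snd z)))"
    and "(LINT z|lborel. G z * (\<psi> (fst z) * \<zeta> (snd z)))
       = (LINT z:UNIV \<times> torus P|lborel. G z * (\<psi> (fst z) * \<tau> (snd z)))"
proof -
  obtain B where B: "\<And>x. \<bar>\<zeta> x\<bar> \<le> B" using periodization_bounded[OF \<zeta>] by blast
  have supp: "\<zeta> x \<noteq> 0 \<Longrightarrow> \<forall>i. \<bar>x $ i\<bar> \<le> 2 * P" for x
    using periodization_support[OF assms(1) \<zeta>] by blast
  have ae: "AE z in lborel. \<psi> (fst z) * \<zeta> (snd z) \<noteq> 0 \<longrightarrow>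
      (\<Sum>n\<in>near. indicat_real (UNIV \<times> torus P) (z - (0, period P n))) = 1"
    using AE_spacetime_torus_tile[OF assms(1)] by eventually_elim (use supp mult_zero_right in metis)
  have [measurable]: "\<zeta> \<in> borel_measurable borel" "\<psi> \<in> borel_measurable borel" "\<tau> \<in> borel_measurable borel"
    using \<zeta> \<psi> by (auto simp: periodization_def intro: smooth_borel_measurable borel_measurable_continuous_onI)
  have m: "(\<lambda>z. \<psi> (fst z) * \<zeta> (snd z)) \<in> borel_measurable borel"
    by (simp add: borel_prod[symmetric])
  have B2: "\<bar>\<psi> (fst z) * \<zeta> (snd z)\<bar> \<le> B1 * B" for z
    unfolding abs_mult by (intro mult_mono B B1) (use B1 in \<open>auto intro: order_trans[OF abs_ge_zero]\<close>)
  have Q: "UNIV \<times> torus P \<in> sets (borel :: (real \<times> (real^3)) measure)"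
    by (simp add: borel_prod[symmetric])
  have per: "G ((0, period P n) + z) = G z" for n z
    using periodic_period[OF assms(3)[of "fst z"], of n "snd z"] by (simp add: plus_prod_def)
  note u = unfold_integral[where I=near and Q="UNIV \<times> torus P" and G=G and s="\<lambda>n. (0, period P n)"
      and \<zeta>="\<lambda>z. \<psi> (fst z) * \<zeta> (snd z)" and B="B1 * B"]
  note u1 = u[OF finite_near Q G per]
  note u2 = u1[OF ae]
  note u3 = u2[OF int m]
  note * = u3[OF B2]
  show "integrable lborel (\<lambda>z. G z * (\<psi> (fst z) * \<zeta> (snd z)))" by (rule *(1))
  have per1: "(\<Sum>n\<in>near. \<zeta> (period P n + x)) = \<tau> x" if "x \<in> torus P" for x
    by (rule periodization_sum_torus[OF assms(1) \<zeta> that])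
  define F where "F = (\<lambda>(t, x). indicator (torus P) x * (G (t, x) * (\<psi> t * \<tau> x)))"
  have Feq: "F z = indicator (UNIV \<times> torus P) z *\<^sub>R
      (G z * (\<Sum>n\<in>near. \<psi> (fst ((0, period P n) + z)) * \<zeta> (snd ((0, period P n) + z))))" for z
    by (cases z) (auto simp: F_def indicator_def per1 sum_distrib_left[symmetric])
  \<comment> \<open>The definition of a periodization does not make \<open>\<tau>\<close> periodic,
    so \<open>\<tau>\<close> is bounded on the cell and the indicator is carried along with
    it.\<close>
  obtain B3 where B3: "\<And>x. x \<in> torus P \<Longrightarrow> \<bar>\<tau> x\<bar> \<le> B3"
  proof -
    have "bounded (\<tau> ` torus P)"
      using \<zeta> unfolding torus_def
      by (intro compact_imp_bounded compact_continuous_image compact_cbox)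
         (auto simp: periodization_def intro: continuous_on_subset smooth_continuous)
    then show ?thesis using that by (auto simp: bounded_iff)
  qed
  have "integrable lborel (\<lambda>z. (indicator (UNIV \<times> torus P) z *\<^sub>R G z) * (\<psi> (fst z) * (indicator (torus P) (snd z) * \<tau> (snd z))))"
  proof (rule integrable_bounded_mult)
    show "integrable lborel (\<lambda>z. indicator (UNIV \<times> torus P) z *\<^sub>R G z)"
      using int by (simp add: set_integrable_def)
    show "(\<lambda>z. \<psi> (fst z) * (indicator (torus P) (snd z) * \<tau> (snd z))) \<in> borel_measurable lborel"
      by (simp add: lborel_prod[symmetric])
    show "\<bar>\<psi> (fst z) * (indicator (torus P) (snd z) * \<tau> (snd z))\<bar> \<le> B1 * max B3 0" for z
      unfolding abs_mult
      by (intro mult_mono B1)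
         (use B1 B3 in \<open>auto simp: indicator_def le_max_iff_disj intro: order_trans[OF abs_ge_zero]\<close>)
  qed
  also have "(\<lambda>z. (indicator (UNIV \<times> torus P) z *\<^sub>R G z) * (\<psi> (fst z) * (indicator (torus P) (snd z) * \<tau> (snd z)))) = F"
    by (auto simp: F_def indicator_def fun_eq_iff)
  finally have F: "integrable (lborel \<Otimes>\<^sub>M lborel) F" by (simp add: lborel_prod)
  have inner: "(LINT x|lborel. F (t, x)) = \<psi> t * (LINT x:torus P|lborel. G (t, x) * \<tau> x)" for t
    unfolding set_lebesgue_integral_def
    by (subst integral_mult_right_zero[symmetric])
       (auto simp: F_def mult.assoc mult.left_commute intro!: Bochner_Integration.integral_cong)
  show "integrable lborel (\<lambda>t. \<psi> t * (LINT x:torus P|lborel. G (t, x) * \<tau> x))"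
    using lborel_pair.integrable_fst'[OF F] by (simp add: inner)
  have "(LINT z|lborel. G z * (\<psi> (fst z) * \<zeta> (snd z))) = integral\<^sup>L lborel F"
    unfolding *(2) set_lebesgue_integral_def
    by (intro Bochner_Integration.integral_cong refl) (simp only: Feq)
  note L0 = this
  also have "\<dots> = (LINT t|lborel. LINT x|lborel. F (t, x))"
    using lborel_pair.integral_fst'[OF F] by (simp add: lborel_prod)
  finally show "(LINT z|lborel. G z * (\<psi> (fst z) * \<zeta> (snd z)))
       = (LINT t|lborel. \<psi> t * (LINT x:torus P|lborel. G (t, x) * \<tau> x))"
    by (simp add: inner)
  have F2: "indicator (UNIV \<times> torus P) z *\<^sub>R (G z * (\<psi> (fst z) * \<tau> (snd z))) = F z" for z
    by (cases z) (auto simp: F_def indicator_def)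
  show "set_integrable lborel (UNIV \<times> torus P) (\<lambda>z. G z * (\<psi> (fst z) * \<tau> (snd z)))"
    using F by (simp only: set_integrable_def F2 lborel_prod)
  show "(LINT z|lborel. G z * (\<psi> (fst z) * \<zeta> (snd z)))
       = (LINT z:UNIV \<times> torus P|lborel. G z * (\<psi> (fst z) * \<tau> (snd z)))"
    using L0 by (simp only: set_lebesgue_integral_def F2)
qed

section \<open>Scalar equations in the sense of distributions\<close>

lemma set_integrable_continuous_Ioo:
  fixes f :: "real \<Rightarrow> real"
  shows "continuous_on {a..b} f \<Longrightarrow> set_integrable lborel {a<..<b} f"
  by (rule set_integrable_subset[OF borel_integrable_atLeastAtMost'[of a b f]]) auto

lemma set_integrable_continuous_mult:
  fixes f g :: "real \<Rightarrow> real"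
  assumes "continuous_on {a..b} f" "set_integrable lborel {a<..<b} g"
  shows "set_integrable lborel {a<..<b} (\<lambda>t. f t * g t)"
proof -
  have "bounded (f ` {a..b})"
    by (intro compact_imp_bounded compact_continuous_image assms) auto
  then obtain B where "\<forall>t\<in>{a..b}. \<bar>f t\<bar> \<le> B" by (auto simp: bounded_iff)
  then have B: "\<And>t. t \<in> {a..b} \<Longrightarrow> \<bar>f t\<bar> \<le> B" by blast
  have m: "(\<lambda>t. indicator {a<..<b} t * f t) \<in> borel_measurable lborel"
    using set_integrable_continuous_Ioo[OF assms(1)] by (simp add: set_integrable_def)
  have "integrable lborel (\<lambda>t. (indicator {a<..<b} t *\<^sub>R g t) * (indicator {a<..<b} t * f t))"
    by (rule integrable_bounded_mult[where B="max B 0"])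
       (use assms(2) m B in \<open>auto simp: set_integrable_def indicator_def le_max_iff_disj\<close>)
  also have "(\<lambda>t. (indicator {a<..<b} t *\<^sub>R g t) * (indicator {a<..<b} t * f t))
      = (\<lambda>t. indicator {a<..<b} t *\<^sub>R (f t * g t))"
    by (auto simp: indicator_def)
  finally show ?thesis by (simp add: set_integrable_def)
qed

lemma set_integral_Ioo_FTC:
  fixes F :: "real \<Rightarrow> real"
  assumes "a \<le> b" "continuous_on UNIV f" "\<And>t. (F has_real_derivative f t) (at t)"
  shows "(LINT t:{a<..<b}|lborel. f t) = F b - F a"
proof -
  have "(LBINT t=a..b. f t) = F b - F a"
    using assms(3)
    by (intro interval_integral_FTC_finite continuous_on_subset[OF assms(2)])
       (auto simp: has_real_derivative_iff_has_vector_derivative intro: has_vector_derivative_at_within)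
  then show ?thesis using interval_integral_Ioo[of a b f] assms(1) by simp
qed

section \<open>Recovering a continuous function from its distributional equation in time\<close>

lemma step_deriv: "(step has_real_derivative pd 1 step s) (at s)"
  by (rule smooth_has_real_derivative[OF smooth_step])

lemma step_deriv_nonneg: "pd 1 step s \<ge> 0"
  by (rule mono_on_imp_deriv_nonneg[of UNIV step, OF _ step_deriv]) (auto intro: mono_onI step_mono)

text \<open>Subtracting the locally constant jump at 1 gives a function that vanishes off
  \<open>{0..1}\<close> and has, off that interval, the same derivative.\<close>

lemma step_deriv_0: "s \<notin> {0..1} \<Longrightarrow> pd 1 step s = 0"
proof -
  assume s: "s \<notin> {0..1}"
  have "pd 1 (\<lambda>s. step s + - of_bool (s > 1)) s = 0"
    by (rule pd_eq_0_outside_closed[of "{0..1}"]) (use s step_0 step_1 in \<open>auto simp: not_le\<close>)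
  moreover have "pd 1 step s = pd 1 (\<lambda>s. step s + - of_bool (s > 1)) s"
  proof -
    have "((\<lambda>s. step s + - of_bool (s > 1)) has_real_derivative pd 1 step s) (at s)"
    proof (rule has_field_derivative_transform_within_open)
      show "((\<lambda>t. step t + - of_bool (s > 1)) has_real_derivative pd 1 step s) (at s)"
        using DERIV_add[OF step_deriv[of s] DERIV_const[of "- of_bool (s > 1)"]] by simp
      show "open (if s > 1 then {1<..} else {..<0::real})" by simp
    qed (use s in \<open>auto split: if_splits\<close>)
    from pd_real[OF this, of 1] show ?thesis by simp
  qed
  ultimately show ?thesis by simp
qed

text \<open>Test with smooth cut-offs that equal 1 up to \<open>b\<close> and vanish shortly
  afterwards. Their derivatives concentrate at \<open>b\<close> and, \<open>w\<close> being
  continuous, pick out its value there; the integral of \<open>G\<close> converges by domination.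
  The initial value enters through \<open>\<psi> 0\<close>, which equals 1.\<close>

lemma weak_primitive:
  fixes w G :: "real \<Rightarrow> real"
  assumes w: "continuous_on {0..T} w" and G: "set_integrable lborel {0<..<T} G"
    and weak: "\<And>\<psi>. test_fun {..<T} \<psi> \<Longrightarrow>
      (LINT t:{0<..<T}|lborel. pd 1 \<psi> t * w t) + (LINT t:{0<..<T}|lborel. \<psi> t * G t) + \<psi> 0 * w0 = 0"
    and b: "0 < b" "b < T"
  shows "w b = w0 + (LINT t:{0<..b}|lborel. G t)"
proof -
  \<comment> \<open>The 2 in the denominator keeps \<open>b + e n\<close> strictly below
    \<open>T\<close> already for \<open>n = 0\<close>, so that all cut-offs are admissible test
    functions.\<close>
  define e where "e n = (T - b) / (real n + 2)" for n
  have e: "e n > 0" "b + e n < T" for n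
  proof -
    show "e n > 0" using b by (simp add: e_def)
    have "e n \<le> (T - b) / 2" unfolding e_def by (rule divide_left_mono) (use b in auto)
    then have "e n * 2 \<le> T - b" by simp
    then show "b + e n < T" using b by linarith
  qed
  have e0: "e \<longlonglongrightarrow> 0"
  proof -
    have "(\<lambda>n. (T - b) * inverse (real (n + 2))) \<longlonglongrightarrow> (T - b) * 0"
      by (intro tendsto_intros LIMSEQ_ignore_initial_segment[OF LIMSEQ_inverse_real_of_nat_add[of 0], of 1, simplified])
        (use LIMSEQ_ignore_initial_segment[OF lim_inverse_n, of 2] in simp)
    then show ?thesis by (simp add: e_def[abs_def] divide_inverse add.commute)
  qed
  \<comment> \<open>The first factor falls from 1 to 0 between \<open>b\<close> and
    \<open>b + e n\<close>. The second equals 1 from time -1 on and merely cuts off the far past, as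
    the support must be compact.\<close>
  define \<psi> where "\<psi> n t = (1 + - 1 * step (1 / e n * t + - b / e n)) * step (1 * t + 2)" for n t
  define k where "k n t = 1 / e n * pd 1 step (1 / e n * t + - b / e n)" for n t
  have arg: "1 / e n * t + - b / e n = (t - b) / e n" for n t
    by (simp add: diff_divide_distrib)
  have sm: "smooth (\<psi> n)" for n
    unfolding \<psi>_def
    using smooth_mult[OF smooth_add[OF smooth_const[of 1] smooth_mult[OF smooth_const[of "-1"]
          smooth_affine_real[OF smooth_step]]] smooth_affine_real[OF smooth_step]] .
  have test: "test_fun {..<T} (\<psi> n)" for n
    unfolding test_fun_def
  proof (intro conjI sm exI[of _ "{-2..b + e n}"] allI impI)
    show "{-2..b + e n} \<subseteq> {..<T}" using e(2)[of n] by auto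
    fix t assume t: "t \<notin> {-2..b + e n}"
    show "\<psi> n t = 0"
    proof (cases "t < -2")
      case True
      then show ?thesis by (simp add: \<psi>_def step_0)
    next
      case False
      then have "(t - b) / e n \<ge> 1" using t e(1)[of n] by (simp add: le_divide_eq)
      then show ?thesis unfolding \<psi>_def arg by (simp add: step_1)
    qed
  qed auto
  have \<psi>pos: "\<psi> n t = 1 - step ((t - b) / e n)" if "t > -1" for n t
    using that unfolding \<psi>_def arg by (simp add: step_1)
  have dstep: "((\<lambda>t. step ((t - b) / e n)) has_real_derivative k n t) (at t)" for n t
  proof -
    have "((\<lambda>t. step (1 / e n * t + - b / e n)) has_real_derivative pd 1 step (1 / e n * t + - b / e n) * (1 / e n)) (at t)"
      by (rule DERIV_chain2[OF step_deriv])
         (use e(1)[of n] in \<open>auto intro!: derivative_eq_intros\<close>)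
    then show ?thesis unfolding arg k_def by (simp add: mult.commute)
  qed
  have d\<psi>: "pd 1 (\<psi> n) t = - k n t" if "t > 0" for n t
  proof -
    have "((\<lambda>t. 1 - step ((t - b) / e n)) has_real_derivative - k n t) (at t)"
      using DERIV_diff[OF DERIV_const[of 1] dstep] by simp
    then have "(\<psi> n has_real_derivative - k n t) (at t)"
      by (rule has_field_derivative_transform_within_open[of _ _ _ "{-1<..}"]) (use that \<psi>pos in auto)
    from pd_real[OF this, of 1] show ?thesis by simp
  qed
  have kc: "continuous_on UNIV (k n)" for n
    unfolding k_def
    by (intro continuous_intros continuous_on_compose2[OF smooth_continuous[OF smooth_pd[OF smooth_step]]]) auto
  have k0: "k n t = 0" if "t \<notin> {b..b + e n}" for n t
  proof -
    have "(t - b) / e n \<notin> {0..1}" using that e(1)[of n] by (auto simp: divide_le_eq zero_le_divide_iff)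
    then show ?thesis unfolding k_def arg by (simp add: step_deriv_0)
  qed
  have kpos: "k n t \<ge> 0" for n t
    unfolding k_def using e(1)[of n] step_deriv_nonneg by simp
  have k1: "(LINT t:{0<..<T}|lborel. k n t) = 1" for n
  proof -
    have "(LINT t:{0<..<T}|lborel. k n t) = step ((T - b) / e n) - step ((0 - b) / e n)"
      by (rule set_integral_Ioo_FTC[OF _ kc dstep]) (use b in auto)
    moreover have "(T - b) / e n \<ge> 1" "(0 - b) / e n \<le> 0"
      using e[of n] b by (auto simp: le_divide_eq divide_le_0_iff)
    ultimately show ?thesis by (simp add: step_0 step_1)
  qed
  have ki: "set_integrable lborel {0<..<T} (k n)" for n
    by (intro set_integrable_continuous_Ioo continuous_on_subset[OF kc]) auto
  have kwi: "set_integrable lborel {0<..<T} (\<lambda>t. k n t * w t)" for n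
    by (intro set_integrable_continuous_Ioo continuous_intros continuous_on_subset[OF kc] w) auto
  \<comment> \<open>Minus the derivative of the cut-off is a nonnegative kernel of mass 1 that
    concentrates at \<open>b\<close> from the right: an approximate identity.\<close>
  have L: "(\<lambda>n. LINT t:{0<..<T}|lborel. k n t * w t) \<longlonglongrightarrow> w b"
  proof (rule LIMSEQ_I)
    fix r :: real assume "r > 0"
    obtain d where d: "d > 0" "\<And>t. t \<in> {0..T} \<Longrightarrow> \<bar>t - b\<bar> < d \<Longrightarrow> \<bar>w t - w b\<bar> < r / 2"
      using w b \<open>r > 0\<close> unfolding continuous_on_iff dist_real_def
      by (metis atLeastAtMost_iff half_gt_zero less_imp_le)
    obtain N where N: "\<And>n. n \<ge> N \<Longrightarrow> e n < d"
      using order_tendstoD(2)[OF e0 d(1)] by (auto simp: eventually_sequentially)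
    have "\<bar>(LINT t:{0<..<T}|lborel. k n t * w t) - w b\<bar> < r" if "n \<ge> N" for n
    proof -
      have "(LINT t:{0<..<T}|lborel. k n t * w t) - w b
          = (LINT t:{0<..<T}|lborel. k n t * w t - k n t * w b)"
        using k1[of n] by (subst set_integral_diff) (auto intro: kwi ki)
      also have "\<bar>\<dots>\<bar> \<le> (LINT t:{0<..<T}|lborel. \<bar>k n t * w t - k n t * w b\<bar>)"
        using set_integral_norm_bound[OF set_integral_diff(1)[OF kwi[of n] set_integrable_mult_left[OF ki[of n]]]]
        by simp
      also have "\<dots> \<le> (LINT t:{0<..<T}|lborel. k n t * (r / 2))"
      proof (rule set_integral_mono)
        show "set_integrable lborel {0<..<T} (\<lambda>t. \<bar>k n t * w t - k n t * w b\<bar>)"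
          by (intro set_integrable_abs set_integral_diff kwi set_integrable_mult_left ki)
        show "set_integrable lborel {0<..<T} (\<lambda>t. k n t * (r / 2))"
          by (intro set_integrable_mult_left ki)
        fix t assume t: "t \<in> {0<..<T}"
        show "\<bar>k n t * w t - k n t * w b\<bar> \<le> k n t * (r / 2)"
        proof (cases "t \<in> {b..b + e n}")
          case True
          then have "\<bar>w t - w b\<bar> \<le> r / 2"
            using d(2)[of t] t N[OF that] by auto
          then show ?thesis
            unfolding right_diff_distrib[symmetric] abs_mult
            by (intro mult_mono) (use kpos[of n t] in auto)
        qed (simp add: k0)
      qed
      also have "\<dots> = r / 2" using k1[of n] by simp
      finally show ?thesis using \<open>r > 0\<close> by linarith
    qed
    then show "\<exists>no. \<forall>n\<ge>no. norm ((LINT t:{0<..<T}|lborel. k n t * w t) - w b) < r" by auto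
  qed
  have R: "(\<lambda>n. LINT t:{0<..<T}|lborel. \<psi> n t * G t) \<longlonglongrightarrow> (LINT t:{0<..b}|lborel. G t)"
    unfolding set_lebesgue_integral_def
  proof (rule integral_dominated_convergence[where w="\<lambda>t. \<bar>indicator {0<..<T} t *\<^sub>R G t\<bar>"])
    have Gm: "(\<lambda>t. indicator {0<..<T} t *\<^sub>R G t) \<in> borel_measurable lborel"
      using G by (simp add: set_integrable_def)
    have "(\<lambda>t. indicator {0<..b} t *\<^sub>R (indicator {0<..<T} t *\<^sub>R G t)) \<in> borel_measurable lborel"
      by (intro borel_measurable_scaleR Gm) simp
    also have "(\<lambda>t. indicator {0<..b} t *\<^sub>R (indicator {0<..<T} t *\<^sub>R G t)) = (\<lambda>t. indicator {0<..b} t *\<^sub>R G t)"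
      using b by (auto simp: indicator_def)
    finally show "(\<lambda>t. indicator {0<..b} t *\<^sub>R G t) \<in> borel_measurable lborel" .
    show "(\<lambda>t. indicator {0<..<T} t *\<^sub>R (\<psi> n t * G t)) \<in> borel_measurable lborel" for n
    proof -
      have "(\<lambda>t. \<psi> n t * (indicator {0<..<T} t *\<^sub>R G t)) \<in> borel_measurable lborel"
        by (intro borel_measurable_times Gm) (use smooth_borel_measurable[OF sm] in simp)
      then show ?thesis by (simp add: mult.left_commute)
    qed
    show "integrable lborel (\<lambda>t. \<bar>indicator {0<..<T} t *\<^sub>R G t\<bar>)"
      using G by (simp add: set_integrable_def integrable_abs)
    show "AE t in lborel. (\<lambda>n. indicator {0<..<T} t *\<^sub>R (\<psi> n t * G t)) \<longlonglongrightarrow> indicator {0<..b} t *\<^sub>R G t"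
    proof (rule AE_I2)
      fix t
      show "(\<lambda>n. indicator {0<..<T} t *\<^sub>R (\<psi> n t * G t)) \<longlonglongrightarrow> indicator {0<..b} t *\<^sub>R G t"
      proof (cases "t \<le> b")
        case True
        have "(t - b) / e n \<le> 0" for n using True e(1)[of n] by (simp add: divide_le_0_iff)
        then have "\<psi> n t = 1" if "t > 0" for n using that by (simp add: \<psi>pos step_0)
        then have "indicator {0<..<T} t *\<^sub>R (\<psi> n t * G t) = indicator {0<..b} t *\<^sub>R G t" for n
          using True b by (auto simp: indicator_def)
        then show ?thesis by (simp only: tendsto_const)
      next
        case False
        obtain N where N: "\<And>n. n \<ge> N \<Longrightarrow> e n < t - b"
          using order_tendstoD(2)[OF e0, of "t - b"] False by (auto simp: eventually_sequentially)
        have "indicator {0<..<T} t *\<^sub>R (\<psi> n t * G t) = 0" if "n \<ge> N" for n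
        proof -
          have "(t - b) / e n \<ge> 1" using N[OF that] e(1)[of n] by (simp add: le_divide_eq)
          then show ?thesis by (simp add: \<psi>pos step_1 indicator_def)
        qed
        then have "\<forall>\<^sub>F n in sequentially. indicator {0<..<T} t *\<^sub>R (\<psi> n t * G t) = indicator {0<..b} t *\<^sub>R G t"
          using False by (auto simp: eventually_sequentially)
        then show ?thesis by (rule tendsto_eventually)
      qed
    qed
    show "AE t in lborel. norm (indicator {0<..<T} t *\<^sub>R (\<psi> n t * G t)) \<le> \<bar>indicator {0<..<T} t *\<^sub>R G t\<bar>" for n
    proof (rule AE_I2)
      fix t
      have "\<bar>\<psi> n t\<bar> \<le> 1" if "t > 0"
        using that step_range[of "(t - b) / e n"] by (simp add: \<psi>pos)
      then show "norm (indicator {0<..<T} t *\<^sub>R (\<psi> n t * G t)) \<le> \<bar>indicator {0<..<T} t *\<^sub>R G t\<bar>"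
        by (auto simp: indicator_def abs_mult intro: mult_left_le_one_le)
    qed
  qed
  have "(LINT t:{0<..<T}|lborel. k n t * w t) = (LINT t:{0<..<T}|lborel. \<psi> n t * G t) + w0" for n
  proof -
    have "(LINT t:{0<..<T}|lborel. pd 1 (\<psi> n) t * w t) = (LINT t:{0<..<T}|lborel. - (k n t * w t))"
      by (rule set_lebesgue_integral_cong) (auto simp: d\<psi>)
    also have "\<dots> = - (LINT t:{0<..<T}|lborel. k n t * w t)"
      by (simp add: set_lebesgue_integral_def)
    moreover have "\<psi> n 0 = 1"
      using b e(1)[of n] by (simp add: \<psi>pos step_0 divide_le_0_iff)
    ultimately show ?thesis using weak[OF test, of n] by simp
  qed
  then have "(\<lambda>n. LINT t:{0<..<T}|lborel. k n t * w t) \<longlonglongrightarrow> (LINT t:{0<..b}|lborel. G t) + w0"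
    using tendsto_add[OF R tendsto_const[of w0]] by simp
  from LIMSEQ_unique[OF L this] show ?thesis by simp
qed

text \<open>The bound 1, the same for every \<open>\<kappa>\<close>, is what removes the damping
  rate from the estimates of the scalar equation.\<close>

lemma exponential_kernel_le_1:
  assumes "\<kappa> \<ge> 0"
  shows "(\<integral>\<^sup>+t. ennreal (\<kappa> * exp (- \<kappa> * (t - s))) * indicator {s..T} t \<partial>lborel) \<le> 1"
proof (cases "s \<le> T")
  case True
  have "(\<integral>\<^sup>+t. ennreal (\<kappa> * exp (- \<kappa> * (t - s))) * indicator {s..T} t \<partial>lborel)
      = ennreal (- exp (- \<kappa> * (T - s)) - - exp (- \<kappa> * (s - s)))"
    by (rule nn_integral_FTC_Icc[OF _ _ _ True])
       (use assms in \<open>auto intro!: derivative_eq_intros\<close>)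
  also have "\<dots> \<le> ennreal 1" by (intro ennreal_leI) simp
  finally show ?thesis by simp
qed simp

lemma nn_integral_eq_set_integral_abs:
  fixes g :: "'a \<Rightarrow> real"
  assumes "set_integrable M A g"
  shows "(\<integral>\<^sup>+t. ennreal (indicator A t * \<bar>g t\<bar>) \<partial>M) = ennreal (LINT t:A|M. \<bar>g t\<bar>)"
proof -
  have "set_integrable M A (\<lambda>t. \<bar>g t\<bar>)" by (rule set_integrable_abs[OF assms])
  then show ?thesis
    unfolding set_integrable_def set_lebesgue_integral_def
    by (subst nn_integral_eq_integral) auto
qed

text \<open>The integrating factor in weak form: with the test function
  \<open>\<psi> t * exp (\<kappa> * t)\<close> the extra term of the product rule cancels the
  damping, and \<open>weak_primitive\<close> applies to
  \<open>exp (\<kappa> * t) * w t\<close>.\<close>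

lemma weak_exponential_primitive:
  fixes w g :: "real \<Rightarrow> real"
  assumes w: "continuous_on {0..T} w" and g: "set_integrable lborel {0<..<T} g"
    and weak: "\<And>\<psi>. test_fun {..<T} \<psi> \<Longrightarrow>
      (LINT t:{0<..<T}|lborel. pd 1 \<psi> t * w t) + (LINT t:{0<..<T}|lborel. \<psi> t * (g t - \<kappa> * w t)) + \<psi> 0 * w0 = 0"
    and b: "0 < b" "b < T"
  shows "exp (\<kappa> * b) * w b = w0 + (LINT t:{0<..b}|lborel. exp (\<kappa> * t) * g t)"
proof (rule weak_primitive[where T=T])
  have ce: "continuous_on A (\<lambda>t. exp (\<kappa> * t))" for A by (intro continuous_intros)
  show "continuous_on {0..T} (\<lambda>t. exp (\<kappa> * t) * w t)"
    by (intro continuous_intros w)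
  show "set_integrable lborel {0<..<T} (\<lambda>t. exp (\<kappa> * t) * g t)"
    by (rule set_integrable_continuous_mult[OF ce g])
  fix \<psi> :: "real \<Rightarrow> real" assume \<psi>: "test_fun {..<T} \<psi>"
  have sm: "smooth \<psi>" using \<psi> by (simp add: test_fun_def)
  have se: "smooth (\<lambda>t. exp (\<kappa> * t))"
  proof -
    have "Ck n (\<lambda>t. exp (\<kappa> * t))" for n
    proof (induction n)
      case (Suc n)
      show ?case
        by (rule Ck_Suc_real[OF _ Ck_mult[OF Ck_const[of n \<kappa>] Suc]]) (auto intro!: derivative_eq_intros)
    qed (simp add: ce)
    then show ?thesis by (simp add: smooth_def)
  qed
  define \<phi> where "\<phi> = (\<lambda>t. \<psi> t * exp (\<kappa> * t))"
  obtain K where "compact K" "K \<subseteq> {..<T}" "\<And>t. t \<notin> K \<Longrightarrow> \<psi> t = 0"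
    using \<psi> unfolding test_fun_def by blast
  then have "test_fun {..<T} \<phi>"
    using smooth_mult[OF sm se] unfolding test_fun_def \<phi>_def by (metis mult_zero_left)
  note W = weak[OF this]
  have pd: "pd 1 \<phi> t = pd 1 \<psi> t * exp (\<kappa> * t) + \<kappa> * \<psi> t * exp (\<kappa> * t)" for t
  proof -
    have "(\<phi> has_real_derivative pd 1 \<psi> t * exp (\<kappa> * t) + \<kappa> * \<psi> t * exp (\<kappa> * t)) (at t)"
      unfolding \<phi>_def
      by (auto intro!: derivative_eq_intros smooth_has_real_derivative[OF sm])
    from pd_real[OF this, of 1] show ?thesis by simp
  qed
  have cc: "continuous_on {0..T} \<psi>" "continuous_on {0..T} (pd 1 \<psi>)"
    using smooth_continuous[OF sm] smooth_continuous[OF smooth_pd[OF sm]] continuous_on_subset by blast+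
  have i1: "set_integrable lborel {0<..<T} (\<lambda>t. pd 1 \<psi> t * (exp (\<kappa> * t) * w t))"
    by (intro set_integrable_continuous_Ioo continuous_intros cc w)
  have i2: "set_integrable lborel {0<..<T} (\<lambda>t. \<kappa> * \<psi> t * exp (\<kappa> * t) * w t)"
    by (intro set_integrable_continuous_Ioo continuous_intros cc w)
  have i3: "set_integrable lborel {0<..<T} (\<lambda>t. (\<psi> t * exp (\<kappa> * t)) * g t)"
    by (intro set_integrable_continuous_mult continuous_intros cc g)
  have "(LINT t:{0<..<T}|lborel. pd 1 \<phi> t * w t)
      = (LINT t:{0<..<T}|lborel. pd 1 \<psi> t * (exp (\<kappa> * t) * w t) + \<kappa> * \<psi> t * exp (\<kappa> * t) * w t)"
    by (simp add: pd algebra_simps)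
  also have "\<dots> = (LINT t:{0<..<T}|lborel. pd 1 \<psi> t * (exp (\<kappa> * t) * w t))
      + (LINT t:{0<..<T}|lborel. \<kappa> * \<psi> t * exp (\<kappa> * t) * w t)"
    by (rule set_integral_add(2)[OF i1 i2])
  finally have e1: "(LINT t:{0<..<T}|lborel. pd 1 \<phi> t * w t) = \<dots>" .
  have "(LINT t:{0<..<T}|lborel. \<phi> t * (g t - \<kappa> * w t))
      = (LINT t:{0<..<T}|lborel. (\<psi> t * exp (\<kappa> * t)) * g t - \<kappa> * \<psi> t * exp (\<kappa> * t) * w t)"
    by (simp add: \<phi>_def algebra_simps)
  also have "\<dots> = (LINT t:{0<..<T}|lborel. (\<psi> t * exp (\<kappa> * t)) * g t)
      - (LINT t:{0<..<T}|lborel. \<kappa> * \<psi> t * exp (\<kappa> * t) * w t)"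
    by (rule set_integral_diff(2)[OF i3 i2])
  finally have e2: "(LINT t:{0<..<T}|lborel. \<phi> t * (g t - \<kappa> * w t)) = \<dots>" .
  have "(LINT t:{0<..<T}|lborel. (\<psi> t * exp (\<kappa> * t)) * g t) = (LINT t:{0<..<T}|lborel. \<psi> t * (exp (\<kappa> * t) * g t))"
    by (simp add: mult.assoc)
  then show "(LINT t:{0<..<T}|lborel. pd 1 \<psi> t * (exp (\<kappa> * t) * w t))
      + (LINT t:{0<..<T}|lborel. \<psi> t * (exp (\<kappa> * t) * g t)) + \<psi> 0 * w0 = 0"
    using W e1 e2 by (simp add: \<phi>_def)
qed (use b in auto)

text \<open>
  The bound does not involve \<open>\<kappa>\<close>: the solution of \<open>w' + \<kappa> w = g\<close> is bounded by
  \<open>A = \<bar>w\<^sub>0\<bar> + \<parallel>g\<parallel>\<^bsub>1\<^esub>\<close>, and so is \<open>\<kappa> \<integral> \<bar>w\<bar>\<close>; hence the total variation of \<open>w\<close> is at most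
  \<open>2 A\<close>, and the squared increment integrates to at most \<open>2 A \<cdot> 2 A h\<close>.
\<close>

lemma weak_ode_shift:
  fixes w g :: "real \<Rightarrow> real"
  assumes w: "continuous_on {0..T} w" and g: "set_integrable lborel {0<..<T} g"
    and \<kappa>: "\<kappa> \<ge> 0"
    and weak: "\<And>\<psi>. test_fun {..<T} \<psi> \<Longrightarrow>
      (LINT t:{0<..<T}|lborel. pd 1 \<psi> t * w t) + (LINT t:{0<..<T}|lborel. \<psi> t * (g t - \<kappa> * w t)) + \<psi> 0 * w0 = 0"
    and h: "0 < h" "S < T"
    and A: "\<bar>w0\<bar> + (LINT t:{0<..<T}|lborel. \<bar>g t\<bar>) \<le> A"
  shows "(\<integral>\<^sup>+t\<in>{0..S - h}. ennreal ((w (t + h) - w t)\<^sup>2) \<partial>lborel) \<le> ennreal (4 * A\<^sup>2 * h)"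
proof -
  define N where "N = (LINT t:{0<..<T}|lborel. \<bar>g t\<bar>)"
  have N0: "N \<ge> 0" unfolding N_def set_lebesgue_integral_def by (intro integral_nonneg_AE) auto
  have A0: "A \<ge> 0" "\<bar>w0\<bar> + N \<le> A" using N0 A by (auto simp: N_def)
  define gg where "gg t = indicator {0<..<T} t * \<bar>g t\<bar>" for t
  have gg: "integrable lborel gg" "integral\<^sup>L lborel gg = N" "\<And>t. gg t \<ge> 0"
    using set_integrable_abs[OF g] by (auto simp: gg_def[abs_def] set_integrable_def N_def set_lebesgue_integral_def)
  then have ggm[measurable]: "gg \<in> borel_measurable borel" by auto
  have nngg: "(\<integral>\<^sup>+t. ennreal (gg t) \<partial>lborel) = ennreal N"
    using gg by (subst nn_integral_eq_integral) auto
  define ww where "ww t = indicator {0<..<T} t * \<bar>w t\<bar>" for t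
  have wi: "set_integrable lborel {0<..<T} w" by (rule set_integrable_continuous_Ioo[OF w])
  have ww: "integrable lborel ww" "\<And>t. ww t \<ge> 0"
    using set_integrable_abs[OF wi] by (auto simp: ww_def[abs_def] set_integrable_def)
  then have wwm[measurable]: "ww \<in> borel_measurable borel" by auto
  have subg: "set_integrable lborel {a<..b} (\<lambda>t. c t * g t)"
    if "0 \<le> a" "b < T" "continuous_on UNIV c" for a b c
    by (rule set_integrable_subset[OF set_integrable_continuous_mult[OF _ g]])
       (use that in \<open>auto intro: continuous_on_subset\<close>)
  \<comment> \<open>Duhamel's formula. The weights are at most 1 for
    \<open>\<kappa> \<ge> 0\<close>, so the damping can only weaken the influence of the initial
    value and of the forcing.\<close>
  have duhamel: "\<bar>w b\<bar> \<le> exp (- \<kappa> * b) * \<bar>w0\<bar> + (LINT t:{0<..b}|lborel. exp (- \<kappa> * (b - t)) * \<bar>g t\<bar>)"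
    if b: "0 < b" "b < T" for b
  proof -
    have "w b = exp (- \<kappa> * b) * (exp (\<kappa> * b) * w b)" by (simp add: mult_exp_exp flip: mult.assoc)
    also have "\<dots> = exp (- \<kappa> * b) * w0 + exp (- \<kappa> * b) * (LINT t:{0<..b}|lborel. exp (\<kappa> * t) * g t)"
      by (simp only: weak_exponential_primitive[OF w g weak b] distrib_left)
    also have "exp (- \<kappa> * b) * (LINT t:{0<..b}|lborel. exp (\<kappa> * t) * g t)
        = (LINT t:{0<..b}|lborel. exp (- \<kappa> * (b - t)) * g t)"
      by (subst set_integral_mult_right[symmetric])
         (auto intro!: set_lebesgue_integral_cong simp: mult_exp_exp algebra_simps simp flip: mult.assoc)
    also have "\<bar>exp (- \<kappa> * b) * w0 + \<dots>\<bar> \<le> \<bar>exp (- \<kappa> * b) * w0\<bar> + \<bar>\<dots>\<bar>" by (rule abs_triangle_ineq)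
    also have "\<bar>LINT t:{0<..b}|lborel. exp (- \<kappa> * (b - t)) * g t\<bar>
        \<le> (LINT t:{0<..b}|lborel. \<bar>exp (- \<kappa> * (b - t)) * g t\<bar>)"
      using set_integral_norm_bound[OF subg[of 0 b "\<lambda>t. exp (- \<kappa> * (b - t))"]] b
      by (simp add: continuous_intros)
    finally show ?thesis by (simp add: abs_mult)
  qed
  have wsup: "\<bar>w b\<bar> \<le> A" if b: "0 < b" "b < T" for b
  proof -
    have "(LINT t:{0<..b}|lborel. exp (- \<kappa> * (b - t)) * \<bar>g t\<bar>) \<le> N"
    proof -
      have "indicator {0<..b} t * (exp (- \<kappa> * (b - t)) * \<bar>g t\<bar>) \<le> gg t" for t
        using b \<kappa> by (auto simp: gg_def indicator_def intro!: mult_left_le_one_le)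
      moreover have "integrable lborel (\<lambda>t. indicator {0<..b} t *\<^sub>R (exp (- \<kappa> * (b - t)) * \<bar>g t\<bar>))"
        using set_integrable_abs[OF subg[of 0 b "\<lambda>t. exp (- \<kappa> * (b - t))"]] b
        by (simp add: continuous_intros set_integrable_def abs_mult)
      ultimately show ?thesis
        unfolding set_lebesgue_integral_def gg(2)[symmetric] using gg(1)
        by (intro integral_mono) auto
    qed
    moreover have "exp (- \<kappa> * b) * \<bar>w0\<bar> \<le> \<bar>w0\<bar>" using b \<kappa> by (intro mult_left_le_one_le) auto
    ultimately show ?thesis using duhamel[OF b] A0 by linarith
  qed
  \<comment> \<open>Duhamel's bound is multiplied by \<open>\<kappa>\<close> and integrated in time.
    By Tonelli the kernel is integrated first over the later time, where its mass is at most 1, so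
    the initial value and the forcing at each instant are counted at most once.\<close>
  have lamw: "(\<integral>\<^sup>+b. ennreal (\<kappa> * ww b) \<partial>lborel) \<le> ennreal A"
  proof -
    define K where "K s t = ennreal (\<kappa> * exp (- \<kappa> * (t - s))) * indicator {s..T} t" for s t
    have Km[measurable]: "(\<lambda>(s, t). K s t) \<in> borel_measurable (lborel \<Otimes>\<^sub>M lborel)"
    proof -
      \<comment> \<open>The indicator is rewritten as that of a set of pairs, since the exchange of
        integrals requires joint measurability.\<close>
      have "(\<lambda>(s, t). ennreal (\<kappa> * exp (- \<kappa> * (t - s))) * indicator {z::real\<times>real. fst z \<le> snd z \<and> snd z \<le> T} (s, t))
          \<in> borel_measurable (lborel \<Otimes>\<^sub>M lborel)"
        by measurable
      also have "(\<lambda>(s, t). ennreal (\<kappa> * exp (- \<kappa> * (t - s))) * indicator {z::real\<times>real. fst z \<le> snd z \<and> snd z \<le> T} (s, t))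
          = (\<lambda>(s, t). K s t)"
        by (auto simp: K_def indicator_def fun_eq_iff)
      finally show ?thesis .
    qed
    have K1: "(\<integral>\<^sup>+t. K s t \<partial>lborel) \<le> 1" for s
      unfolding K_def by (rule exponential_kernel_le_1[OF \<kappa>])
    have "ennreal (\<kappa> * ww b) \<le> ennreal \<bar>w0\<bar> * K 0 b + (\<integral>\<^sup>+s. ennreal (gg s) * K s b \<partial>lborel)" for b
    proof (cases "0 < b \<and> b < T")
      case True
      then have b: "0 < b" "b < T" by auto
      have i: "set_integrable lborel {0<..b} (\<lambda>t. exp (- \<kappa> * (b - t)) * g t)"
        using subg[of 0 b "\<lambda>t. exp (- \<kappa> * (b - t))"] b by (simp add: continuous_intros)
      have "ennreal (\<kappa> * ww b) \<le> ennreal (\<kappa> * (exp (- \<kappa> * b) * \<bar>w0\<bar>) + \<kappa> * (LINT t:{0<..b}|lborel. \<bar>exp (- \<kappa> * (b - t)) * g t\<bar>))"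
        using duhamel[OF b] b \<kappa> by (intro ennreal_leI) (simp add: ww_def abs_mult mult_left_mono flip: distrib_left)
      also have "\<dots> = ennreal (\<kappa> * (exp (- \<kappa> * b) * \<bar>w0\<bar>)) + ennreal \<kappa> * ennreal (LINT t:{0<..b}|lborel. \<bar>exp (- \<kappa> * (b - t)) * g t\<bar>)"
        using \<kappa> by (subst ennreal_plus) (auto simp: ennreal_mult' set_lebesgue_integral_def intro!: mult_nonneg_nonneg integral_nonneg_AE)
      also have "ennreal (\<kappa> * (exp (- \<kappa> * b) * \<bar>w0\<bar>)) = ennreal \<bar>w0\<bar> * K 0 b"
        using b \<kappa> by (simp add: K_def ennreal_mult'[symmetric] mult_ac)
      also have "ennreal (LINT t:{0<..b}|lborel. \<bar>exp (- \<kappa> * (b - t)) * g t\<bar>)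
          = (\<integral>\<^sup>+t. ennreal (indicator {0<..b} t * \<bar>exp (- \<kappa> * (b - t)) * g t\<bar>) \<partial>lborel)"
        by (rule nn_integral_eq_set_integral_abs[OF i, symmetric])
      also have "ennreal \<kappa> * \<dots> = (\<integral>\<^sup>+t. ennreal \<kappa> * ennreal (indicator {0<..b} t * \<bar>exp (- \<kappa> * (b - t)) * g t\<bar>) \<partial>lborel)"
        using set_integrable_abs[OF i] by (intro nn_integral_cmult[symmetric]) (simp add: set_integrable_def)
      also have "\<dots> \<le> (\<integral>\<^sup>+s. ennreal (gg s) * K s b \<partial>lborel)"
      proof (intro nn_integral_mono)
        fix t
        show "ennreal \<kappa> * ennreal (indicator {0<..b} t * \<bar>exp (- \<kappa> * (b - t)) * g t\<bar>) \<le> ennreal (gg t) * K t b"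
          using b \<kappa> by (auto simp: gg_def K_def indicator_def abs_mult mult_ac simp flip: ennreal_mult')
      qed
      finally show ?thesis by (simp add: add_left_mono)
    qed (simp add: ww_def)
    then have "(\<integral>\<^sup>+b. ennreal (\<kappa> * ww b) \<partial>lborel)
        \<le> (\<integral>\<^sup>+b. ennreal \<bar>w0\<bar> * K 0 b + (\<integral>\<^sup>+s. ennreal (gg s) * K s b \<partial>lborel) \<partial>lborel)"
      by (intro nn_integral_mono)
    also have "\<dots> = ennreal \<bar>w0\<bar> * (\<integral>\<^sup>+b. K 0 b \<partial>lborel) + (\<integral>\<^sup>+b. (\<integral>\<^sup>+s. ennreal (gg s) * K s b \<partial>lborel) \<partial>lborel)"
      by (subst nn_integral_add) (auto simp: nn_integral_cmult)
    also have "(\<integral>\<^sup>+b. (\<integral>\<^sup>+s. ennreal (gg s) * K s b \<partial>lborel) \<partial>lborel)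
        = (\<integral>\<^sup>+s. (\<integral>\<^sup>+b. ennreal (gg s) * K s b \<partial>lborel) \<partial>lborel)"
      by (rule lborel_pair.Fubini') measurable
    also have "\<dots> = (\<integral>\<^sup>+s. ennreal (gg s) * (\<integral>\<^sup>+b. K s b \<partial>lborel) \<partial>lborel)"
      by (intro nn_integral_cong nn_integral_cmult) measurable
    also have "\<dots> \<le> (\<integral>\<^sup>+s. ennreal (gg s) * 1 \<partial>lborel)"
      by (intro nn_integral_mono mult_left_mono K1) auto
    also have "ennreal \<bar>w0\<bar> * (\<integral>\<^sup>+b. K 0 b \<partial>lborel) \<le> ennreal \<bar>w0\<bar> * 1"
      by (intro mult_left_mono K1) auto
    finally have "(\<integral>\<^sup>+b. ennreal (\<kappa> * ww b) \<partial>lborel) \<le> ennreal \<bar>w0\<bar> + ennreal N"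
      by (simp add: nngg add_right_mono)
    also have "\<dots> \<le> ennreal A" using A0 N0 by (simp add: ennreal_plus[symmetric] ennreal_leI del: ennreal_plus)
    finally show ?thesis .
  qed
  define V where "V t = gg t + \<kappa> * ww t" for t
  have Vm[measurable]: "V \<in> borel_measurable borel" unfolding V_def by measurable
  have V0: "V t \<ge> 0" for t using gg(3) ww(2) \<kappa> by (simp add: V_def)
  have nnV: "(\<integral>\<^sup>+t. ennreal (V t) \<partial>lborel) \<le> ennreal (2 * A)"
  proof -
    have "(\<integral>\<^sup>+t. ennreal (V t) \<partial>lborel) = (\<integral>\<^sup>+t. ennreal (gg t) + ennreal (\<kappa> * ww t) \<partial>lborel)"
      using gg(3) ww(2) \<kappa> by (simp add: V_def ennreal_plus)
    also have "\<dots> = ennreal N + (\<integral>\<^sup>+t. ennreal (\<kappa> * ww t) \<partial>lborel)"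
      by (subst nn_integral_add) (auto simp: nngg)
    also have "\<dots> \<le> ennreal A + ennreal A"
      using A0 by (intro add_mono lamw ennreal_leI) auto
    finally show ?thesis using A0(1) by (simp add: ennreal_plus[symmetric] del: ennreal_plus)
  qed
  have incr: "ennreal \<bar>w (t + h) - w t\<bar> \<le> (\<integral>\<^sup>+s. ennreal (V s) * indicator {t<..t + h} s \<partial>lborel)"
    if t: "0 < t" "t + h < T" for t
  proof -
    have gi: "set_integrable lborel {0<..<T} (\<lambda>t. g t - \<kappa> * w t)"
      by (intro set_integral_diff g set_integrable_mult_right wi)
    have sub: "set_integrable lborel {a<..b} (\<lambda>t. g t - \<kappa> * w t)" if "0 \<le> a" "b < T" for a b
      by (rule set_integrable_subset[OF gi]) (use that in auto)
    have prim: "w b = w0 + (LINT t:{0<..b}|lborel. g t - \<kappa> * w t)" if "0 < b" "b < T" for b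
      using weak_primitive[OF w gi weak that] .
    have "{0<..t + h} = {0<..t} \<union> {t<..t + h}" using t h by auto
    then have "w (t + h) - w t = (LINT s:{t<..t + h}|lborel. g s - \<kappa> * w s)"
      using t h by (simp add: prim set_integral_Un sub)
    also have "\<bar>\<dots>\<bar> \<le> (LINT s:{t<..t + h}|lborel. \<bar>g s - \<kappa> * w s\<bar>)"
      using set_integral_norm_bound[OF sub[of t "t + h"]] t h by simp
    finally have "ennreal \<bar>w (t + h) - w t\<bar> \<le> ennreal (LINT s:{t<..t + h}|lborel. \<bar>g s - \<kappa> * w s\<bar>)"
      by (rule ennreal_leI)
    also have "\<dots> = (\<integral>\<^sup>+s. ennreal (indicator {t<..t + h} s * \<bar>g s - \<kappa> * w s\<bar>) \<partial>lborel)"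
      by (rule nn_integral_eq_set_integral_abs[symmetric, OF sub]) (use t h in auto)
    also have "\<dots> \<le> (\<integral>\<^sup>+s. ennreal (V s) * indicator {t<..t + h} s \<partial>lborel)"
    proof (intro nn_integral_mono)
      fix s
      have "\<bar>g s - \<kappa> * w s\<bar> \<le> \<bar>g s\<bar> + \<kappa> * \<bar>w s\<bar>"
        using abs_triangle_ineq4[of "g s" "\<kappa> * w s"] \<kappa> by (simp add: abs_mult)
      then show "ennreal (indicator {t<..t + h} s * \<bar>g s - \<kappa> * w s\<bar>) \<le> ennreal (V s) * indicator {t<..t + h} s"
        using t h by (auto simp: V_def gg_def ww_def indicator_def intro: ennreal_leI)
    qed
    finally show ?thesis .
  qed
  have "(\<integral>\<^sup>+t\<in>{0..S - h}. ennreal ((w (t + h) - w t)\<^sup>2) \<partial>lborel)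
      \<le> (\<integral>\<^sup>+t. ennreal (2 * A) * (\<integral>\<^sup>+s. ennreal (V s) * indicator {s - h..s} t \<partial>lborel) \<partial>lborel)"
  proof (rule nn_integral_mono_AE)
    \<comment> \<open>The estimates of \<open>w\<close> are available for strictly positive times;
      the initial instant is a null set.\<close>
    have "AE t in lborel. t \<noteq> (0::real)" by (rule AE_lborel_singleton)
    then show "AE t in lborel. ennreal ((w (t + h) - w t)\<^sup>2) * indicator {0..S - h} t
       \<le> ennreal (2 * A) * (\<integral>\<^sup>+s. ennreal (V s) * indicator {s - h..s} t \<partial>lborel)"
    proof eventually_elim
      case (elim t)
      show ?case
      proof (cases "t \<in> {0..S - h}")
        case True
        then have t: "0 < t" "t + h < T" "t < T" "0 < t + h" using elim h by auto
        have "(w (t + h) - w t)\<^sup>2 = \<bar>w (t + h) - w t\<bar> * \<bar>w (t + h) - w t\<bar>"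
          by (simp add: power2_eq_square)
        also have "\<dots> \<le> (2 * A) * \<bar>w (t + h) - w t\<bar>"
          using wsup[of t] wsup[of "t + h"] t by (intro mult_right_mono) auto
        finally have "ennreal ((w (t + h) - w t)\<^sup>2) \<le> ennreal (2 * A) * ennreal \<bar>w (t + h) - w t\<bar>"
          using A0(1) by (simp add: ennreal_mult'[symmetric] ennreal_leI)
        also have "\<dots> \<le> ennreal (2 * A) * (\<integral>\<^sup>+s. ennreal (V s) * indicator {t<..t + h} s \<partial>lborel)"
          by (intro mult_left_mono incr t) auto
        \<comment> \<open>The condition on \<open>s\<close> is turned into one on \<open>t\<close>:
          for each \<open>s\<close> the admissible \<open>t\<close> fill an interval of length
          \<open>h\<close>, which yields the factor \<open>h\<close> once the integrals are
          exchanged.\<close>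
        also have "\<dots> \<le> ennreal (2 * A) * (\<integral>\<^sup>+s. ennreal (V s) * indicator {s - h..s} t \<partial>lborel)"
          by (intro mult_left_mono nn_integral_mono) (auto simp: indicator_def)
        finally show ?thesis using True by simp
      qed simp
    qed
  qed
  also have "\<dots> = ennreal (2 * A) * (\<integral>\<^sup>+t. (\<integral>\<^sup>+s. ennreal (V s) * indicator {s - h..s} t \<partial>lborel) \<partial>lborel)"
  proof (rule nn_integral_cmult)
    have "(\<lambda>(t, s). ennreal (V s) * indicator {z::real\<times>real. snd z - h \<le> fst z \<and> fst z \<le> snd z} (t, s))
        \<in> borel_measurable (lborel \<Otimes>\<^sub>M lborel)" by measurable
    from lborel.borel_measurable_nn_integral[OF this]
    show "(\<lambda>t. \<integral>\<^sup>+s. ennreal (V s) * indicator {s - h..s} t \<partial>lborel) \<in> borel_measurable lborel"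
      by (simp add: indicator_def)
  qed
  also have "(\<integral>\<^sup>+t. (\<integral>\<^sup>+s. ennreal (V s) * indicator {s - h..s} t \<partial>lborel) \<partial>lborel)
      = (\<integral>\<^sup>+s. (\<integral>\<^sup>+t. ennreal (V s) * indicator {s - h..s} t \<partial>lborel) \<partial>lborel)"
  proof (rule lborel_pair.Fubini')
    have "(\<lambda>(t, s). ennreal (V s) * indicator {z::real\<times>real. fst z - h \<le> snd z \<and> snd z \<le> fst z} (s, t))
        \<in> borel_measurable (lborel \<Otimes>\<^sub>M lborel)" by measurable
    then show "(\<lambda>(s, t). ennreal (V s) * indicator {s - h..s} t) \<in> borel_measurable (lborel \<Otimes>\<^sub>M lborel)"
      by (simp add: indicator_def)
  qed
  also have "\<dots> = (\<integral>\<^sup>+s. ennreal (V s) * ennreal h \<partial>lborel)"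
    using h by (simp add: nn_integral_cmult)
  also have "\<dots> = (\<integral>\<^sup>+s. ennreal (V s) \<partial>lborel) * ennreal h"
    by (rule nn_integral_multc) measurable
  also have "ennreal (2 * A) * \<dots> \<le> ennreal (2 * A) * (ennreal (2 * A) * ennreal h)"
    by (intro mult_left_mono mult_right_mono nnV) auto
  also have "\<dots> = ennreal (4 * A\<^sup>2 * h)"
    using A0(1) h by (simp add: ennreal_mult'[symmetric] power2_eq_square)
  finally show ?thesis .
qed

section \<open>Fourier series on the torus\<close>

lemma emeasure_torus_finite: "emeasure lborel (torus P) < \<infinity>"
  unfolding torus_def by (rule emeasure_lborel_cbox_finite)

lemma measure_torus_pos: "P > 0 \<Longrightarrow> measure lborel (torus P) > 0"
  unfolding torus_def content_pos_lt_eq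
  by (auto simp: Basis_vec_def Basis_real_def inner_axis)

lemma torus_integrable_const: "integrable lborel (\<lambda>x. indicator (torus P) x *\<^sub>R (c::real))"
  using emeasure_torus_finite by (intro integrable_scaleR_left integrable_real_indicator) auto

lemma torus_integrable_bounded:
  fixes f :: "real^3 \<Rightarrow> real"
  assumes "f \<in> borel_measurable borel" "\<And>x. \<bar>f x\<bar> \<le> B"
  shows "set_integrable lborel (torus P) f"
proof -
  have "integrable lborel (\<lambda>x. (indicator (torus P) x *\<^sub>R 1) * f x)"
    by (rule integrable_bounded_mult[OF torus_integrable_const _ assms(2)]) (use assms(1) in simp)
  then show ?thesis by (simp add: set_integrable_def)
qed

text \<open>Unfold the cell to the whole space by the partition of unity, translate there, and fold
  back: the translated partition still sums to 1. The restriction on \<open>a\<close> keeps the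
  translated support inside the cube that \<open>near\<close> covers.\<close>

lemma torus_integral_translate:
  fixes g :: "real^3 \<Rightarrow> real"
  assumes "P > 0" and g: "g \<in> borel_measurable borel" and per: "periodic P g"
    and B: "\<And>x. \<bar>g x\<bar> \<le> B" and a: "\<And>i. \<bar>a $ i\<bar> \<le> P"
  shows "(LINT x:torus P|lborel. g (a + x)) = (LINT x:torus P|lborel. g x)"
proof -
  have tm: "(\<lambda>x. tile P (c + x)) \<in> borel_measurable borel" for c
    using borel_measurable_translate[OF smooth_borel_measurable[OF smooth_tile]] .
  have "periodic P (\<lambda>_::real^3. 1::real)" by (simp add: periodic_def)
  from periodization_tile[OF assms(1) smooth_const this] have p1: "periodization P (tile P) (\<lambda>_. 1)"
    by simp
  obtain B' where B': "\<And>x. \<bar>tile P x\<bar> \<le> B'" using periodization_bounded[OF p1] by blast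
  have "(LINT x:torus P|lborel. g (a + x)) = (LINT x|lborel. g (a + x) * tile P x)"
  proof (subst unfold_space(2)[OF assms(1) _ _ _ p1])
    show "(\<lambda>x. g (a + x)) \<in> borel_measurable borel" by (rule borel_measurable_translate[OF g])
    show "periodic P (\<lambda>x. g (a + x))" using per by (simp add: periodic_def add.assoc[symmetric])
    show "set_integrable lborel (torus P) (\<lambda>x. g (a + x))"
      by (rule torus_integrable_bounded[OF borel_measurable_translate[OF g] B])
  qed simp
  also have "\<dots> = (LINT x|lborel. g (a + x) * tile P (- a + (a + x)))" by (simp add: add.assoc[symmetric])
  also have "\<dots> = (LINT x|lborel. g x * tile P (- a + x))"
    by (rule lborel_integral_translate[of "\<lambda>x. g x * tile P (- a + x)"]) (intro borel_measurable_times g tm)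
  also have "\<dots> = (LINT x:torus P|lborel. g x * (\<Sum>n\<in>near. tile P (- a + (period P n + x))))"
  proof (rule unfold_integral(2)[OF finite_near torus_borel g periodic_period[OF per] _ _ tm])
    have "\<forall>i. \<bar>x $ i\<bar> \<le> 2 * P" if "tile P (- a + x) \<noteq> 0" for x
    proof
      fix i
      have "\<bar>(- a + x) $ i\<bar> \<le> P" by (rule tile_support[OF assms(1) that])
      then show "\<bar>x $ i\<bar> \<le> 2 * P" using a[of i] by simp
    qed
    then show "AE x in lborel. tile P (- a + x) \<noteq> 0 \<longrightarrow> (\<Sum>n\<in>near. indicat_real (torus P) (x - period P n)) = 1"
      using AE_torus_tile[OF assms(1)] by auto
    show "set_integrable lborel (torus P) g" by (rule torus_integrable_bounded[OF g B])
  qed (rule B')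
  also have "\<dots> = (LINT x:torus P|lborel. g x)"
  proof (rule set_lebesgue_integral_cong)
    show "\<forall>x. x \<in> torus P \<longrightarrow> g x * (\<Sum>n\<in>near. tile P (- a + (period P n + x))) = g x"
    proof (intro allI impI)
      fix x assume x: "x \<in> torus P"
      have "(\<Sum>n\<in>near. tile P (period P n + (- a + x))) = 1"
      proof (rule tile_sum[OF assms(1)])
        fix i
        have "\<bar>x $ i\<bar> \<le> P / 2" using x by (simp add: torus_iff)
        then show "\<bar>(- a + x) $ i\<bar> \<le> 2 * P" using a[of i] assms(1) by simp
      qed
      then show "g x * (\<Sum>n\<in>near. tile P (- a + (period P n + x))) = g x"
        by (simp only: add.left_commute[of "- a"] mult_1_right)
    qed
  qed simp
  finally show ?thesis .
qed

subsection \<open>Wave vectors and orthogonality\<close>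

lemma wave_vectors_0: "0 \<in> wave_vectors P"
  unfolding wave_vectors_def by (rule CollectI, rule exI[of _ "\<lambda>_. 0"]) (simp add: vec_eq_iff)

lemma wave_vectors_add: "k \<in> wave_vectors P \<Longrightarrow> l \<in> wave_vectors P \<Longrightarrow> k + l \<in> wave_vectors P"
  unfolding wave_vectors_def
proof safe
  fix n m :: "3 \<Rightarrow> int"
  show "\<exists>na. (2 * pi / P) *\<^sub>R (\<chi> i. real_of_int (n i)) + (2 * pi / P) *\<^sub>R (\<chi> i. real_of_int (m i))
      = (2 * pi / P) *\<^sub>R (\<chi> i. real_of_int (na i)) \<and> True"
    by (rule exI[of _ "\<lambda>i. n i + m i"]) (simp add: vec_eq_iff distrib_left)
qed

lemma wave_vectors_minus: "k \<in> wave_vectors P \<Longrightarrow> - k \<in> wave_vectors P"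
  unfolding wave_vectors_def
proof safe
  fix n :: "3 \<Rightarrow> int"
  show "\<exists>na. - ((2 * pi / P) *\<^sub>R (\<chi> i. real_of_int (n i))) = (2 * pi / P) *\<^sub>R (\<chi> i. real_of_int (na i)) \<and> True"
    by (rule exI[of _ "\<lambda>i. - n i"]) (simp add: vec_eq_iff)
qed

lemma wave_vectors_axis: "axis j (2 * pi / P) \<in> wave_vectors P"
  unfolding wave_vectors_def
  by (rule CollectI, rule exI[of _ "\<lambda>i. of_bool (i = j)"]) (auto simp: vec_eq_iff axis_def)

lemma wave_vectors_nth:
  assumes "k \<in> wave_vectors P"
  obtains m :: int where "k $ i = 2 * pi / P * real_of_int m"
proof -
  obtain n :: "3 \<Rightarrow> int" where "k = (2 * pi / P) *\<^sub>R (\<chi> i. real_of_int (n i))"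
    using assms unfolding wave_vectors_def by blast
  then have "k $ i = 2 * pi / P * real_of_int (n i)" by simp
  then show ?thesis by (rule that)
qed

lemma inner_axis_real: "(k::real^3) \<bullet> axis i c = k $ i * c"
  by (simp add: inner_axis)

lemma periodic_inner_function:
  fixes F :: "real \<Rightarrow> 'b"
  assumes "P > 0" "k \<in> wave_vectors P" "\<And>y. F (y + 2 * pi) = F y"
  shows "periodic P (\<lambda>x. F (k \<bullet> x))"
  unfolding periodic_def
proof (intro allI)
  fix x :: "real^3" and i
  obtain m :: int where m: "k $ i = 2 * pi / P * real_of_int m" using wave_vectors_nth[OF assms(2)] by blast
  have F: "F (y + 2 * pi * real_of_int m) = F y" for y
  proof (induction m arbitrary: y rule: int_induct[of _ 0])
    case (step1 m)
    have "F (y + 2 * pi * real_of_int (m + 1)) = F ((y + 2 * pi) + 2 * pi * real_of_int m)"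
      by (simp add: algebra_simps)
    then show ?case using step1 assms(3) by simp
  next
    case (step2 m)
    have "F y = F ((y - 2 * pi) + 2 * pi)" by simp
    also have "\<dots> = F (y - 2 * pi)" by (rule assms(3))
    also have "\<dots> = F ((y - 2 * pi) + 2 * pi * real_of_int m)" using step2 by simp
    finally show ?case by (simp add: algebra_simps)
  qed simp
  have "k \<bullet> (x + P *\<^sub>R axis i 1) = k \<bullet> x + 2 * pi * real_of_int m"
    using assms(1) by (simp add: inner_add_right inner_axis_real m)
  then show "F (k \<bullet> (x + P *\<^sub>R axis i 1)) = F (k \<bullet> x)" by (simp add: F)
qed


text \<open>A shift along an axis on which \<open>k\<close> does not vanish advances the phase by
  \<open>pi\<close> and changes the sign of the integrand, so the integral equals its own negative.
  The shift \<open>pi / k $ j\<close> is at most half a period because \<open>k $ j\<close> is a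
  nonzero multiple of \<open>2 * pi / P\<close>.\<close>

lemma torus_integral_oscillating:
  fixes F :: "real \<Rightarrow> real"
  assumes "P > 0" "k \<in> wave_vectors P" "k \<noteq> 0"
    and F: "continuous_on UNIV F" "\<And>y. \<bar>F y\<bar> \<le> 1" "\<And>y. F (y + pi) = - F y"
  shows "(LINT x:torus P|lborel. F (k \<bullet> x)) = 0"
proof -
  obtain j where j: "k $ j \<noteq> 0" using assms(3) by (auto simp: vec_eq_iff)
  obtain m :: int where m: "k $ j = 2 * pi / P * real_of_int m" using wave_vectors_nth[OF assms(2)] by blast
  have m0: "m \<noteq> 0" using j m by auto
  define a :: "real^3" where "a = axis j (pi / k $ j)"
  have ka: "k \<bullet> (a + x) = k \<bullet> x + pi" for x
    using j by (simp add: a_def inner_add_right inner_axis_real)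
  have "\<bar>pi / k $ j\<bar> = P / (2 * \<bar>real_of_int m\<bar>)"
    using assms(1) m0 by (simp add: m abs_mult field_simps)
  also have "\<dots> \<le> P / 2"
    using m0 assms(1) by (intro divide_left_mono) auto
  finally have "\<bar>pi / k $ j\<bar> \<le> P" using assms(1) by linarith
  then have a: "\<bar>a $ i\<bar> \<le> P" for i
    using assms(1) by (simp add: a_def axis_def)
  have per: "periodic P (\<lambda>x. F (k \<bullet> x))"
  proof (rule periodic_inner_function[OF assms(1,2)])
    show "F (y + 2 * pi) = F y" for y using F(3)[of y] F(3)[of "y + pi"] by (simp add: add.assoc)
  qed
  have meas: "(\<lambda>x. F (k \<bullet> x)) \<in> borel_measurable borel"
    by (intro borel_measurable_continuous_onI continuous_on_compose2[OF F(1)] continuous_intros) auto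
  have "(LINT x:torus P|lborel. F (k \<bullet> x)) = (LINT x:torus P|lborel. F (k \<bullet> (a + x)))"
    by (rule torus_integral_translate[OF assms(1) meas per F(2) a, symmetric])
  also have "\<dots> = - (LINT x:torus P|lborel. F (k \<bullet> x))"
    by (simp add: ka F(3) set_lebesgue_integral_def)
  finally show ?thesis by simp
qed

lemma torus_integral_cos:
  assumes "P > 0" "k \<in> wave_vectors P"
  shows "(LINT x:torus P|lborel. cos (k \<bullet> x)) = (if k = 0 then measure lborel (torus P) else 0)"
proof (cases "k = 0")
  case False
  have "(LINT x:torus P|lborel. cos (k \<bullet> x)) = 0"
    by (rule torus_integral_oscillating[OF assms False, of cos]) (auto intro: continuous_intros)
  then show ?thesis using False by simp
qed (simp add: set_lebesgue_integral_def)

lemma torus_integral_sin: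
  assumes "P > 0" "k \<in> wave_vectors P"
  shows "(LINT x:torus P|lborel. sin (k \<bullet> x)) = 0"
proof (cases "k = 0")
  case False
  show ?thesis
    by (rule torus_integral_oscillating[OF assms False, of sin]) (auto intro: continuous_intros)
qed (simp add: set_lebesgue_integral_def)

subsection \<open>Trigonometric polynomials\<close>

text \<open>Generated by monomials and sums only, so that closure under products is an induction;
  the explicit finite expansion is extracted where orthogonality requires it.\<close>

inductive trig_poly :: "real \<Rightarrow> (real^3 \<Rightarrow> complex) \<Rightarrow> bool" for P where
  monomial: "k \<in> wave_vectors P \<Longrightarrow> trig_poly P (\<lambda>x. c * cis (k \<bullet> x))"
| add: "trig_poly P f \<Longrightarrow> trig_poly P g \<Longrightarrow> trig_poly P (\<lambda>x. f x + g x)"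

lemma trig_poly_mult:
  assumes "trig_poly P f" "trig_poly P g"
  shows "trig_poly P (\<lambda>x. f x * g x)"
  using assms(1)
proof induction
  case (monomial k c)
  show ?case
    using assms(2)
  proof induction
    case (monomial l d)
    have "trig_poly P (\<lambda>x. (c * d) * cis ((k + l) \<bullet> x))"
      by (intro trig_poly.monomial wave_vectors_add) fact+
    then show ?case by (simp add: inner_add_left cis_mult[symmetric] mult_ac)
  next
    case (add f g)
    then show ?case by (simp add: distrib_left trig_poly.add)
  qed
next
  case (add f h)
  then show ?case by (simp add: distrib_right trig_poly.add)
qed

lemma trig_poly_const: "trig_poly P (\<lambda>_. c)"
  using trig_poly.monomial[OF wave_vectors_0, of P c] by simp

lemma trig_poly_expansion:
  assumes "trig_poly P f"
  obtains F c where "finite F" "F \<subseteq> wave_vectors P" "f = (\<lambda>x. \<Sum>k\<in>F. c k * cis (k \<bullet> x))"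
proof -
  from assms have "\<exists>F c. finite F \<and> F \<subseteq> wave_vectors P \<and> f = (\<lambda>x. \<Sum>k\<in>F. c k * cis (k \<bullet> x))"
  proof induction
    case (monomial k c)
    then show ?case by (intro exI[of _ "{k}"] exI[of _ "\<lambda>_. c"]) simp
  next
    case (add f g)
    obtain F c where f: "finite F" "F \<subseteq> wave_vectors P" "f = (\<lambda>x. \<Sum>k\<in>F. c k * cis (k \<bullet> x))"
      using add by blast
    obtain G d where g: "finite G" "G \<subseteq> wave_vectors P" "g = (\<lambda>x. \<Sum>k\<in>G. d k * cis (k \<bullet> x))"
      using add by blast
    have "(\<Sum>k\<in>F. c k * cis (k \<bullet> x)) = (\<Sum>k\<in>F \<union> G. (if k \<in> F then c k else 0) * cis (k \<bullet> x))" for x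
      using f(1) g(1) by (intro sum.mono_neutral_cong_left) auto
    moreover have "(\<Sum>k\<in>G. d k * cis (k \<bullet> x)) = (\<Sum>k\<in>F \<union> G. (if k \<in> G then d k else 0) * cis (k \<bullet> x))" for x
      using f(1) g(1) by (intro sum.mono_neutral_cong_left) auto
    ultimately have "(\<lambda>x. f x + g x) = (\<lambda>x. \<Sum>k\<in>F \<union> G. ((if k \<in> F then c k else 0) + (if k \<in> G then d k else 0)) * cis (k \<bullet> x))"
      unfolding f(3) g(3) by (simp add: sum.distrib distrib_right)
    moreover have "finite (F \<union> G)" "F \<union> G \<subseteq> wave_vectors P" using f g by auto
    ultimately show ?case
      by (intro exI[of _ "F \<union> G"] exI[of _ "\<lambda>k. (if k \<in> F then c k else 0) + (if k \<in> G then d k else 0)"]) simp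
  qed
  then show ?thesis using that by blast
qed

lemma trig_poly_continuous: "trig_poly P f \<Longrightarrow> continuous_on UNIV f"
proof (induction rule: trig_poly.induct)
  case (monomial k c)
  show ?case unfolding cis_conv_exp by (intro continuous_intros)
qed (rule continuous_on_add)

text \<open>The cell wrapped onto a product of three circles. Real polynomials on the compact image
  pull back to trigonometric polynomials, which brings polynomial approximation within
  reach.\<close>

definition torus_embed :: "real \<Rightarrow> real^3 \<Rightarrow> complex^3" where
  "torus_embed P x = (\<chi> i. cis (2 * pi / P * x $ i))"

lemma continuous_torus_embed: "continuous_on A (torus_embed P)"
  unfolding torus_embed_def cis_conv_exp by (intro continuous_intros)

lemma trig_poly_sum: "(\<And>i. i \<in> I \<Longrightarrow> trig_poly P (f i)) \<Longrightarrow> trig_poly P (\<lambda>x. \<Sum>i\<in>I. f i x)"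
proof (induction I rule: infinite_finite_induct)
  case (insert a I)
  have "trig_poly P (\<lambda>x. f a x + (\<Sum>i\<in>I. f i x))"
    by (rule trig_poly.add) (use insert in auto)
  then show ?case using insert by simp
qed (use trig_poly_const[of P 0] in simp_all)

lemma trig_poly_torus_embed:
  assumes "real_polynomial_function p"
  shows "trig_poly P (\<lambda>x. complex_of_real (p (torus_embed P x)))"
  using assms
proof induction
  case (linear f)
  \<comment> \<open>A real-linear form on \<open>complex^3\<close> reads off cosines and sines of
    the scaled coordinates, and Euler's formulas turn these into exponentials with wave vectors plus
    or minus \<open>axis i (2 * pi / P)\<close>.\<close>
  have 1: "complex_of_real (f (torus_embed P x))
      = (\<Sum>i\<in>UNIV. complex_of_real (f (axis i 1)) * (cis (axis i (2 * pi / P) \<bullet> x) + cis ((- axis i (2 * pi / P)) \<bullet> x)) / 2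
          + complex_of_real (f (axis i \<i>)) * (cis (axis i (2 * pi / P) \<bullet> x) - cis ((- axis i (2 * pi / P)) \<bullet> x)) / (2 * \<i>))" for x
  proof -
    have "torus_embed P x = (\<Sum>i\<in>UNIV. cos (2 * pi / P * x $ i) *\<^sub>R axis i 1 + sin (2 * pi / P * x $ i) *\<^sub>R axis i \<i>)"
      by (simp add: torus_embed_def vec_eq_iff axis_def if_distrib complex_eq_iff cong: if_cong)
    then have "f (torus_embed P x) = (\<Sum>i\<in>UNIV. cos (2 * pi / P * x $ i) * f (axis i 1) + sin (2 * pi / P * x $ i) * f (axis i \<i>))"
      using linear by (simp add: linear_sum linear_add linear_scale bounded_linear.linear)
    moreover have "axis i (2 * pi / P) \<bullet> x = 2 * pi / P * x $ i" for i
      by (metis inner_commute inner_axis_real mult.commute)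
    moreover have "complex_of_real a * (cis t + cis (- t)) / 2 + complex_of_real b * (cis t - cis (- t)) / (2 * \<i>)
        = complex_of_real (cos t * a + sin t * b)" for a b t
    proof -
      have "cis t + cis (- t) = 2 * complex_of_real (cos t)" "cis t - cis (- t) = 2 * \<i> * complex_of_real (sin t)"
        by (simp_all add: complex_eq_iff)
      moreover have "x * (2 * \<i> * y) / (2 * \<i>) = x * y" for x y :: complex
        using nonzero_mult_div_cancel_left[of "2 * \<i>" "x * y"] by (simp only: mult_ac) simp
      ultimately show ?thesis by (simp only:) (simp add: mult.commute)
    qed
    ultimately show ?thesis by (simp only: inner_minus_left of_real_sum)
  qed
  have 2: "trig_poly P (\<lambda>x. cis (axis i (2 * pi / P) \<bullet> x))" "trig_poly P (\<lambda>x. cis ((- axis i (2 * pi / P)) \<bullet> x))" for i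
    using trig_poly.monomial[OF wave_vectors_axis, of P 1 i]
      trig_poly.monomial[OF wave_vectors_minus[OF wave_vectors_axis], of P 1 i] by simp_all
  have 3: "trig_poly P (\<lambda>x. c * (cis (axis i (2 * pi / P) \<bullet> x) + cis ((- axis i (2 * pi / P)) \<bullet> x)) / 2
          + d * (cis (axis i (2 * pi / P) \<bullet> x) - cis ((- axis i (2 * pi / P)) \<bullet> x)) / (2 * \<i>))" for c d i
  proof -
    have "trig_poly P (\<lambda>x. (c / 2 + d / (2 * \<i>)) * cis (axis i (2 * pi / P) \<bullet> x)
        + (c / 2 - d / (2 * \<i>)) * cis ((- axis i (2 * pi / P)) \<bullet> x))"
      by (rule trig_poly.add[OF trig_poly_mult[OF trig_poly_const 2(1)] trig_poly_mult[OF trig_poly_const 2(2)]])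
    also have "(\<lambda>x. (c / 2 + d / (2 * \<i>)) * cis (axis i (2 * pi / P) \<bullet> x)
        + (c / 2 - d / (2 * \<i>)) * cis ((- axis i (2 * pi / P)) \<bullet> x))
      = (\<lambda>x. c * (cis (axis i (2 * pi / P) \<bullet> x) + cis ((- axis i (2 * pi / P)) \<bullet> x)) / 2
          + d * (cis (axis i (2 * pi / P) \<bullet> x) - cis ((- axis i (2 * pi / P)) \<bullet> x)) / (2 * \<i>))"
      by (simp add: add_divide_distrib diff_divide_distrib algebra_simps)
    finally show ?thesis .
  qed
  show ?case unfolding 1 by (rule trig_poly_sum[OF 3])
next
  case (const c)
  show ?case by (rule trig_poly_const)
next
  case (add f g)
  then show ?case by (simp add: trig_poly.add)
next
  case (mult f g)
  then show ?case by (simp add: trig_poly_mult)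
qed

text \<open>
  On the cell, \<^const>\<open>torus_embed\<close> identifies only boundary points, so a continuous function
  vanishing there factors through the image, where Stone--Weierstrass applies.
\<close>

lemma trig_poly_approx:
  fixes g :: "real^3 \<Rightarrow> real"
  assumes "P > 0" and g: "continuous_on (torus P) g"
    and bd: "\<And>x i. x \<in> torus P \<Longrightarrow> \<bar>x $ i\<bar> = P / 2 \<Longrightarrow> g x = 0" and "e > 0"
  obtains q where "trig_poly P (\<lambda>x. complex_of_real (q x))" "\<And>x. x \<in> torus P \<Longrightarrow> \<bar>g x - q x\<bar> < e"
proof -
  define K where "K = torus_embed P ` torus P"
  have ct: "compact (torus P)" by (simp add: torus_def)
  have cK: "compact K" unfolding K_def by (intro compact_continuous_image continuous_torus_embed ct)
  have eq: "g x = g y" if x: "x \<in> torus P" and y: "y \<in> torus P" and e: "torus_embed P x = torus_embed P y" for x y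
  proof (cases "x = y")
    case False
    then obtain i where i: "x $ i \<noteq> y $ i" by (auto simp: vec_eq_iff)
    have "cis (2 * pi / P * x $ i) = cis (2 * pi / P * y $ i)"
      using e by (simp add: torus_embed_def vec_eq_iff)
    then have "cis (2 * pi / P * x $ i - 2 * pi / P * y $ i) = 1"
      by (simp add: cis_divide[symmetric])
    then have "cos (2 * pi / P * x $ i - 2 * pi / P * y $ i) = 1"
      by (metis cis.sel(1) one_complex.sel(1))
    then obtain n :: int where "2 * pi / P * x $ i - 2 * pi / P * y $ i = of_int n * 2 * pi"
      using cos_one_2pi_int by blast
    then have "2 * pi * (x $ i - y $ i) = 2 * pi * (P * of_int n)" using assms(1) by (simp add: field_simps)
    then have n: "x $ i - y $ i = P * of_int n" by simp
    have xy: "\<bar>x $ i\<bar> \<le> P / 2" "\<bar>y $ i\<bar> \<le> P / 2" using x y by (auto simp: torus_iff)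
    have "n \<noteq> 0" using n i by auto
    then have "\<bar>x $ i - y $ i\<bar> \<ge> P" using assms(1) by (simp add: n abs_mult mult_le_cancel_left1)
    then have "\<bar>x $ i\<bar> = P / 2" "\<bar>y $ i\<bar> = P / 2" using xy by linarith+
    then show ?thesis using bd x y by metis
  qed simp
  define G where "G y = g (SOME x. x \<in> torus P \<and> torus_embed P x = y)" for y
  have G: "G (torus_embed P x) = g x" if "x \<in> torus P" for x
  proof -
    have "(SOME z. z \<in> torus P \<and> torus_embed P z = torus_embed P x) \<in> torus P \<and>
        torus_embed P (SOME z. z \<in> torus P \<and> torus_embed P z = torus_embed P x) = torus_embed P x"
      by (rule someI[of _ x]) (use that in simp)
    then show ?thesis unfolding G_def using eq that by blast
  qed
  \<comment> \<open>A continuous surjection from a compact space onto a Hausdorff one is a quotient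
    map, so preimages under \<open>G\<close> may be tested for openness in the cell, where
    \<open>G\<close> becomes \<open>g\<close>.\<close>
  have "continuous_on K G"
    unfolding continuous_openin_preimage_eq
  proof (intro allI impI)
    fix B :: "real set" assume "open B"
    have "torus P \<inter> torus_embed P -` (K \<inter> G -` B) = torus P \<inter> g -` B"
      using G by (auto simp: K_def simp del: vimage_Int) (metis G)+
    moreover have "openin (top_of_set (torus P)) (torus P \<inter> g -` B)"
      using g \<open>open B\<close> by (simp add: continuous_openin_preimage_eq)
    ultimately show "openin (top_of_set K) (K \<inter> G -` B)"
      using Abstract_Topology_2.continuous_imp_quotient_map[OF continuous_torus_embed K_def[symmetric] ct, of "K \<inter> G -` B"]
      by simp
  qed
  from Stone_Weierstrass_real_polynomial_function[OF cK this \<open>e > 0\<close>]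
  obtain p where p: "real_polynomial_function p" "\<And>y. y \<in> K \<Longrightarrow> \<bar>G y - p y\<bar> < e" by blast
  show ?thesis
  proof (rule that[OF trig_poly_torus_embed[OF p(1)]])
    fix x assume x: "x \<in> torus P"
    then have "torus_embed P x \<in> K" by (simp add: K_def)
    from p(2)[OF this] show "\<bar>g x - p (torus_embed P x)\<bar> < e" by (simp add: G[OF x])
  qed
qed

subsection \<open>Completeness\<close>

lemma torus_mult_cis_integrable:
  fixes f :: "real^3 \<Rightarrow> real"
  assumes "set_integrable lborel (torus P) f"
  shows "set_integrable lborel (torus P) (\<lambda>x. complex_of_real (f x) * cis (k \<bullet> x))"
proof -
  have c: "(\<lambda>x. cis (k \<bullet> x)) \<in> borel_measurable borel"
    unfolding cis_conv_exp by (intro borel_measurable_continuous_onI continuous_intros)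
  have m: "(\<lambda>x. complex_of_real (indicator (torus P) x *\<^sub>R f x) * cis (k \<bullet> x)) \<in> borel_measurable lborel"
  proof (rule borel_measurable_times)
    show "(\<lambda>x. complex_of_real (indicator (torus P) x *\<^sub>R f x)) \<in> borel_measurable lborel"
      by (rule measurable_compose[OF borel_measurable_integrable[OF assms[unfolded set_integrable_def]]])
         (intro borel_measurable_continuous_onI continuous_intros)
  qed (use c in simp)
  have "integrable lborel (\<lambda>x. complex_of_real (indicator (torus P) x *\<^sub>R f x) * cis (k \<bullet> x))"
    by (rule Bochner_Integration.integrable_bound[OF assms[unfolded set_integrable_def] m])
       (simp add: norm_mult)
  then show ?thesis by (simp add: set_integrable_def scaleR_conv_of_real mult.assoc)
qed

lemma set_integral_finite_sum:
  fixes f :: "'i \<Rightarrow> 'a \<Rightarrow> 'b::{banach, second_countable_topology}"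
  assumes "\<And>i. i \<in> I \<Longrightarrow> set_integrable M A (f i)"
  shows "(LINT x:A|M. (\<Sum>i\<in>I. f i x)) = (\<Sum>i\<in>I. (LINT x:A|M. f i x))"
    and "set_integrable M A (\<lambda>x. \<Sum>i\<in>I. f i x)"
  using assms unfolding set_lebesgue_integral_def set_integrable_def
  by (simp_all add: scaleR_sum_right)

lemma torus_integral_cis:
  assumes "P > 0" "k \<in> wave_vectors P"
  shows "(CLINT x:torus P|lborel. cis (k \<bullet> x)) = (if k = 0 then complex_of_real (measure lborel (torus P)) else 0)"
proof -
  have "set_integrable lborel (torus P) (\<lambda>x. cis (k \<bullet> x))"
    using torus_mult_cis_integrable[OF torus_integrable_bounded[of "\<lambda>_. 1" 1], of P k] by simp
  then have i: "integrable lborel (\<lambda>x. indicator (torus P) x *\<^sub>R cis (k \<bullet> x))"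
    by (simp add: set_integrable_def)
  have "Re (CLINT x:torus P|lborel. cis (k \<bullet> x)) = (LINT x:torus P|lborel. cos (k \<bullet> x))"
    unfolding set_lebesgue_integral_def by (subst integral_Re[OF i, symmetric]) simp
  moreover have "Im (CLINT x:torus P|lborel. cis (k \<bullet> x)) = (LINT x:torus P|lborel. sin (k \<bullet> x))"
    unfolding set_lebesgue_integral_def by (subst integral_Im[OF i, symmetric]) simp
  ultimately show ?thesis
    using torus_integral_cos[OF assms] torus_integral_sin[OF assms] by (auto simp: complex_eq_iff)
qed

lemma trig_poly_norm:
  assumes "P > 0" "finite F" "F \<subseteq> wave_vectors P"
    and q: "\<And>x. complex_of_real (q x) = (\<Sum>k\<in>F. c k * cis (k \<bullet> x))"
  shows "(LINT x:torus P|lborel. (q x)\<^sup>2) = measure lborel (torus P) * (\<Sum>k\<in>F. (norm (c k))\<^sup>2)"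
proof -
  have i: "set_integrable lborel (torus P) (\<lambda>x. a * cis (k \<bullet> x))" for a k
    using torus_mult_cis_integrable[OF torus_integrable_bounded[of "\<lambda>_. 1" 1], of P k] by simp
  have "complex_of_real (LINT x:torus P|lborel. (q x)\<^sup>2) = (CLINT x:torus P|lborel. complex_of_real ((q x)\<^sup>2))"
    by (rule set_integral_complex_of_real[symmetric])
  also have "\<dots> = (CLINT x:torus P|lborel. (\<Sum>k\<in>F. \<Sum>l\<in>F. c k * cnj (c l) * cis ((k - l) \<bullet> x)))"
  proof -
    \<comment> \<open>As \<open>q\<close> is real, one factor may be conjugated; the double sum then
      involves differences of wave vectors, and orthogonality leaves the diagonal.\<close>
    have "complex_of_real ((q x)\<^sup>2) = complex_of_real (q x) * cnj (complex_of_real (q x))" for x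
      by (simp add: power2_eq_square)
    also have "\<dots> x = (\<Sum>k\<in>F. \<Sum>l\<in>F. c k * cnj (c l) * cis ((k - l) \<bullet> x))" for x
      unfolding q by (simp add: sum_product cis_cnj inner_diff_left mult_ac cis_divide[symmetric] divide_inverse)
    finally show ?thesis by simp
  qed
  also have "\<dots> = (\<Sum>k\<in>F. \<Sum>l\<in>F. (CLINT x:torus P|lborel. c k * cnj (c l) * cis ((k - l) \<bullet> x)))"
    by (simp only: set_integral_finite_sum i)
  also have "\<dots> = (\<Sum>k\<in>F. \<Sum>l\<in>F. if l = k then c k * cnj (c k) * complex_of_real (measure lborel (torus P)) else 0)"
  proof (intro sum.cong refl)
    fix k l assume "k \<in> F" "l \<in> F"
    then have "k - l \<in> wave_vectors P"
      using wave_vectors_add[OF _ wave_vectors_minus, of k P l] assms(3) by auto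
    from torus_integral_cis[OF assms(1) this]
    show "(CLINT x:torus P|lborel. c k * cnj (c l) * cis ((k - l) \<bullet> x))
        = (if l = k then c k * cnj (c k) * complex_of_real (measure lborel (torus P)) else 0)"
      by auto
  qed
  also have "\<dots> = complex_of_real (measure lborel (torus P) * (\<Sum>k\<in>F. (norm (c k))\<^sup>2))"
    using assms(2) by (simp add: sum.delta complex_norm_square[symmetric] sum_distrib_left mult.commute)
  finally show ?thesis by (simp only: of_real_eq_iff)
qed

text \<open>The pairing is the sum of products of coefficients of \<open>v\<close> with conjugate
  coefficients of \<open>q\<close>; Cauchy-Schwarz and \<open>trig_poly_norm\<close> conclude. The
  integrals bounded by \<open>Z\<close> carry no normalization, whence the division by the measure
  of the cell.\<close>

lemma trig_poly_duality:
  fixes v :: "real^3 \<Rightarrow> real"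
  assumes "P > 0" and v: "set_integrable lborel (torus P) v"
    and q: "trig_poly P (\<lambda>x. complex_of_real (q x))"
    and Z: "\<And>F. finite F \<Longrightarrow> F \<subseteq> wave_vectors P \<Longrightarrow>
      (\<Sum>k\<in>F. (norm (CLINT x:torus P|lborel. complex_of_real (v x) * cis (- (k \<bullet> x))))\<^sup>2) \<le> Z"
  shows "(LINT x:torus P|lborel. v x * q x)\<^sup>2 \<le> Z / measure lborel (torus P) * (LINT x:torus P|lborel. (q x)\<^sup>2)"
proof -
  define a where "a k = (CLINT x:torus P|lborel. complex_of_real (v x) * cis (- (k \<bullet> x)))" for k
  from trig_poly_expansion[OF q] obtain F c where F: "finite F" "F \<subseteq> wave_vectors P"
    and qq: "(\<lambda>x. complex_of_real (q x)) = (\<lambda>x. \<Sum>k\<in>F. c k * cis (k \<bullet> x))" by blast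
  have qx: "complex_of_real (q x) = (\<Sum>k\<in>F. c k * cis (k \<bullet> x))" for x using qq by (rule fun_cong)
  have i: "set_integrable lborel (torus P) (\<lambda>x. b * (complex_of_real (v x) * cis (- (k \<bullet> x))))" for k b
    using torus_mult_cis_integrable[OF v, of "- k"] by simp
  note mpos = measure_torus_pos[OF assms(1)]
  have "complex_of_real (LINT x:torus P|lborel. v x * q x) = (CLINT x:torus P|lborel. complex_of_real (v x * q x))"
    by (rule set_integral_complex_of_real[symmetric])
  also have "\<dots> = (CLINT x:torus P|lborel. (\<Sum>k\<in>F. cnj (c k) * (complex_of_real (v x) * cis (- (k \<bullet> x)))))"
  proof -
    have "complex_of_real (v x * q x) = complex_of_real (v x) * cnj (complex_of_real (q x))" for x by simp
    also have "\<dots> x = (\<Sum>k\<in>F. cnj (c k) * (complex_of_real (v x) * cis (- (k \<bullet> x))))" for x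
      unfolding qx by (simp add: sum_distrib_left cis_cnj mult_ac)
    finally show ?thesis by simp
  qed
  also have "\<dots> = (\<Sum>k\<in>F. cnj (c k) * a k)"
    by (subst set_integral_finite_sum(1)[OF i]) (simp add: a_def)
  finally have "\<bar>LINT x:torus P|lborel. v x * q x\<bar> = norm (\<Sum>k\<in>F. cnj (c k) * a k)"
    by (metis norm_of_real)
  also have "\<dots> \<le> (\<Sum>k\<in>F. \<bar>norm (c k) * norm (a k)\<bar>)"
    by (rule order_trans[OF norm_sum]) (simp add: norm_mult)
  also have "\<dots> \<le> L2_set (\<lambda>k. norm (c k)) F * L2_set (\<lambda>k. norm (a k)) F"
    using L2_set_mult_ineq[of "\<lambda>k. norm (c k)" "\<lambda>k. norm (a k)" F] by (simp add: abs_mult)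
  finally have "\<bar>LINT x:torus P|lborel. v x * q x\<bar> \<le> L2_set (\<lambda>k. norm (c k)) F * L2_set (\<lambda>k. norm (a k)) F" .
  from power_mono[OF this abs_ge_zero, of 2]
  have "(LINT x:torus P|lborel. v x * q x)\<^sup>2 \<le> (L2_set (\<lambda>k. norm (c k)) F * L2_set (\<lambda>k. norm (a k)) F)\<^sup>2"
    by (simp only: power2_abs)
  also have "\<dots> = (\<Sum>k\<in>F. (norm (c k))\<^sup>2) * (\<Sum>k\<in>F. (norm (a k))\<^sup>2)"
    by (simp add: power_mult_distrib L2_set_def sum_nonneg)
  also have "\<dots> \<le> (\<Sum>k\<in>F. (norm (c k))\<^sup>2) * Z"
    using Z[OF F] by (intro mult_left_mono) (auto simp: a_def intro: sum_nonneg)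
  also have "\<dots> = Z / measure lborel (torus P) * (LINT x:torus P|lborel. (q x)\<^sup>2)"
    unfolding trig_poly_norm[OF assms(1) F qx] using mpos by simp
  finally show ?thesis .
qed

lemma torus_dominated_convergence:
  fixes s :: "nat \<Rightarrow> real^3 \<Rightarrow> real"
  assumes "\<And>n. set_borel_measurable lborel (torus P) (s n)" "set_borel_measurable lborel (torus P) f"
    and w: "set_integrable lborel (torus P) w"
    and "AE x in lborel. x \<in> torus P \<longrightarrow> (\<lambda>n. s n x) \<longlonglongrightarrow> f x"
    and "\<And>n x. x \<in> torus P \<Longrightarrow> \<bar>s n x\<bar> \<le> w x"
  shows "(\<lambda>n. LINT x:torus P|lborel. s n x) \<longlonglongrightarrow> (LINT x:torus P|lborel. f x)"
  unfolding set_lebesgue_integral_def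
proof (rule integral_dominated_convergence[OF _ _ w[unfolded set_integrable_def]])
  show "AE x in lborel. (\<lambda>n. indicator (torus P) x *\<^sub>R s n x) \<longlonglongrightarrow> indicator (torus P) x *\<^sub>R f x"
    using assms(4) by eventually_elim (auto simp: indicator_def)
  show "AE x in lborel. norm (indicator (torus P) x *\<^sub>R s n x) \<le> indicator (torus P) x *\<^sub>R w x" for n
    using assms(5) by (intro AE_I2) (auto simp: indicator_def)
qed (use assms(1,2) in \<open>auto simp: set_borel_measurable_def\<close>)

text \<open>
  The duality inequality passes to uniform limits, and then to bounded limits almost everywhere.
\<close>

lemma continuous_duality:
  fixes v g :: "real^3 \<Rightarrow> real"
  assumes "P > 0" and v: "set_integrable lborel (torus P) v"
    and Z: "\<And>q. trig_poly P (\<lambda>x. complex_of_real (q x)) \<Longrightarrow>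
      (LINT x:torus P|lborel. v x * q x)\<^sup>2 \<le> Z * (LINT x:torus P|lborel. (q x)\<^sup>2)"
    and g: "continuous_on UNIV g"
    and bd: "\<And>x i. x \<in> torus P \<Longrightarrow> \<bar>x $ i\<bar> = P / 2 \<Longrightarrow> g x = 0"
  shows "(LINT x:torus P|lborel. v x * g x)\<^sup>2 \<le> Z * (LINT x:torus P|lborel. (g x)\<^sup>2)"
proof -
  have "\<exists>q. trig_poly P (\<lambda>x. complex_of_real (q x)) \<and> (\<forall>x\<in>torus P. \<bar>g x - q x\<bar> < inverse (real (Suc n)))" for n
  proof -
    have e: "inverse (real (Suc n)) > 0" by simp
    obtain q where "trig_poly P (\<lambda>x. complex_of_real (q x))" "\<And>x. x \<in> torus P \<Longrightarrow> \<bar>g x - q x\<bar> < inverse (real (Suc n))"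
      by (rule trig_poly_approx[OF assms(1) continuous_on_subset[OF g subset_UNIV] _ e])
         (use bd in blast)+
    then show ?thesis by blast
  qed
  then obtain q where q: "\<And>n. trig_poly P (\<lambda>x. complex_of_real (q n x))"
    and ql: "\<And>n x. x \<in> torus P \<Longrightarrow> \<bar>g x - q n x\<bar> < inverse (real (Suc n))" by metis
  have "bounded (g ` torus P)"
    by (intro compact_imp_bounded compact_continuous_image continuous_on_subset[OF g]) (auto simp: torus_def)
  then obtain B where "\<forall>x\<in>torus P. \<bar>g x\<bar> \<le> B" by (auto simp: bounded_iff)
  then have B: "\<And>x. x \<in> torus P \<Longrightarrow> \<bar>g x\<bar> \<le> B" by blast
  have qb: "\<bar>q n x\<bar> \<le> B + 1" if "x \<in> torus P" for n x
  proof -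
    have "inverse (real (Suc n)) \<le> 1" by (simp add: inverse_le_1_iff)
    then show ?thesis using ql[OF that, of n] B[OF that] by linarith
  qed
  have conv: "(\<lambda>n. q n x) \<longlonglongrightarrow> g x" if "x \<in> torus P" for x
  proof (rule metric_LIMSEQ_I)
    fix r :: real assume "r > 0"
    then obtain N where N: "inverse (real (Suc N)) < r" using reals_Archimedean by blast
    have "dist (q n x) (g x) < r" if "n \<ge> N" for n
    proof -
      have "inverse (real (Suc n)) \<le> inverse (real (Suc N))" using that by (simp add: le_imp_inverse_le)
      then have "\<bar>g x - q n x\<bar> < r" using ql[OF \<open>x \<in> torus P\<close>, of n] N by linarith
      then show ?thesis by (simp add: dist_real_def abs_minus_commute)
    qed
    then show "\<exists>no. \<forall>n\<ge>no. dist (q n x) (g x) < r" by blast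
  qed
  have qm: "q n \<in> borel_measurable borel" for n
  proof -
    have "continuous_on UNIV (\<lambda>x. Re (complex_of_real (q n x)))"
      by (intro continuous_intros trig_poly_continuous[OF q])
    then show ?thesis by (simp add: borel_measurable_continuous_onI)
  qed
  have gm: "g \<in> borel_measurable borel" by (rule borel_measurable_continuous_onI[OF g])
  have vm: "(\<lambda>x. indicator (torus P) x * v x) \<in> borel_measurable lborel"
    using v by (simp add: set_integrable_def)
  have l1: "(\<lambda>n. LINT x:torus P|lborel. v x * q n x) \<longlonglongrightarrow> (LINT x:torus P|lborel. v x * g x)"
  proof (rule torus_dominated_convergence[where w="\<lambda>x. \<bar>v x\<bar> * (B + 1)"])
    show "set_integrable lborel (torus P) (\<lambda>x. \<bar>v x\<bar> * (B + 1))"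
      by (intro set_integrable_mult_left set_integrable_abs v)
    show "set_borel_measurable lborel (torus P) (\<lambda>x. v x * q n x)" for n
      unfolding set_borel_measurable_def
      using borel_measurable_times[OF vm, of "q n"] qm by (simp add: mult.assoc)
    show "set_borel_measurable lborel (torus P) (\<lambda>x. v x * g x)"
      unfolding set_borel_measurable_def
      using borel_measurable_times[OF vm, of g] gm by (simp add: mult.assoc)
    show "AE x in lborel. x \<in> torus P \<longrightarrow> (\<lambda>n. v x * q n x) \<longlonglongrightarrow> v x * g x"
      by (intro AE_I2 impI tendsto_intros conv)
    show "\<bar>v x * q n x\<bar> \<le> \<bar>v x\<bar> * (B + 1)" if "x \<in> torus P" for n x
      unfolding abs_mult by (intro mult_left_mono qb that) auto
  qed
  have l2: "(\<lambda>n. LINT x:torus P|lborel. (q n x)\<^sup>2) \<longlonglongrightarrow> (LINT x:torus P|lborel. (g x)\<^sup>2)"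
  proof (rule torus_dominated_convergence[where w="\<lambda>x. (B + 1)\<^sup>2"])
    show "set_integrable lborel (torus P) (\<lambda>x. (B + 1)\<^sup>2)"
      by (rule torus_integrable_bounded[of _ "(B + 1)\<^sup>2"]) auto
    show "AE x in lborel. x \<in> torus P \<longrightarrow> (\<lambda>n. (q n x)\<^sup>2) \<longlonglongrightarrow> (g x)\<^sup>2"
      by (intro AE_I2 impI tendsto_intros conv)
    show "\<bar>(q n x)\<^sup>2\<bar> \<le> (B + 1)\<^sup>2" if "x \<in> torus P" for n x
      using power_mono[OF qb[OF that, of n], of 2] by simp
  qed (use qm gm in \<open>auto simp: set_borel_measurable_def\<close>)
  show ?thesis
    by (rule LIMSEQ_le[OF tendsto_power[OF l1] tendsto_mult[OF tendsto_const l2]]) (use Z[OF q] in auto)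
qed

lemma measurable_duality:
  fixes v g :: "real^3 \<Rightarrow> real"
  assumes "P > 0" and v: "set_integrable lborel (torus P) v"
    and Z: "\<And>q. continuous_on UNIV q \<Longrightarrow> (\<And>x i. x \<in> torus P \<Longrightarrow> \<bar>x $ i\<bar> = P / 2 \<Longrightarrow> q x = 0) \<Longrightarrow>
      (LINT x:torus P|lborel. v x * q x)\<^sup>2 \<le> Z * (LINT x:torus P|lborel. (q x)\<^sup>2)"
    and g: "g \<in> borel_measurable borel" and B: "\<And>x. \<bar>g x\<bar> \<le> B"
  shows "(LINT x:torus P|lborel. v x * g x)\<^sup>2 \<le> Z * (LINT x:torus P|lborel. (g x)\<^sup>2)"
proof -
  have B0: "B \<ge> 0" using B[of 0] by linarith
  have "g measurable_on UNIV"
    using g by (intro lebesgue_measurable_imp_measurable_on) (auto intro: measurable_completion)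
  then obtain N h where N: "negligible N" and h: "\<And>n. continuous_on UNIV (h n)"
    and hl: "\<And>x. x \<notin> N \<Longrightarrow> (\<lambda>n. h n x) \<longlonglongrightarrow> g x"
    unfolding measurable_on_def by auto
  \<comment> \<open>Approximants must vanish on the faces for the continuous case to apply;
    \<open>\<rho> n\<close> achieves this and tends to 1 in the open cell. The faces themselves are
    null.\<close>
  define \<rho> :: "nat \<Rightarrow> real^3 \<Rightarrow> real"
    where "\<rho> n x = (\<Prod>i\<in>UNIV. max 0 (min 1 (real n * (P / 2 - \<bar>x $ i\<bar>))))" for n x
  \<comment> \<open>Clamping to the range of \<open>g\<close> preserves the limit and supplies the
    bound for dominated convergence.\<close>
  define q where "q n x = \<rho> n x * max (- B) (min B (h n x))" for n x
  have \<rho>01: "0 \<le> \<rho> n x" "\<rho> n x \<le> 1" for n x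
    unfolding \<rho>_def by (auto intro!: prod_nonneg prod_le_1)
  have qc: "continuous_on UNIV (q n)" for n
    unfolding q_def \<rho>_def by (intro continuous_intros continuous_on_max continuous_on_min h)
  have q0: "q n x = 0" if "\<bar>x $ i\<bar> = P / 2" for n x i
  proof -
    have "\<rho> n x = 0" unfolding \<rho>_def by (rule prod_zero) (use that in \<open>auto intro!: exI[of _ i]\<close>)
    then show ?thesis by (simp add: q_def)
  qed
  have qb: "\<bar>q n x\<bar> \<le> B" for n x
  proof -
    have "\<bar>max (- B) (min B (h n x))\<bar> \<le> B" using B0 by linarith
    then show ?thesis unfolding q_def abs_mult using \<rho>01[of n x] B0
      by (metis abs_ge_zero abs_of_nonneg mult_left_le_one_le order_trans)
  qed
  have \<rho>lim: "(\<lambda>n. \<rho> n x) \<longlonglongrightarrow> 1" if "\<And>i. \<bar>x $ i\<bar> < P / 2" for x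
  proof -
    have "(\<lambda>n. \<Prod>i\<in>UNIV. max 0 (min 1 (real n * (P / 2 - \<bar>x $ i\<bar>)))) \<longlonglongrightarrow> (\<Prod>i\<in>(UNIV::3 set). 1)"
    proof (rule tendsto_prod)
      fix i
      have "filterlim (\<lambda>n. real n * (P / 2 - \<bar>x $ i\<bar>)) at_top sequentially"
        using that[of i] by (intro filterlim_at_top_mult_tendsto_pos[OF tendsto_const _ filterlim_real_sequentially]) auto
      then have "\<forall>\<^sub>F n in sequentially. 1 \<le> real n * (P / 2 - \<bar>x $ i\<bar>)"
        unfolding filterlim_at_top by blast
      then have "\<forall>\<^sub>F n in sequentially. max 0 (min 1 (real n * (P / 2 - \<bar>x $ i\<bar>))) = 1"
        by eventually_elim simp
      then show "(\<lambda>n. max 0 (min 1 (real n * (P / 2 - \<bar>x $ i\<bar>)))) \<longlonglongrightarrow> 1" by (rule tendsto_eventually)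
    qed
    then show ?thesis by (simp add: \<rho>_def)
  qed
  have ae: "AE x in lborel. x \<in> torus P \<longrightarrow> (\<lambda>n. q n x) \<longlonglongrightarrow> g x"
  proof -
    have "AE x::real^3 in lborel. x \<notin> N"
    proof -
      have "AE x::real^3 in lebesgue. x \<notin> N"
        using N by (intro AE_not_in) (simp add: negligible_iff_null_sets)
      then show ?thesis by (simp add: AE_completion_iff)
    qed
    moreover have "AE x::real^3 in lborel. \<forall>i\<in>UNIV. x $ i \<notin> {P / 2, - (P / 2)}"
    proof (subst AE_ball_countable)
      show "\<forall>i\<in>UNIV. AE x::real^3 in lborel. x $ i \<notin> {P / 2, - (P / 2)}"
      proof
        fix i :: 3
        show "AE x::real^3 in lborel. x $ i \<notin> {P / 2, - (P / 2)}"
          using AE_coordinate_notin_countable[of "{P / 2, - (P / 2)}" "axis i (1::real) :: real^3"]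
          by (simp add: inner_axis Basis_real_def)
      qed
    qed auto
    ultimately show ?thesis
    proof eventually_elim
      case (elim x)
      show ?case
      proof
        assume x: "x \<in> torus P"
        have "\<bar>x $ i\<bar> < P / 2" for i
        proof -
          have "x $ i \<noteq> P / 2" "x $ i \<noteq> - (P / 2)" using elim(2) by auto
          moreover have "\<bar>x $ i\<bar> \<le> P / 2" using x by (simp add: torus_iff)
          ultimately show ?thesis by linarith
        qed
        then have "(\<lambda>n. q n x) \<longlonglongrightarrow> 1 * max (- B) (min B (g x))"
          unfolding q_def by (intro tendsto_intros tendsto_max tendsto_min \<rho>lim hl elim(1)) auto
        moreover have "max (- B) (min B (g x)) = g x" using B[of x] by linarith
        ultimately show "(\<lambda>n. q n x) \<longlonglongrightarrow> g x" by simp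
      qed
    qed
  qed
  have qm: "q n \<in> borel_measurable borel" for n by (rule borel_measurable_continuous_onI[OF qc])
  have vm: "(\<lambda>x. indicator (torus P) x * v x) \<in> borel_measurable lborel"
    using v by (simp add: set_integrable_def)
  have l1: "(\<lambda>n. LINT x:torus P|lborel. v x * q n x) \<longlonglongrightarrow> (LINT x:torus P|lborel. v x * g x)"
  proof (rule torus_dominated_convergence[where w="\<lambda>x. \<bar>v x\<bar> * B"])
    show "set_integrable lborel (torus P) (\<lambda>x. \<bar>v x\<bar> * B)"
      by (intro set_integrable_mult_left set_integrable_abs v)
    show "set_borel_measurable lborel (torus P) (\<lambda>x. v x * q n x)" for n
      unfolding set_borel_measurable_def
      using borel_measurable_times[OF vm, of "q n"] qm by (simp add: mult.assoc)
    show "set_borel_measurable lborel (torus P) (\<lambda>x. v x * g x)"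
      unfolding set_borel_measurable_def
      using borel_measurable_times[OF vm, of g] g by (simp add: mult.assoc)
    show "AE x in lborel. x \<in> torus P \<longrightarrow> (\<lambda>n. v x * q n x) \<longlonglongrightarrow> v x * g x"
      using ae by eventually_elim (auto intro: tendsto_intros)
    show "\<bar>v x * q n x\<bar> \<le> \<bar>v x\<bar> * B" for n x
      unfolding abs_mult by (intro mult_left_mono qb) auto
  qed
  have l2: "(\<lambda>n. LINT x:torus P|lborel. (q n x)\<^sup>2) \<longlonglongrightarrow> (LINT x:torus P|lborel. (g x)\<^sup>2)"
  proof (rule torus_dominated_convergence[where w="\<lambda>x. B\<^sup>2"])
    show "set_integrable lborel (torus P) (\<lambda>x. B\<^sup>2)"
      by (rule torus_integrable_bounded[of _ "B\<^sup>2"]) auto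
    show "AE x in lborel. x \<in> torus P \<longrightarrow> (\<lambda>n. (q n x)\<^sup>2) \<longlonglongrightarrow> (g x)\<^sup>2"
      using ae by eventually_elim (auto intro: tendsto_intros)
    show "\<bar>(q n x)\<^sup>2\<bar> \<le> B\<^sup>2" for n x
      using power_mono[OF qb[of n x], of 2] by simp
  qed (use qm g in \<open>auto simp: set_borel_measurable_def\<close>)
  show ?thesis
    by (rule LIMSEQ_le[OF tendsto_power[OF l1] tendsto_mult[OF tendsto_const l2]])
       (use Z[OF qc q0] in auto)
qed

text \<open>Square integrability of \<open>v\<close> is a conclusion here, so \<open>v\<close>
  cannot be paired with itself. Its truncations \<open>g n\<close> can be used instead: the pairing
  of \<open>v\<close> with \<open>g n\<close> is the integral \<open>I\<close> of
  \<open>(g n x)\<^sup>2\<close>, and the duality inequality \<open>I\<^sup>2 \<le> Z' * I\<close>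
  bounds it by \<open>Z'\<close>. Monotone convergence removes the truncation.\<close>

lemma parseval_finite_sums:
  fixes v :: "real^3 \<Rightarrow> real"
  assumes "P > 0" and vm: "v \<in> borel_measurable borel" and v: "set_integrable lborel (torus P) v"
    and Z: "\<And>F. finite F \<Longrightarrow> F \<subseteq> wave_vectors P \<Longrightarrow>
      (\<Sum>k\<in>F. (norm (CLINT x:torus P|lborel. complex_of_real (v x) * cis (- (k \<bullet> x))))\<^sup>2) \<le> Z"
  shows "(\<integral>\<^sup>+x\<in>torus P. ennreal ((v x)\<^sup>2) \<partial>lborel) \<le> ennreal (Z / measure lborel (torus P))"
proof -
  define Z' where "Z' = Z / measure lborel (torus P)"
  have Z0: "Z' \<ge> 0" using Z[of "{}"] by (simp add: Z'_def)
  have dual: "(LINT x:torus P|lborel. v x * g x)\<^sup>2 \<le> Z' * (LINT x:torus P|lborel. (g x)\<^sup>2)"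
    if "g \<in> borel_measurable borel" "\<And>x. \<bar>g x\<bar> \<le> B" for g B
    by (rule measurable_duality[OF assms(1) v continuous_duality[OF assms(1) v] that])
       (use trig_poly_duality[OF assms(1) v _ Z] in \<open>auto simp: Z'_def\<close>)
  define g where "g n x = (if \<bar>v x\<bar> \<le> real n then v x else 0)" for n x
  have gm[measurable]: "g n \<in> borel_measurable borel" for n unfolding g_def using vm by measurable
  have gb: "\<bar>g n x\<bar> \<le> real n" for n x by (simp add: g_def)
  have vg: "v x * g n x = (g n x)\<^sup>2" for n x by (simp add: g_def power2_eq_square)
  have bound: "(\<integral>\<^sup>+x\<in>torus P. ennreal ((g n x)\<^sup>2) \<partial>lborel) \<le> ennreal Z'" for n
  proof -
    have gi: "set_integrable lborel (torus P) (\<lambda>x. (g n x)\<^sup>2)"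
      by (rule torus_integrable_bounded[where B="(real n)\<^sup>2"]) (use power_mono[OF gb abs_ge_zero, of n _ 2] in auto)
    define I where "I = (LINT x:torus P|lborel. (g n x)\<^sup>2)"
    have "I\<^sup>2 \<le> Z' * I" using dual[OF gm gb, of n] by (simp add: vg I_def)
    moreover have "I \<ge> 0" unfolding I_def set_lebesgue_integral_def by (intro integral_nonneg_AE) auto
    ultimately have "I \<le> Z'" using Z0 by (cases "I = 0") (auto simp: power2_eq_square)
    moreover have "(\<integral>\<^sup>+x\<in>torus P. ennreal ((g n x)\<^sup>2) \<partial>lborel) = ennreal I"
    proof -
      have "(\<integral>\<^sup>+x\<in>torus P. ennreal ((g n x)\<^sup>2) \<partial>lborel) = (\<integral>\<^sup>+x. ennreal (indicator (torus P) x * \<bar>(g n x)\<^sup>2\<bar>) \<partial>lborel)"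
        by (intro nn_integral_cong) (auto simp: indicator_def)
      then show ?thesis using nn_integral_eq_set_integral_abs[OF gi] by (simp add: I_def)
    qed
    ultimately show ?thesis by (simp add: ennreal_leI)
  qed
  have "(\<integral>\<^sup>+x\<in>torus P. ennreal ((v x)\<^sup>2) \<partial>lborel)
      = (\<integral>\<^sup>+x. (SUP n. ennreal ((g n x)\<^sup>2) * indicator (torus P) x) \<partial>lborel)"
  proof (rule nn_integral_cong)
    fix x
    obtain m where m: "\<bar>v x\<bar> \<le> real m" using real_arch_simple by blast
    show "ennreal ((v x)\<^sup>2) * indicator (torus P) x = (SUP n. ennreal ((g n x)\<^sup>2) * indicator (torus P) x)"
    proof (rule antisym)
      show "ennreal ((v x)\<^sup>2) * indicator (torus P) x \<le> (SUP n. ennreal ((g n x)\<^sup>2) * indicator (torus P) x)"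
        by (rule SUP_upper2[of m]) (use m in \<open>auto simp: g_def\<close>)
      show "(SUP n. ennreal ((g n x)\<^sup>2) * indicator (torus P) x) \<le> ennreal ((v x)\<^sup>2) * indicator (torus P) x"
        by (rule SUP_least) (auto simp: g_def intro!: mult_right_mono)
    qed
  qed
  also have "\<dots> = (SUP n. \<integral>\<^sup>+x\<in>torus P. ennreal ((g n x)\<^sup>2) \<partial>lborel)"
  proof (rule nn_integral_monotone_convergence_SUP)
    show "incseq (\<lambda>n x. ennreal ((g n x)\<^sup>2) * indicator (torus P) x)"
      by (auto simp: incseq_def le_fun_def g_def indicator_def)
  qed measurable
  also have "\<dots> \<le> ennreal Z'" by (rule SUP_least) (rule bound)
  finally show ?thesis by (simp add: Z'_def)
qed

section \<open>Vector fields and their normalized Fourier coefficients\<close>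

lemma fourier_coeff_nth:
  "fourier_coeff P v k $ j = complex_of_real (1 / measure lborel (torus P)) *
     (CLINT x:torus P|lborel. complex_of_real (v x $ j) * cis (- (k \<bullet> x)))"
  by (simp add: fourier_coeff_def cis_conv_exp)

lemma norm_complex_vec_sq: "(norm (z :: complex^3))\<^sup>2 = (\<Sum>j\<in>UNIV. (norm (z $ j))\<^sup>2)"
  by (simp add: norm_vec_def L2_set_def sum_nonneg)

lemma norm_real_vec_sq: "(norm (z :: real^3))\<^sup>2 = (\<Sum>j\<in>UNIV. (z $ j)\<^sup>2)"
  by (simp add: norm_vec_def L2_set_def sum_nonneg)

lemma sum_le_nn_integral_count_space:
  assumes "finite F" "F \<subseteq> A"
  shows "(\<Sum>k\<in>F. f k) \<le> (\<integral>\<^sup>+k. f k \<partial>count_space A)"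
proof -
  have "(\<Sum>k\<in>F. f k) = (\<integral>\<^sup>+k. f k \<partial>count_space F)"
    using assms(1) by (simp add: nn_integral_count_space_finite)
  also have "\<dots> = (\<integral>\<^sup>+k. f k * indicator F k \<partial>count_space A)"
    using assms(2) nn_integral_restrict_space[of F "count_space A" f]
    by (simp add: restrict_count_space Int_absorb2)
  also have "\<dots> \<le> (\<integral>\<^sup>+k. f k \<partial>count_space A)"
    by (intro nn_integral_mono) (auto simp: indicator_def)
  finally show ?thesis .
qed

text \<open>Applied to the time increments of \<open>u\<close> at fixed times. Both sides are
  extended nonnegative integrals, so an infinite sum of coefficients makes the bound trivial, and
  otherwise each component falls under \<open>parseval_finite_sums\<close>.\<close>

lemma parseval_le:
  fixes v :: "real^3 \<Rightarrow> real^3"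
  assumes "P > 0" and vm: "v \<in> borel_measurable borel"
    and v: "\<And>j. set_integrable lborel (torus P) (\<lambda>x. v x $ j)"
  shows "(\<integral>\<^sup>+x\<in>torus P. ennreal ((norm (v x))\<^sup>2) \<partial>lborel)
    \<le> ennreal (measure lborel (torus P)) *
       (\<integral>\<^sup>+k. ennreal ((norm (fourier_coeff P v k))\<^sup>2) \<partial>count_space (wave_vectors P))"
proof -
  let ?m = "measure lborel (torus P)"
  note mpos = measure_torus_pos[OF assms(1)]
  define S where "S j = (\<integral>\<^sup>+k. ennreal ((norm (fourier_coeff P v k $ j))\<^sup>2) \<partial>count_space (wave_vectors P))" for j
  have vjm[measurable]: "(\<lambda>x. v x $ j) \<in> borel_measurable borel" for j
    by (rule measurable_compose[OF vm]) (intro borel_measurable_continuous_onI continuous_intros)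
  have comp: "(\<integral>\<^sup>+x\<in>torus P. ennreal ((v x $ j)\<^sup>2) \<partial>lborel) \<le> ennreal ?m * S j" for j
  proof (cases "S j = top")
    case True
    then show ?thesis using mpos by (simp add: ennreal_mult_top)
  next
    case False
    define s where "s = enn2real (S j)"
    have s: "S j = ennreal s" "s \<ge> 0" using False by (auto simp: s_def less_top)
    \<comment> \<open>The coefficients are normalized by the measure of the cell, so the
      unnormalized sums are bounded by \<open>?m\<^sup>2 * s\<close>; the duality bound divides by
      \<open>?m\<close> once, which leaves one factor.\<close>
    have "(\<integral>\<^sup>+x\<in>torus P. ennreal ((v x $ j)\<^sup>2) \<partial>lborel) \<le> ennreal (?m\<^sup>2 * s / ?m)"
    proof (rule parseval_finite_sums[OF assms(1) vjm v])
      fix F assume F: "finite F" "F \<subseteq> wave_vectors P"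
      have "ennreal (\<Sum>k\<in>F. (norm (fourier_coeff P v k $ j))\<^sup>2) \<le> ennreal s"
        using sum_le_nn_integral_count_space[OF F, of "\<lambda>k. ennreal ((norm (fourier_coeff P v k $ j))\<^sup>2)"]
        by (simp add: s(1)[symmetric] S_def)
      then have "(\<Sum>k\<in>F. (norm (fourier_coeff P v k $ j))\<^sup>2) \<le> s" using s(2) by simp
      then have "?m\<^sup>2 * (\<Sum>k\<in>F. (norm (fourier_coeff P v k $ j))\<^sup>2) \<le> ?m\<^sup>2 * s"
        by (intro mult_left_mono) auto
      then show "(\<Sum>k\<in>F. (norm (CLINT x:torus P|lborel. complex_of_real (v x $ j) * cis (- (k \<bullet> x))))\<^sup>2) \<le> ?m\<^sup>2 * s"
        using mpos by (simp add: fourier_coeff_nth norm_mult power_mult_distrib sum_distrib_left norm_divide power_divide)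
    qed
    also have "?m\<^sup>2 * s / ?m = ?m * s" using mpos by (simp add: power2_eq_square)
    finally show ?thesis using s by (simp add: ennreal_mult')
  qed
  have "(\<integral>\<^sup>+x\<in>torus P. ennreal ((norm (v x))\<^sup>2) \<partial>lborel)
      = (\<integral>\<^sup>+x. (\<Sum>j\<in>UNIV. ennreal ((v x $ j)\<^sup>2) * indicator (torus P) x) \<partial>lborel)"
    by (simp add: norm_real_vec_sq sum_distrib_right[symmetric])
  also have "\<dots> = (\<Sum>j\<in>UNIV. (\<integral>\<^sup>+x\<in>torus P. ennreal ((v x $ j)\<^sup>2) \<partial>lborel))"
    by (rule nn_integral_sum) measurable
  also have "\<dots> \<le> (\<Sum>j\<in>UNIV. ennreal ?m * S j)" by (intro sum_mono comp)
  also have "\<dots> = ennreal ?m * (\<integral>\<^sup>+k. (\<Sum>j\<in>UNIV. ennreal ((norm (fourier_coeff P v k $ j))\<^sup>2)) \<partial>count_space (wave_vectors P))"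
    by (subst nn_integral_sum) (auto simp: S_def sum_distrib_left)
  finally show ?thesis by (simp add: norm_complex_vec_sq)
qed

section \<open>Weak formulations against separated periodic test functions\<close>

text \<open>Extension by zero outside the open time interval. Integrals over a space-time strip
  become integrals over all of space-time, and the same field can be compared on time intervals of
  different length.\<close>

definition window :: "real \<Rightarrow> (real \<Rightarrow> real^3 \<Rightarrow> 'b::real_vector) \<Rightarrow> real \<times> (real^3) \<Rightarrow> 'b" where
  "window T g z = (if 0 < fst z \<and> fst z < T then g (fst z) (snd z) else 0)"

text \<open>The weights for which test functions on the whole space-time can be unfolded:
  integrability is asked for over one spatial period and all times.\<close>

definition density :: "real \<Rightarrow> (real \<times> (real^3) \<Rightarrow> real) \<Rightarrow> bool" where
  "density P G \<longleftrightarrow> G \<in> borel_measurable borel \<and> (\<forall>t. periodic P (\<lambda>x. G (t, x))) \<and>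
     set_integrable lborel (UNIV \<times> torus P) G"

lemma window_eq_indicator:
  "window T g z = indicator ({0<..<T} \<times> UNIV) z *\<^sub>R (case z of (t, x) \<Rightarrow> g t x)"
  by (cases z) (auto simp: window_def indicator_def)

section \<open>Integrability over one spatial period of space-time\<close>

lemma Lq_Lp_window_measurable: "Lq_Lp P T q r g \<Longrightarrow> window T g \<in> borel_measurable borel"
  unfolding Lq_Lp_def set_borel_measurable_def window_eq_indicator[abs_def] by simp

lemma Lq_Lp_window_periodic: "Lq_Lp P T q r g \<Longrightarrow> periodic P (\<lambda>x. window T g (t, x))"
  unfolding Lq_Lp_def by (auto simp: window_def periodic_def)

lemma slab_borel [measurable]: "UNIV \<times> torus P \<in> sets (borel :: (real \<times> (real^3)) measure)"
  by (simp add: borel_prod[symmetric])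

text \<open>For \<open>r \<le> q\<close> the inequality \<open>X \<le> 1 + X powr (q / r)\<close>
  trades the higher power in time for integrability on the bounded interval; Tonelli's criterion
  then gives joint integrability.\<close>

lemma Lq_Lp_powr_integrable:
  fixes g :: "real \<Rightarrow> real^3 \<Rightarrow> 'b::euclidean_space"
  assumes g: "Lq_Lp P T q r g" and r: "0 < r" "r \<le> q"
  shows "set_integrable lborel (UNIV \<times> torus P) (\<lambda>z. norm (window T g z) powr r)"
proof -
  define f where "f z = indicator (UNIV \<times> torus P) z *\<^sub>R (norm (window T g z) powr r)" for z
  define X where "X t = (LINT x:torus P|lborel. norm (g t x) powr r)" for t
  have gm[measurable]: "window T g \<in> borel_measurable borel" by (rule Lq_Lp_window_measurable[OF g])
  have fm: "f \<in> borel_measurable borel" unfolding f_def by measurable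
  have fm2[measurable]: "f \<in> borel_measurable (lborel \<Otimes>\<^sub>M lborel)" using fm by (simp add: lborel_prod)
  have f0: "f z \<ge> 0" for z by (simp add: f_def)
  have ft: "f (t, x) = indicator {0<..<T} t * (indicator (torus P) x *\<^sub>R norm (g t x) powr r)" for t x
    using r by (auto simp: f_def window_def indicator_def)
  have Xi: "(LINT x|lborel. norm (f (t, x))) = indicator {0<..<T} t * X t" for t
    using f0 by (simp add: ft X_def set_lebesgue_integral_def abs_mult)
  have X0: "X t \<ge> 0" for t unfolding X_def set_lebesgue_integral_def by (intro integral_nonneg_AE) auto
  have "integrable (lborel \<Otimes>\<^sub>M lborel) f"
  proof (rule lborel_pair.Fubini_integrable)
    show "integrable lborel (\<lambda>t. LINT x|lborel. norm (f (t, x)))"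
    proof (rule Bochner_Integration.integrable_bound)
      have "set_integrable lborel {0<..<T} (\<lambda>t. 1 + X t powr (q / r))"
        using g unfolding Lq_Lp_def X_def
        by (intro set_integral_add(1) set_integrable_continuous_Ioo[OF continuous_on_const]) auto
      then show "integrable lborel (\<lambda>t. indicator {0<..<T} t * (1 + X t powr (q / r)))"
        by (simp add: set_integrable_def)
      show "AE t in lborel. norm (LINT x|lborel. norm (f (t, x))) \<le> norm (indicator {0<..<T} t * (1 + X t powr (q / r)))"
      proof (rule AE_I2)
        fix t
        have "X t \<le> 1 + X t powr (q / r)"
        proof (cases "X t \<le> 1")
          case False
          have "X t powr 1 \<le> X t powr (q / r)"
            using False r by (intro powr_mono) auto
          then show ?thesis using False by simp
        qed (simp add: add_increasing2)
        then show "norm (LINT x|lborel. norm (f (t, x))) \<le> norm (indicator {0<..<T} t * (1 + X t powr (q / r)))"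
          unfolding Xi using X0[of t] by (auto simp: indicator_def)
      qed
      show "(\<lambda>t. LINT x|lborel. norm (f (t, x))) \<in> borel_measurable lborel"
        by measurable
    qed
    have "AE t in lborel. t \<in> {0<..<T} \<longrightarrow> set_integrable lborel (torus P) (\<lambda>x. norm (g t x) powr r)"
      using g by (simp add: Lq_Lp_def)
    then show "AE t in lborel. integrable lborel (\<lambda>x. f (t, x))"
      by eventually_elim (simp add: ft set_integrable_def indicator_def)
  qed measurable
  then show ?thesis by (simp add: set_integrable_def f_def[abs_def] lborel_prod)
qed

lemma slab_integrable:
  fixes T :: real
  shows "set_integrable lborel (UNIV \<times> torus P) (indicat_real ({0<..<T} \<times> UNIV))"
proof -
  have b: "{0<..<T} \<times> torus P \<in> sets (borel :: (real \<times> (real^3)) measure)"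
    unfolding borel_prod[symmetric] by (intro pair_measureI) auto
  have "emeasure lborel ({0<..<T} \<times> torus P) \<le> emeasure lborel (cbox (0, (\<chi> i. - P / 2) :: real^3) (T, \<chi> i. P / 2))"
  proof (rule emeasure_mono)
    show "{0<..<T} \<times> torus P \<subseteq> cbox (0, \<chi> i. - P / 2) (T, \<chi> i. P / 2)"
      unfolding torus_def cbox_Pair_eq by (intro Sigma_mono) auto
  qed simp
  also have "\<dots> < \<infinity>" by (rule emeasure_lborel_cbox_finite)
  finally have "integrable lborel (indicat_real ({0<..<T} \<times> torus P))"
    using b by (intro integrable_real_indicator) auto
  also have "indicat_real ({0<..<T} \<times> torus P)
      = (\<lambda>z. indicator (UNIV \<times> torus P) z *\<^sub>R indicator ({0<..<T} \<times> UNIV) z)"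
    by (auto simp: indicator_def fun_eq_iff)
  finally show ?thesis by (simp add: set_integrable_def)
qed

lemma densityI_bound:
  assumes "G \<in> borel_measurable borel" "\<And>t. periodic P (\<lambda>x. G (t, x))"
    and "set_integrable lborel (UNIV \<times> torus P) (H :: _ \<Rightarrow> real)" "\<And>z. \<bar>G z\<bar> \<le> H z"
  shows "density P G"
  unfolding density_def
proof (intro conjI allI assms)
  show "set_integrable lborel (UNIV \<times> torus P) G"
  proof (rule set_integrable_bound[OF assms(3)])
    show "set_borel_measurable lborel (UNIV \<times> torus P) G"
      unfolding set_borel_measurable_def using assms(1) by measurable
    show "AE z in lborel. z \<in> UNIV \<times> torus P \<longrightarrow> norm (G z) \<le> norm (H z)"
      using assms(4) order_trans[OF assms(4) abs_ge_self] by (intro AE_I2 impI) (simp only: real_norm_def)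
  qed
qed

text \<open>Inside the window \<open>norm g\<close> is at most \<open>1 + norm g powr r\<close>, and
  the window meets one period in a set of finite measure.\<close>

lemma Lq_Lp_norm_integrable:
  fixes g :: "real \<Rightarrow> real^3 \<Rightarrow> 'b::euclidean_space"
  assumes g: "Lq_Lp P T q r g" and r: "1 \<le> r" "r \<le> q"
  shows "density P (\<lambda>z. norm (window T g z))"
proof (rule densityI_bound)
  have [measurable]: "window T g \<in> borel_measurable borel" by (rule Lq_Lp_window_measurable[OF g])
  show "(\<lambda>z. norm (window T g z)) \<in> borel_measurable borel" by measurable
  show "periodic P (\<lambda>x. norm (window T g (t, x)))" for t
    using Lq_Lp_window_periodic[OF g, of t] by (simp add: periodic_def)
  show "set_integrable lborel (UNIV \<times> torus P)
      (\<lambda>z. indicator ({0<..<T} \<times> UNIV) z + norm (window T g z) powr r)"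
    using Lq_Lp_powr_integrable[OF g] r by (intro set_integral_add slab_integrable) auto
  show "\<bar>norm (window T g z)\<bar> \<le> indicator ({0<..<T} \<times> UNIV) z + norm (window T g z) powr r" for z
  proof (cases "z \<in> {0<..<T} \<times> UNIV")
    case True
    show ?thesis
    proof (cases "norm (window T g z) \<le> 1")
      case False
      have "norm (window T g z) powr 1 \<le> norm (window T g z) powr r" using False r by (intro powr_mono) auto
      then show ?thesis using False True by simp
    qed (use True in \<open>simp add: add_increasing2\<close>)
  next
    case False
    then have "window T g z = 0" by (auto simp: window_def mem_Times_iff)
    then show ?thesis by simp
  qed
qed

lemma L2_sq_density:
  fixes g :: "real \<Rightarrow> real^3 \<Rightarrow> 'b::euclidean_space"
  assumes "Lq_Lp P T 2 2 g"
  shows "density P (\<lambda>z. (norm (window T g z))\<^sup>2)"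
proof -
  have [measurable]: "window T g \<in> borel_measurable borel" by (rule Lq_Lp_window_measurable[OF assms])
  have "set_integrable lborel (UNIV \<times> torus P) (\<lambda>z. norm (window T g z) powr 2)"
    by (rule Lq_Lp_powr_integrable[OF assms]) auto
  then have "set_integrable lborel (UNIV \<times> torus P) (\<lambda>z. (norm (window T g z))\<^sup>2)" by simp
  then show ?thesis
    using Lq_Lp_window_periodic[OF assms] unfolding density_def by (auto simp: periodic_def)
qed

lemma density_unfold:
  fixes \<psi> :: "real \<Rightarrow> real"
  assumes "P > 0" "density P G" "periodization P \<zeta> \<tau>"
    and "continuous_on UNIV \<psi>" "\<And>t. \<bar>\<psi> t\<bar> \<le> B"
  shows "integrable lborel (\<lambda>z. G z * (\<psi> (fst z) * \<zeta> (snd z)))"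
    and "integrable lborel (\<lambda>t. \<psi> t * (LINT x:torus P|lborel. G (t, x) * \<tau> x))"
    and "(LINT z|lborel. G z * (\<psi> (fst z) * \<zeta> (snd z)))
       = (LINT t|lborel. \<psi> t * (LINT x:torus P|lborel. G (t, x) * \<tau> x))"
    and "set_integrable lborel (UNIV \<times> torus P) (\<lambda>z. G z * (\<psi> (fst z) * \<tau> (snd z)))"
    and "(LINT z|lborel. G z * (\<psi> (fst z) * \<zeta> (snd z)))
       = (LINT z:UNIV \<times> torus P|lborel. G z * (\<psi> (fst z) * \<tau> (snd z)))"
proof -
  have G: "G \<in> borel_measurable borel" "\<And>t. periodic P (\<lambda>x. G (t, x))" "set_integrable lborel (UNIV \<times> torus P) G"
    using assms(2) by (auto simp: density_def)
  note * = unfold_spacetime[OF assms(1) G assms(3-5)]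
  show "integrable lborel (\<lambda>z. G z * (\<psi> (fst z) * \<zeta> (snd z)))" by (rule *(1))
  show "integrable lborel (\<lambda>t. \<psi> t * (LINT x:torus P|lborel. G (t, x) * \<tau> x))" by (rule *(2))
  show "(LINT z|lborel. G z * (\<psi> (fst z) * \<zeta> (snd z)))
       = (LINT t|lborel. \<psi> t * (LINT x:torus P|lborel. G (t, x) * \<tau> x))" by (rule *(3))
  show "set_integrable lborel (UNIV \<times> torus P) (\<lambda>z. G z * (\<psi> (fst z) * \<tau> (snd z)))" by (rule *(4))
  show "(LINT z|lborel. G z * (\<psi> (fst z) * \<zeta> (snd z)))
       = (LINT z:UNIV \<times> torus P|lborel. G z * (\<psi> (fst z) * \<tau> (snd z)))" by (rule *(5))
qed

text \<open>Fubini. This converts the space-time norms of convection and force into the L^1 norm in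
  time of the right-hand side of the scalar equation of a mode, with \<open>M\<close> the size of
  the periodic test factor.\<close>

lemma density_slice_bound:
  assumes "density P G" and \<tau>: "\<tau> \<in> borel_measurable borel" "\<And>x. \<bar>\<tau> x\<bar> \<le> M"
  shows "integrable lborel (\<lambda>t. LINT x:torus P|lborel. G (t, x) * \<tau> x)"
    and "(LINT t|lborel. \<bar>LINT x:torus P|lborel. G (t, x) * \<tau> x\<bar>) \<le> M * (LINT z:UNIV \<times> torus P|lborel. \<bar>G z\<bar>)"
proof -
  have i0: "integrable lborel (\<lambda>z. indicator (UNIV \<times> torus P) z *\<^sub>R G z)"
    using assms(1) by (simp add: density_def set_integrable_def)
  have "integrable lborel (\<lambda>z. (indicator (UNIV \<times> torus P) z *\<^sub>R G z) * \<tau> (snd z))"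
    by (rule integrable_bounded_mult[OF i0 _ \<tau>(2)]) (use \<tau>(1) in \<open>simp add: lborel_prod[symmetric]\<close>)
  then have i: "integrable (lborel \<Otimes>\<^sub>M lborel) (\<lambda>z. (indicator (UNIV \<times> torus P) z *\<^sub>R G z) * \<tau> (snd z))"
    by (simp add: lborel_prod)
  have sl: "(LINT x|lborel. (indicator (UNIV \<times> torus P) (t, x) *\<^sub>R G (t, x)) * \<tau> (snd (t, x)))
      = (LINT x:torus P|lborel. G (t, x) * \<tau> x)" for t
    by (auto simp: set_lebesgue_integral_def indicator_def intro!: Bochner_Integration.integral_cong)
  show I: "integrable lborel (\<lambda>t. LINT x:torus P|lborel. G (t, x) * \<tau> x)"
    using lborel_pair.integrable_fst'[OF i] unfolding sl .
  have j: "integrable (lborel \<Otimes>\<^sub>M lborel) (\<lambda>z. M * \<bar>indicator (UNIV \<times> torus P) z *\<^sub>R G z\<bar>)"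
    using i0 by (simp add: lborel_prod integrable_abs)
  have "(LINT t|lborel. \<bar>LINT x:torus P|lborel. G (t, x) * \<tau> x\<bar>)
      \<le> (LINT t|lborel. LINT x|lborel. M * \<bar>indicator (UNIV \<times> torus P) (t, x) *\<^sub>R G (t, x)\<bar>)"
  proof (rule integral_mono_AE)
    show "integrable lborel (\<lambda>t. \<bar>LINT x:torus P|lborel. G (t, x) * \<tau> x\<bar>)" using I by (rule integrable_abs)
    show "integrable lborel (\<lambda>t. LINT x|lborel. M * \<bar>indicator (UNIV \<times> torus P) (t, x) *\<^sub>R G (t, x)\<bar>)"
      by (rule lborel_pair.integrable_fst'[OF j])
    show "AE t in lborel. \<bar>LINT x:torus P|lborel. G (t, x) * \<tau> x\<bar>
        \<le> (LINT x|lborel. M * \<bar>indicator (UNIV \<times> torus P) (t, x) *\<^sub>R G (t, x)\<bar>)"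
      using lborel_pair.AE_integrable_fst'[OF i] lborel_pair.AE_integrable_fst'[OF j]
    proof eventually_elim
      case (elim t)
      show ?case
        unfolding sl[symmetric]
      proof (rule order_trans[OF integral_abs_bound], rule integral_mono)
        show "integrable lborel (\<lambda>x. \<bar>indicat_real (UNIV \<times> torus P) (t, x) *\<^sub>R G (t, x) * \<tau> (snd (t, x))\<bar>)"
          using elim(1) by (rule integrable_abs)
        show "\<bar>indicat_real (UNIV \<times> torus P) (t, x) *\<^sub>R G (t, x) * \<tau> (snd (t, x))\<bar>
            \<le> M * \<bar>indicat_real (UNIV \<times> torus P) (t, x) *\<^sub>R G (t, x)\<bar>" for x
          using mult_right_mono[OF \<tau>(2)[of x], of "\<bar>indicat_real (UNIV \<times> torus P) (t, x) *\<^sub>R G (t, x)\<bar>"]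
          by (simp add: abs_mult mult_ac)
      qed (rule elim(2))
    qed
  qed
  also have "\<dots> = (LINT z|lborel. M * \<bar>indicator (UNIV \<times> torus P) z *\<^sub>R G z\<bar>)"
    using lborel_pair.integral_fst'[OF j] by (simp add: lborel_prod)
  also have "\<dots> = M * (LINT z:UNIV \<times> torus P|lborel. \<bar>G z\<bar>)"
    by (simp add: set_lebesgue_integral_def abs_mult)
  finally show "(LINT t|lborel. \<bar>LINT x:torus P|lborel. G (t, x) * \<tau> x\<bar>) \<le> M * (LINT z:UNIV \<times> torus P|lborel. \<bar>G z\<bar>)" .
qed

subsection \<open>Separated test functions\<close>

lemma smooth_separated:
  fixes \<psi> :: "real \<Rightarrow> real" and \<zeta> :: "real^3 \<Rightarrow> real"
  assumes "smooth \<psi>" "smooth \<zeta>"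
  shows "smooth (\<lambda>z. \<psi> (fst z) * \<zeta> (snd z))"
  using smooth_mult[OF smooth_compose_linear0[OF bounded_linear_fst assms(1)]
      smooth_compose_linear0[OF bounded_linear_snd assms(2)]] .

lemma pd_separated:
  fixes \<psi> :: "real \<Rightarrow> real" and \<zeta> :: "real^3 \<Rightarrow> real"
  assumes "smooth \<psi>" "smooth \<zeta>"
  shows "pd (s, v) (\<lambda>z. \<psi> (fst z) * \<zeta> (snd z)) = (\<lambda>z. s * pd 1 \<psi> (fst z) * \<zeta> (snd z) + \<psi> (fst z) * pd v \<zeta> (snd z))"
proof
  fix z
  have 1: "pd (s, v) (\<lambda>z. \<psi> (fst z)) z = s * pd 1 \<psi> (fst z)"
    using pd_compose_linear[OF bounded_linear_fst, of \<psi> z 0 "(s, v)"] smooth_differentiable[OF assms(1)]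
      pd_real[OF smooth_has_real_derivative[OF assms(1)], of s "fst z"] by simp
  have 2: "pd (s, v) (\<lambda>z. \<zeta> (snd z)) z = pd v \<zeta> (snd z)"
    using pd_compose_linear[OF bounded_linear_snd, of \<zeta> z 0 "(s, v)"] smooth_differentiable[OF assms(2)] by simp
  have d: "(\<lambda>z::real \<times> (real^3). \<psi> (fst z)) differentiable (at z)" "(\<lambda>z::real \<times> (real^3). \<zeta> (snd z)) differentiable (at z)"
    using smooth_differentiable[OF smooth_compose_linear0[OF bounded_linear_fst assms(1)]]
      smooth_differentiable[OF smooth_compose_linear0[OF bounded_linear_snd assms(2)]] by blast+
  show "pd (s, v) (\<lambda>z. \<psi> (fst z) * \<zeta> (snd z)) z = s * pd 1 \<psi> (fst z) * \<zeta> (snd z) + \<psi> (fst z) * pd v \<zeta> (snd z)"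
    unfolding pd_mult[OF d] 1 2 by simp
qed

lemma test_fun_separated:
  fixes \<psi> :: "real \<Rightarrow> real" and \<zeta> \<tau> :: "real^3 \<Rightarrow> real"
  assumes "test_fun {..<T} \<psi>" "periodization P \<zeta> \<tau>"
  shows "test_fun (spacetime T) (\<lambda>z. \<psi> (fst z) * \<zeta> (snd z))"
proof -
  obtain K where K: "compact K" "K \<subseteq> {..<T}" "\<And>t. t \<notin> K \<Longrightarrow> \<psi> t = 0"
    using assms(1) unfolding test_fun_def by blast
  have "\<psi> (fst z) * \<zeta> (snd z) = 0" if "z \<notin> K \<times> {x. \<forall>i. \<bar>x $ i\<bar> \<le> P}" for z
    using that K(3)[of "fst z"] assms(2) by (auto simp: periodization_def mem_Times_iff)
  moreover have "compact (K \<times> {x::real^3. \<forall>i. \<bar>x $ i\<bar> \<le> P})"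
    by (intro compact_Times K compact_two_period_box)
  ultimately show ?thesis
    using smooth_separated[of \<psi> \<zeta>] assms K(2) unfolding test_fun_def periodization_def by blast
qed

lemma test_fun_scaleR:
  fixes g :: "'a::real_normed_vector \<Rightarrow> real"
  assumes "test_fun \<Omega> g"
  shows "test_fun \<Omega> (\<lambda>z. g z *\<^sub>R a)"
  using assms smooth_bounded_linear[OF bounded_linear_scaleR_left, of g a]
  unfolding test_fun_def by (metis scale_eq_0_iff)

lemma pd_scaleR:
  fixes g :: "'a::real_normed_vector \<Rightarrow> real"
  assumes "smooth g"
  shows "pd v (\<lambda>z. g z *\<^sub>R a) = (\<lambda>z. pd v g z *\<^sub>R a)"
  using pd_bounded_linear[OF bounded_linear_scaleR_left smooth_differentiable[OF assms]] by auto

lemma test_fun_real_bounds: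
  fixes \<psi> :: "real \<Rightarrow> real"
  assumes "test_fun {..<T} \<psi>"
  obtains B where "\<And>t. \<bar>\<psi> t\<bar> \<le> B" "\<And>t. \<bar>pd 1 \<psi> t\<bar> \<le> B"
proof -
  obtain K where sm: "smooth \<psi>" and K: "compact K" "\<And>t. t \<notin> K \<Longrightarrow> \<psi> t = 0"
    using assms unfolding test_fun_def by blast
  obtain B1 where B1: "\<And>t. \<bar>\<psi> t\<bar> \<le> B1"
    using bounded_of_compact_support[OF smooth_continuous[OF sm] K] by blast
  have "pd 1 \<psi> t = 0" if "t \<notin> K" for t
    by (rule pd_eq_0_outside_closed[OF compact_imp_closed[OF K(1)] K(2) that])
  then obtain B2 where B2: "\<And>t. \<bar>pd 1 \<psi> t\<bar> \<le> B2"
    using bounded_of_compact_support[OF smooth_continuous[OF smooth_pd[OF sm]] K(1)] by blast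
  show ?thesis by (rule that[of "max B1 B2"]) (use B1 B2 in \<open>auto simp: le_max_iff_disj\<close>)
qed


subsection \<open>The momentum equation\<close>

lemma weak_solution_onD:
  assumes "weak_solution_on P T \<mu> u0 f u p"
  shows "momentum_eq T \<mu> u0 f u p" "divergence_free T u" "Lq_Lp P T 2 2 u" "C_L2w P T u"
    and "\<exists>Du. energy_ineq T \<mu> u0 f u Du p"
    and "\<exists>p1 p2. Lq_Lp P T 2 2 p1 \<and> Lq_Lp P T 2 (3 / 2) p2 \<and> (\<forall>t\<in>{0<..<T}. \<forall>x. p t x = p1 t x + p2 t x)"
proof -
  have "\<forall>s2. 1 \<le> s2 \<longrightarrow>
        (\<exists>p1 p2. Lq_Lp P T 2 2 p1 \<and> Lq_Lp P T s2 (3 * s2 / (3 * s2 - 2)) p2 \<and>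
                 (\<forall>t\<in>{0<..<T}. \<forall>x. p t x = p1 t x + p2 t x))"
    using assms unfolding weak_solution_on_def by blast
  \<comment> \<open>For \<open>s2 = 2\<close> the space exponent is 6/4 = 3/2, which does not exceed
    2; both parts of the pressure are then integrable over one period of space-time.\<close>
  from this[rule_format, of 2]
  show "\<exists>p1 p2. Lq_Lp P T 2 2 p1 \<and> Lq_Lp P T 2 (3 / 2) p2 \<and> (\<forall>t\<in>{0<..<T}. \<forall>x. p t x = p1 t x + p2 t x)"
    by simp
qed (use assms in \<open>auto simp: weak_solution_on_def L2_H1_def\<close>)

text \<open>Integrability is claimed without any estimate: it only allows the pressure terms to be
  split off and unfolded before they cancel.\<close>

lemma pressure_density:
  assumes "weak_solution_on P T \<mu> u0 f u p"
  shows "density P (window T p)"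
proof -
  obtain p1 p2 where p: "Lq_Lp P T 2 2 p1" "Lq_Lp P T 2 (3 / 2) p2"
    and e: "\<And>t x. t \<in> {0<..<T} \<Longrightarrow> p t x = p1 t x + p2 t x"
    using weak_solution_onD(6)[OF assms] by blast
  have eq: "window T p z = window T p1 z + window T p2 z" for z
    using e by (auto simp: window_def)
  have d: "density P (\<lambda>z. norm (window T p1 z))" "density P (\<lambda>z. norm (window T p2 z))"
    using Lq_Lp_norm_integrable[OF p(1)] Lq_Lp_norm_integrable[OF p(2)] by simp_all
  show ?thesis
  proof (rule densityI_bound)
    show "window T p \<in> borel_measurable borel"
      unfolding eq[abs_def] using p[THEN Lq_Lp_window_measurable] by measurable
    show "periodic P (\<lambda>x. window T p (t, x))" for t
      using p[THEN Lq_Lp_window_periodic, of t] unfolding eq by (simp add: periodic_def)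
    show "set_integrable lborel (UNIV \<times> torus P) (\<lambda>z. norm (window T p1 z) + norm (window T p2 z))"
      using d unfolding density_def by (intro set_integral_add) auto
    show "\<bar>window T p z\<bar> \<le> norm (window T p1 z) + norm (window T p2 z)" for z
      unfolding eq real_norm_def by (rule abs_triangle_ineq)
  qed
qed

lemma density_mult_right: "density P G \<Longrightarrow> density P (\<lambda>z. G z * c)"
  unfolding density_def by (auto simp: periodic_def)

lemma density_inner:
  fixes g :: "real \<Rightarrow> real^3 \<Rightarrow> real^3"
  assumes "Lq_Lp P T 2 2 g"
  shows "density P (\<lambda>z. window T g z \<bullet> a)"
proof (rule densityI_bound)
  have [measurable]: "window T g \<in> borel_measurable borel" by (rule Lq_Lp_window_measurable[OF assms])
  show "(\<lambda>z. window T g z \<bullet> a) \<in> borel_measurable borel" by measurable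
  show "periodic P (\<lambda>x. window T g (t, x) \<bullet> a)" for t
    using Lq_Lp_window_periodic[OF assms, of t] by (simp add: periodic_def)
  show "set_integrable lborel (UNIV \<times> torus P) (\<lambda>z. norm (window T g z) * norm a)"
    using Lq_Lp_norm_integrable[OF assms] unfolding density_def by (intro set_integrable_mult_left) simp
  show "\<bar>window T g z \<bullet> a\<bar> \<le> norm (window T g z) * norm a" for z by (rule Cauchy_Schwarz_ineq2)
qed

lemma density_bilinear:
  fixes g h :: "real \<Rightarrow> real^3 \<Rightarrow> real^3" and b :: "real^3 \<Rightarrow> real^3 \<Rightarrow> real"
  assumes g: "Lq_Lp P T 2 2 g" and h: "Lq_Lp P T 2 2 h"
    and b: "(\<lambda>z. b (window T g z) (window T h z)) \<in> borel_measurable borel" "\<And>x y. \<bar>b x y\<bar> \<le> norm x * norm y"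
  shows "density P (\<lambda>z. b (window T g z) (window T h z))"
proof (rule densityI_bound[OF b(1)])
  show "periodic P (\<lambda>x. b (window T g (t, x)) (window T h (t, x)))" for t
    using Lq_Lp_window_periodic[OF g, of t] Lq_Lp_window_periodic[OF h, of t] by (simp add: periodic_def)
  show "set_integrable lborel (UNIV \<times> torus P) (\<lambda>z. (norm (window T g z))\<^sup>2 + (norm (window T h z))\<^sup>2)"
    using L2_sq_density[OF g] L2_sq_density[OF h] unfolding density_def by (intro set_integral_add) auto
  show "\<bar>b (window T g z) (window T h z)\<bar> \<le> (norm (window T g z))\<^sup>2 + (norm (window T h z))\<^sup>2" for z
  proof -
    have "2 * (norm (window T g z) * norm (window T h z)) \<le> (norm (window T g z))\<^sup>2 + (norm (window T h z))\<^sup>2"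
      using sum_squares_bound[of "norm (window T g z)" "norm (window T h z)"] by (simp add: mult.assoc)
    moreover have "0 \<le> norm (window T g z) * norm (window T h z)" by simp
    ultimately show ?thesis using b(2)[of "window T g z" "window T h z"] by linarith
  qed
qed

lemma pd_periodic:
  assumes "smooth \<tau>" "periodic P \<tau>"
  shows "periodic P (pd v \<tau>)"
  unfolding periodic_def
proof (intro allI)
  fix x i
  have "pd v (\<lambda>y. \<tau> (y + P *\<^sub>R axis i 1)) x = pd v \<tau> (x + P *\<^sub>R axis i 1)"
    by (rule pd_compose_linear[OF bounded_linear_ident smooth_differentiable[OF assms(1)]])
  then show "pd v \<tau> (x + P *\<^sub>R axis i 1) = pd v \<tau> x"
    using assms(2) by (simp add: periodic_def)
qed

lemma periodic_continuous_bounded: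
  fixes g :: "real^3 \<Rightarrow> real"
  assumes "P > 0" "periodic P g" "continuous_on UNIV g"
  obtains B where "\<And>x. \<bar>g x\<bar> \<le> B"
proof -
  have "bounded (g ` torus P)"
    by (intro compact_imp_bounded compact_continuous_image continuous_on_subset[OF assms(3)]) (auto simp: torus_def)
  then obtain B where "\<forall>x\<in>torus P. \<bar>g x\<bar> \<le> B" by (auto simp: bounded_iff)
  then have B: "\<And>x. x \<in> torus P \<Longrightarrow> \<bar>g x\<bar> \<le> B" by blast
  have "\<bar>g x\<bar> \<le> B" for x
  proof -
    define n where "n i = - \<lfloor>x $ i / P + 1 / 2\<rfloor>" for i
    have "period P n + x \<in> torus P"
      unfolding torus_iff
    proof
      fix i
      have "\<bar>x $ i / P + of_int (n i)\<bar> \<le> 1 / 2" unfolding n_def by linarith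
      then have "P * \<bar>x $ i / P + of_int (n i)\<bar> \<le> P * (1 / 2)" using assms(1) by (intro mult_left_mono) auto
      moreover have "(period P n + x) $ i = P * (x $ i / P + of_int (n i))"
        using assms(1) by (simp add: distrib_left)
      ultimately show "\<bar>(period P n + x) $ i\<bar> \<le> P / 2" using assms(1) by (simp only: abs_mult abs_of_pos)
    qed
    then show ?thesis using B periodic_period[OF assms(2), of n x] by metis
  qed
  then show ?thesis by (rule that)
qed

lemma window_slice: "(LINT x:torus P|lborel. F (window T u (t, x)) * \<tau> x) =
    indicator {0<..<T} t * (LINT x:torus P|lborel. F (u t x) * \<tau> x)" if "F 0 = (0::real)"
  using that by (cases "0 < t \<and> t < T") (auto simp: window_def indicator_def set_lebesgue_integral_def)

text \<open>
  \<open>a\<close> being orthogonal to \<open>\<nabla>\<tau>\<close>, the test field \<open>\<tau> a\<close> is divergence free and the pressure drops out.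
\<close>

lemma momentum_separated:
  fixes a :: "real^3"
  assumes P: "P > 0" and ws: "weak_solution_on P T \<mu> u0 f u p"
    and f: "Lq_Lp P T 2 2 f" and u0: "Lp_per P 2 u0"
    and \<tau>: "smooth \<tau>" "periodic P \<tau>"
    and orth: "\<And>x. (\<Sum>i\<in>UNIV. a $ i * pd (axis i 1) \<tau> x) = 0"
    and lap: "\<And>x. (\<Sum>j\<in>UNIV. pd (axis j 1) (pd (axis j 1) \<tau>) x) = - \<kappa> * \<tau> x"
    and na: "norm a \<le> 1" and \<tau>1: "\<And>x. \<bar>\<tau> x\<bar> \<le> 1" and d\<tau>: "\<And>j x. \<bar>pd (axis j 1) \<tau> x\<bar> \<le> m"
  obtains g where "set_integrable lborel {0<..<T} g"
    and "(LINT t:{0<..<T}|lborel. \<bar>g t\<bar>) \<le> 3 * m * (LINT z:UNIV \<times> torus P|lborel. (norm (window T u z))\<^sup>2)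
          + (LINT z:UNIV \<times> torus P|lborel. norm (window T f z))"
    and "\<And>\<psi>. test_fun {..<T} \<psi> \<Longrightarrow>
      (LINT t:{0<..<T}|lborel. pd 1 \<psi> t * (LINT x:torus P|lborel. (u t x \<bullet> a) * \<tau> x))
      + (LINT t:{0<..<T}|lborel. \<psi> t * (g t - \<mu> * \<kappa> * (LINT x:torus P|lborel. (u t x \<bullet> a) * \<tau> x)))
      + \<psi> 0 * (LINT x:torus P|lborel. (u0 x \<bullet> a) * \<tau> x) = 0"
proof -
  note D = weak_solution_onD[OF ws]
  have [measurable]: "window T u \<in> borel_measurable borel" "window T f \<in> borel_measurable borel"
    by (rule Lq_Lp_window_measurable[OF D(3)], rule Lq_Lp_window_measurable[OF f])
  define \<zeta> where "\<zeta> = (\<lambda>x. tile P x * \<tau> x)"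
  have pz: "periodization P \<zeta> \<tau>" unfolding \<zeta>_def by (rule periodization_tile[OF P \<tau>])
  then have sz: "smooth \<zeta>" by (simp add: periodization_def)
  note pz1 = periodization_pd[OF pz] and pz2 = periodization_pd[OF periodization_pd[OF pz]]
  define Gu where "Gu = (\<lambda>z. window T u z \<bullet> a)"
  define Guu where "Guu j = (\<lambda>z. (window T u z \<bullet> a) * window T u z $ j)" for j
  define Gp where "Gp i = (\<lambda>z. window T p z * a $ i)" for i
  define Gf where "Gf = (\<lambda>z. window T f z \<bullet> a)"
  have nu: "\<bar>(x \<bullet> a) * y $ j\<bar> \<le> norm x * norm y" for x y :: "real^3" and j
  proof -
    have "\<bar>x \<bullet> a\<bar> \<le> norm x * norm a" by (rule Cauchy_Schwarz_ineq2)
    also have "\<dots> \<le> norm x * 1" using na by (intro mult_left_mono) auto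
    finally show ?thesis unfolding abs_mult by (intro mult_mono component_le_norm_cart) auto
  qed
  have nthm: "(\<lambda>z. window T u z $ j) \<in> borel_measurable borel" for j
    by (rule measurable_compose[OF \<open>window T u \<in> borel_measurable borel\<close>])
       (intro borel_measurable_continuous_onI continuous_intros)
  have d: "density P Gu" "density P (Guu j)" "density P (Gp i)" "density P Gf" for i j
  proof -
    show "density P Gu" unfolding Gu_def by (rule density_inner[OF D(3)])
    show "density P Gf" unfolding Gf_def by (rule density_inner[OF f])
    show "density P (Gp i)" unfolding Gp_def by (rule density_mult_right[OF pressure_density[OF ws]])
    show "density P (Guu j)"
      unfolding Guu_def
      by (rule density_bilinear[OF D(3) D(3), of "\<lambda>x y. (x \<bullet> a) * y $ j"])
         (use nthm[of j] nu in \<open>auto intro!: borel_measurable_times\<close>)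
  qed
  define w where "w t = (LINT x:torus P|lborel. (u t x \<bullet> a) * \<tau> x)" for t
  define w0 where "w0 = (LINT x:torus P|lborel. (u0 x \<bullet> a) * \<tau> x)"
  define N where "N j t = (LINT x:torus P|lborel. Guu j (t, x) * pd (axis j 1) \<tau> x)" for j t
  define Fo where "Fo t = (LINT x:torus P|lborel. Gf (t, x) * \<tau> x)" for t
  \<comment> \<open>Convection and force, the terms to be estimated. The viscous term is kept apart
    as the damping \<open>\<mu> * \<kappa> * w t\<close>.\<close>
  define g where "g t = (\<Sum>j\<in>UNIV. N j t) + Fo t" for t
  have wu: "(LINT x:torus P|lborel. Gu (t, x) * \<tau> x) = indicator {0<..<T} t * w t" for t
    unfolding Gu_def w_def by (rule window_slice[of "\<lambda>x. x \<bullet> a"]) simp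
  have \<tau>m: "\<tau> \<in> borel_measurable borel" "pd (axis j 1) \<tau> \<in> borel_measurable borel" for j
    using \<tau>(1) smooth_pd[OF \<tau>(1)] by (auto intro: smooth_borel_measurable)
  have Nb: "integrable lborel (N j)"
      "(LINT t|lborel. \<bar>N j t\<bar>) \<le> m * (LINT z:UNIV \<times> torus P|lborel. \<bar>Guu j z\<bar>)" for j
    unfolding N_def by (rule density_slice_bound[OF d(2) \<tau>m(2) d\<tau>])+
  have Fb: "integrable lborel Fo"
      "(LINT t|lborel. \<bar>Fo t\<bar>) \<le> 1 * (LINT z:UNIV \<times> torus P|lborel. \<bar>Gf z\<bar>)"
    unfolding Fo_def by (rule density_slice_bound[OF d(4) \<tau>m(1) \<tau>1])+
  have gi: "integrable lborel g"
    unfolding g_def using Nb(1) Fb(1) by (intro Bochner_Integration.integrable_add Bochner_Integration.integrable_sum)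
  have out: "window T h (t, x) = 0" if "t \<notin> {0<..<T}" for h :: "real \<Rightarrow> real^3 \<Rightarrow> real^3" and t x
    using that by (auto simp: window_def)
  have N_out: "N j t = 0" if "t \<notin> {0<..<T}" for j t
    by (simp add: N_def Guu_def out[OF that] set_lebesgue_integral_def)
  have Fo_out: "Fo t = 0" if "t \<notin> {0<..<T}" for t
    by (simp add: Fo_def Gf_def out[OF that] set_lebesgue_integral_def)
  have g_out: "g t = 0" if "t \<notin> {0<..<T}" for t using N_out[OF that] Fo_out[OF that] by (simp add: g_def)
  show ?thesis
  proof (rule that[of g])
    have ind: "indicator {0<..<T} t *\<^sub>R g t = g t" for t using g_out[of t] by (auto simp: indicator_def)
    show "set_integrable lborel {0<..<T} g" using gi by (simp only: set_integrable_def ind)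
    have "(LINT t:{0<..<T}|lborel. \<bar>g t\<bar>) = (LINT t|lborel. \<bar>g t\<bar>)"
      using g_out unfolding set_lebesgue_integral_def
      by (intro Bochner_Integration.integral_cong) (auto simp: indicator_def)
    also have "\<dots> \<le> (LINT t|lborel. (\<Sum>j\<in>UNIV. \<bar>N j t\<bar>) + \<bar>Fo t\<bar>)"
    proof (rule integral_mono)
      show "integrable lborel (\<lambda>t. (\<Sum>j\<in>UNIV. \<bar>N j t\<bar>) + \<bar>Fo t\<bar>)"
        using Nb(1) Fb(1) by (intro Bochner_Integration.integrable_add Bochner_Integration.integrable_sum integrable_abs)
      show "\<bar>g t\<bar> \<le> (\<Sum>j\<in>UNIV. \<bar>N j t\<bar>) + \<bar>Fo t\<bar>" for t
        unfolding g_def by (rule order_trans[OF abs_triangle_ineq]) (simp add: sum_abs)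
    qed (rule integrable_abs[OF gi])
    also have "\<dots> = (\<Sum>j\<in>UNIV. (LINT t|lborel. \<bar>N j t\<bar>)) + (LINT t|lborel. \<bar>Fo t\<bar>)"
      using Nb(1) Fb(1) by (simp add: integrable_abs)
    \<comment> \<open>Each of the three convective terms costs one derivative of
      \<open>\<tau>\<close>, hence a factor \<open>m\<close>, times the squared norm of
      \<open>u\<close>; this is the origin of \<open>3 * m\<close>.\<close>
    also have "\<dots> \<le> (\<Sum>j\<in>(UNIV::3 set). m * (LINT z:UNIV \<times> torus P|lborel. (norm (window T u z))\<^sup>2))
        + 1 * (LINT z:UNIV \<times> torus P|lborel. norm (window T f z))"
    proof (intro add_mono sum_mono)
      fix j :: 3
      have m0: "m \<ge> 0" using d\<tau>[of j 0] by linarith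
      have "(LINT z:UNIV \<times> torus P|lborel. \<bar>Guu j z\<bar>) \<le> (LINT z:UNIV \<times> torus P|lborel. (norm (window T u z))\<^sup>2)"
      proof (rule set_integral_mono)
        show "set_integrable lborel (UNIV \<times> torus P) (\<lambda>z. \<bar>Guu j z\<bar>)"
          using d(2) unfolding density_def by (intro set_integrable_abs) auto
        show "set_integrable lborel (UNIV \<times> torus P) (\<lambda>z. (norm (window T u z))\<^sup>2)"
          using L2_sq_density[OF D(3)] unfolding density_def by auto
        show "\<bar>Guu j z\<bar> \<le> (norm (window T u z))\<^sup>2" for z
          unfolding Guu_def power2_eq_square by (rule nu)
      qed
      then have "m * (LINT z:UNIV \<times> torus P|lborel. \<bar>Guu j z\<bar>) \<le> m * (LINT z:UNIV \<times> torus P|lborel. (norm (window T u z))\<^sup>2)"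
        using m0 by (rule mult_left_mono)
      then show "(LINT t|lborel. \<bar>N j t\<bar>) \<le> m * (LINT z:UNIV \<times> torus P|lborel. (norm (window T u z))\<^sup>2)"
        using Nb(2)[of j] by linarith
    next
      have "(LINT z:UNIV \<times> torus P|lborel. \<bar>Gf z\<bar>) \<le> (LINT z:UNIV \<times> torus P|lborel. norm (window T f z))"
      proof (rule set_integral_mono)
        show "set_integrable lborel (UNIV \<times> torus P) (\<lambda>z. \<bar>Gf z\<bar>)"
          using d(4) unfolding density_def by (intro set_integrable_abs) auto
        show "set_integrable lborel (UNIV \<times> torus P) (\<lambda>z. norm (window T f z))"
          using Lq_Lp_norm_integrable[OF f] unfolding density_def by auto
        show "\<bar>Gf z\<bar> \<le> norm (window T f z)" for z
        proof -
          have "\<bar>window T f z \<bullet> a\<bar> \<le> norm (window T f z) * norm a" by (rule Cauchy_Schwarz_ineq2)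
          also have "\<dots> \<le> norm (window T f z) * 1" using na by (intro mult_left_mono) auto
          finally show ?thesis by (simp add: Gf_def)
        qed
      qed
      then show "(LINT t|lborel. \<bar>Fo t\<bar>) \<le> 1 * (LINT z:UNIV \<times> torus P|lborel. norm (window T f z))"
        using Fb(2) by linarith
    qed
    finally show "(LINT t:{0<..<T}|lborel. \<bar>g t\<bar>) \<le> 3 * m * (LINT z:UNIV \<times> torus P|lborel. (norm (window T u z))\<^sup>2)
          + (LINT z:UNIV \<times> torus P|lborel. norm (window T f z))"
      by simp
  next
    fix \<psi> :: "real \<Rightarrow> real" assume \<psi>: "test_fun {..<T} \<psi>"
    then have s\<psi>: "smooth \<psi>" by (simp add: test_fun_def)
    obtain B where B: "\<And>t. \<bar>\<psi> t\<bar> \<le> B" "\<And>t. \<bar>pd 1 \<psi> t\<bar> \<le> B" using test_fun_real_bounds[OF \<psi>] by blast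
    note c\<psi> = smooth_continuous[OF s\<psi>] and c\<psi>' = smooth_continuous[OF smooth_pd[OF s\<psi>, of 1]]
    define \<phi> where "\<phi> = (\<lambda>z. \<psi> (fst z) * \<zeta> (snd z))"
    have s\<phi>: "smooth \<phi>" unfolding \<phi>_def by (rule smooth_separated[OF s\<psi> sz])
    have dt: "pd (1, 0) \<phi> = (\<lambda>z. pd 1 \<psi> (fst z) * \<zeta> (snd z))"
    proof -
      have "pd 0 \<zeta> x = 0" for x
        using has_derivative_pd[OF smooth_differentiable[OF sz], of x] linear_0 has_derivative_linear by metis
      then show ?thesis unfolding \<phi>_def pd_separated[OF s\<psi> sz] by simp
    qed
    have dx: "pd (0, v) (\<lambda>z. \<psi> (fst z) * \<xi> (snd z)) = (\<lambda>z. \<psi> (fst z) * pd v \<xi> (snd z))" if "smooth \<xi>" for v and \<xi> :: "real^3 \<Rightarrow> real"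
      unfolding pd_separated[OF s\<psi> that] by simp
    note dx1 = dx[OF sz, folded \<phi>_def] and dx2 = dx[OF smooth_pd[OF sz]]
    define \<Phi> where "\<Phi> = (\<lambda>z. \<phi> z *\<^sub>R a)"
    have test: "test_fun (spacetime T) \<Phi>"
      unfolding \<Phi>_def \<phi>_def by (rule test_fun_scaleR[OF test_fun_separated[OF \<psi> pz]])
    have Dt: "pd (1, 0) \<Phi> = (\<lambda>z. (pd 1 \<psi> (fst z) * \<zeta> (snd z)) *\<^sub>R a)"
      unfolding \<Phi>_def pd_scaleR[OF s\<phi>] dt ..
    have Dx: "pd (0, v) \<Phi> = (\<lambda>z. (\<psi> (fst z) * pd v \<zeta> (snd z)) *\<^sub>R a)" for v
      unfolding \<Phi>_def pd_scaleR[OF s\<phi>] dx1 ..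
    have Dxx: "pd (0, v) (pd (0, v) \<Phi>) = (\<lambda>z. (\<psi> (fst z) * pd v (pd v \<zeta>) (snd z)) *\<^sub>R a)" for v
      unfolding Dx pd_scaleR[OF smooth_separated[OF s\<psi> smooth_pd[OF sz]]] dx2 ..
    define J where "J G \<theta> \<xi> = (LINT z|lborel. G z * (\<theta> (fst z) * \<xi> (snd z)))"
      for G :: "real \<times> (real^3) \<Rightarrow> real" and \<theta> :: "real \<Rightarrow> real" and \<xi> :: "real^3 \<Rightarrow> real"
    have pt: "indicator ({0<..<T} \<times> UNIV) z *\<^sub>R (case z of (t, x) \<Rightarrow>
            u t x \<bullet> d_t \<Phi> (t, x)
          + (\<Sum>i\<in>UNIV. \<Sum>j\<in>UNIV. u t x $ i * u t x $ j * d_x j \<Phi> (t, x) $ i)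
          + p t x * (\<Sum>i\<in>UNIV. d_x i \<Phi> (t, x) $ i)
          + \<mu> * (u t x \<bullet> laplace_x \<Phi> (t, x))
          + f t x \<bullet> \<Phi> (t, x))
      = Gu z * (pd 1 \<psi> (fst z) * \<zeta> (snd z))
        + (\<Sum>j\<in>UNIV. Guu j z * (\<psi> (fst z) * pd (axis j 1) \<zeta> (snd z)))
        + (\<Sum>i\<in>UNIV. Gp i z * (\<psi> (fst z) * pd (axis i 1) \<zeta> (snd z)))
        + \<mu> * (\<Sum>j\<in>UNIV. Gu z * (\<psi> (fst z) * pd (axis j 1) (pd (axis j 1) \<zeta>) (snd z)))
        + Gf z * (\<psi> (fst z) * \<zeta> (snd z))" for z
    proof (cases "z \<in> {0<..<T} \<times> UNIV")
      case True
      obtain t x where z: "z = (t, x)" by (cases z)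
      then have t: "0 < t" "t < T" using True by auto
      have c: "window T u (t, x) = u t x" "window T p (t, x) = p t x" "window T f (t, x) = f t x"
        using t by (simp_all add: window_def)
      have "(\<Sum>i\<in>UNIV. \<Sum>j\<in>UNIV. u t x $ i * u t x $ j * d_x j \<Phi> (t, x) $ i)
          = (\<Sum>j\<in>UNIV. \<Sum>i\<in>UNIV. u t x $ i * u t x $ j * d_x j \<Phi> (t, x) $ i)"
        by (rule sum.swap)
      also have "\<dots> = (\<Sum>j\<in>UNIV. Guu j z * (\<psi> (fst z) * pd (axis j 1) \<zeta> (snd z)))"
        by (simp add: Dx Guu_def c z inner_vec_def sum_distrib_left sum_distrib_right mult_ac)
      finally have 1: "(\<Sum>i\<in>UNIV. \<Sum>j\<in>UNIV. u t x $ i * u t x $ j * d_x j \<Phi> (t, x) $ i) = \<dots>" .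
      have 2: "p t x * (\<Sum>i\<in>UNIV. d_x i \<Phi> (t, x) $ i) = (\<Sum>i\<in>UNIV. Gp i z * (\<psi> (fst z) * pd (axis i 1) \<zeta> (snd z)))"
        by (simp add: Dx Gp_def c z sum_distrib_left mult_ac)
      have 3: "u t x \<bullet> laplace_x \<Phi> (t, x) = (\<Sum>j\<in>UNIV. Gu z * (\<psi> (fst z) * pd (axis j 1) (pd (axis j 1) \<zeta>) (snd z)))"
        by (simp add: laplace_x_def Dxx Gu_def c z inner_sum_right mult_ac)
      have 4: "u t x \<bullet> d_t \<Phi> (t, x) = Gu z * (pd 1 \<psi> (fst z) * \<zeta> (snd z))"
        by (simp add: Dt Gu_def c z mult_ac)
      have 5: "f t x \<bullet> \<Phi> (t, x) = Gf z * (\<psi> (fst z) * \<zeta> (snd z))"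
        by (simp add: \<Phi>_def \<phi>_def Gf_def c z mult_ac)
      show ?thesis using True by (simp add: z 1[unfolded z] 2[unfolded z] 3[unfolded z] 4[unfolded z] 5[unfolded z])
    next
      case False
      then have "window T u z = 0" "window T p z = 0" "window T f z = 0" by (auto simp: window_def mem_Times_iff)
      then show ?thesis using False by (simp add: Gu_def Guu_def Gp_def Gf_def)
    qed
    \<comment> \<open>One unfolding for each kind of term: time derivative, convection, pressure,
      viscosity, force, and the undifferentiated pairing.\<close>
    note U = density_unfold[OF P d(1) pz c\<psi>' B(2)]
    note UU = density_unfold[OF P d(2) pz1 c\<psi> B(1)]
    note UP = density_unfold[OF P d(3) pz1 c\<psi> B(1)]
    note UL = density_unfold[OF P d(1) pz2 c\<psi> B(1)]
    note UF = density_unfold[OF P d(4) pz c\<psi> B(1)]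
    note UW = density_unfold[OF P d(1) pz c\<psi> B(1)]
    have "(LINT (t, x):{0<..<T} \<times> UNIV|lborel.
            u t x \<bullet> d_t \<Phi> (t, x)
          + (\<Sum>i\<in>UNIV. \<Sum>j\<in>UNIV. u t x $ i * u t x $ j * d_x j \<Phi> (t, x) $ i)
          + p t x * (\<Sum>i\<in>UNIV. d_x i \<Phi> (t, x) $ i)
          + \<mu> * (u t x \<bullet> laplace_x \<Phi> (t, x))
          + f t x \<bullet> \<Phi> (t, x))
        = J Gu (pd 1 \<psi>) \<zeta> + (\<Sum>j\<in>UNIV. J (Guu j) \<psi> (pd (axis j 1) \<zeta>)) + (\<Sum>i\<in>UNIV. J (Gp i) \<psi> (pd (axis i 1) \<zeta>))
          + \<mu> * (\<Sum>j\<in>UNIV. J Gu \<psi> (pd (axis j 1) (pd (axis j 1) \<zeta>))) + J Gf \<psi> \<zeta>"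
      unfolding set_lebesgue_integral_def pt J_def
      by (simp add: U(1) UU(1) UP(1) UL(1) UF(1))
    moreover have "(\<Sum>i\<in>UNIV. J (Gp i) \<psi> (pd (axis i 1) \<zeta>)) = 0"
    proof -
      \<comment> \<open>The pressure terms are added under one integral over the slab, so that the
        orthogonality of \<open>a\<close> and the gradient of \<open>\<tau>\<close> acts pointwise.
        It holds for \<open>\<tau>\<close> and not for \<open>\<zeta>\<close>, hence the unfolding
        comes before the summation.\<close>
      have "(\<Sum>i\<in>UNIV. J (Gp i) \<psi> (pd (axis i 1) \<zeta>))
          = (LINT z:UNIV \<times> torus P|lborel. (\<Sum>i\<in>UNIV. Gp i z * (\<psi> (fst z) * pd (axis i 1) \<tau> (snd z))))"
        unfolding J_def UP(5) by (rule set_integral_finite_sum(1)[OF UP(4), symmetric])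
      also have "\<dots> = (LINT z:UNIV \<times> torus P|lborel. 0)"
      proof -
        have "(\<Sum>i\<in>UNIV. Gp i z * (\<psi> (fst z) * pd (axis i 1) \<tau> (snd z)))
            = window T p z * \<psi> (fst z) * (\<Sum>i\<in>UNIV. a $ i * pd (axis i 1) \<tau> (snd z))" for z
          by (simp add: Gp_def sum_distrib_left mult_ac)
        then have "(\<Sum>i\<in>UNIV. Gp i z * (\<psi> (fst z) * pd (axis i 1) \<tau> (snd z))) = 0" for z
          by (simp only: orth mult_zero_right)
        then show ?thesis by simp
      qed
      finally show ?thesis by (simp add: set_lebesgue_integral_def)
    qed
    moreover have "(\<Sum>j\<in>UNIV. J Gu \<psi> (pd (axis j 1) (pd (axis j 1) \<zeta>))) = - \<kappa> * (LINT t|lborel. \<psi> t * (indicator {0<..<T} t * w t))"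
    proof -
      \<comment> \<open>Again the terms are joined after unfolding: \<open>\<tau>\<close> is an
        eigenfunction of the Laplacian, so viscosity becomes multiplication by a number.\<close>
      have "(\<Sum>j\<in>UNIV. J Gu \<psi> (pd (axis j 1) (pd (axis j 1) \<zeta>)))
          = (LINT z:UNIV \<times> torus P|lborel. (\<Sum>j\<in>UNIV. Gu z * (\<psi> (fst z) * pd (axis j 1) (pd (axis j 1) \<tau>) (snd z))))"
        unfolding J_def UL(5) by (rule set_integral_finite_sum(1)[OF UL(4), symmetric])
      also have "\<dots> = (LINT z:UNIV \<times> torus P|lborel. - \<kappa> * (Gu z * (\<psi> (fst z) * \<tau> (snd z))))"
      proof -
        have "(\<Sum>j\<in>UNIV. Gu z * (\<psi> (fst z) * pd (axis j 1) (pd (axis j 1) \<tau>) (snd z)))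
            = Gu z * (\<psi> (fst z) * (\<Sum>j\<in>UNIV. pd (axis j 1) (pd (axis j 1) \<tau>) (snd z)))" for z
          by (simp add: sum_distrib_left)
        also have "\<dots> z = - \<kappa> * (Gu z * (\<psi> (fst z) * \<tau> (snd z)))" for z unfolding lap by simp
        finally show ?thesis by simp
      qed
      also have "\<dots> = - \<kappa> * (LINT z:UNIV \<times> torus P|lborel. Gu z * (\<psi> (fst z) * \<tau> (snd z)))"
        by (rule set_integral_mult_right)
      also have "(LINT z:UNIV \<times> torus P|lborel. Gu z * (\<psi> (fst z) * \<tau> (snd z)))
          = (LINT t|lborel. \<psi> t * (indicator {0<..<T} t * w t))"
        using UW(3,5) by (simp only: wu)
      finally show ?thesis .
    qed
    moreover have "(LINT x|lborel. u0 x \<bullet> \<Phi> (0, x)) = \<psi> 0 * w0"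
    proof -
      have um: "u0 \<in> borel_measurable borel" "periodic P u0" and ui: "set_integrable lborel (torus P) (\<lambda>x. norm (u0 x) powr 2)"
        using u0 by (auto simp: Lp_per_def)
      have m2: "(\<lambda>x. u0 x \<bullet> a) \<in> borel_measurable borel" using um(1) by measurable
      have "set_integrable lborel (torus P) (\<lambda>x. u0 x \<bullet> a)"
      proof (rule set_integrable_bound)
        show "set_integrable lborel (torus P) (\<lambda>x. 1 + norm (u0 x) powr 2)"
          by (intro set_integral_add(1) ui torus_integrable_bounded[of _ 1]) auto
        show "set_borel_measurable lborel (torus P) (\<lambda>x. u0 x \<bullet> a)"
          unfolding set_borel_measurable_def using m2 by measurable
        show "AE x in lborel. x \<in> torus P \<longrightarrow> norm (u0 x \<bullet> a) \<le> norm (1 + norm (u0 x) powr 2)"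
        proof (intro AE_I2 impI)
          fix x
          have "\<bar>u0 x \<bullet> a\<bar> \<le> norm (u0 x) * norm a" by (rule Cauchy_Schwarz_ineq2)
          also have "\<dots> \<le> norm (u0 x) * 1" using na by (intro mult_left_mono) auto
          also have "\<dots> \<le> 1 + (norm (u0 x))\<^sup>2"
          proof -
            have "2 * norm (u0 x) \<le> 1 + (norm (u0 x))\<^sup>2" using sum_squares_bound[of 1 "norm (u0 x)"] by simp
            then show ?thesis using norm_ge_zero[of "u0 x"] by linarith
          qed
          finally show "norm (u0 x \<bullet> a) \<le> norm (1 + norm (u0 x) powr 2)" by simp
        qed
      qed
      from unfold_space(2)[OF P m2 _ this pz]
      have "(LINT x|lborel. (u0 x \<bullet> a) * \<zeta> x) = w0"
        using um(2) by (simp add: periodic_def w0_def)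
      then show ?thesis by (simp add: \<Phi>_def \<phi>_def mult_ac)
    qed
    moreover have "(LINT (t, x):{0<..<T} \<times> UNIV|lborel.
            u t x \<bullet> d_t \<Phi> (t, x)
          + (\<Sum>i\<in>UNIV. \<Sum>j\<in>UNIV. u t x $ i * u t x $ j * d_x j \<Phi> (t, x) $ i)
          + p t x * (\<Sum>i\<in>UNIV. d_x i \<Phi> (t, x) $ i)
          + \<mu> * (u t x \<bullet> laplace_x \<Phi> (t, x))
          + f t x \<bullet> \<Phi> (t, x)) + (LINT x|lborel. u0 x \<bullet> \<Phi> (0, x)) = 0"
      using D(1) test unfolding momentum_eq_def by blast
    ultimately have "J Gu (pd 1 \<psi>) \<zeta> + (\<Sum>j\<in>UNIV. J (Guu j) \<psi> (pd (axis j 1) \<zeta>))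
        + \<mu> * (- \<kappa> * (LINT t|lborel. \<psi> t * (indicator {0<..<T} t * w t))) + J Gf \<psi> \<zeta> + \<psi> 0 * w0 = 0"
      by simp
    then have main: "(LINT t|lborel. pd 1 \<psi> t * (indicator {0<..<T} t * w t)) + (\<Sum>j\<in>UNIV. (LINT t|lborel. \<psi> t * N j t))
        + \<mu> * (- \<kappa> * (LINT t|lborel. \<psi> t * (indicator {0<..<T} t * w t))) + (LINT t|lborel. \<psi> t * Fo t) + \<psi> 0 * w0 = 0"
      by (simp only: J_def U(3) UU(3) UF(3) wu N_def Fo_def)
    have iw: "integrable lborel (\<lambda>t. \<psi> t * (indicator {0<..<T} t * w t))" using UW(2) by (simp only: wu)
    have iN: "integrable lborel (\<lambda>t. \<psi> t * N j t)" for j using UU(2) by (simp only: N_def)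
    have iF: "integrable lborel (\<lambda>t. \<psi> t * Fo t)" using UF(2) by (simp only: Fo_def)
    have "(LINT t:{0<..<T}|lborel. \<psi> t * (g t - \<mu> * \<kappa> * w t))
        = (LINT t|lborel. (\<Sum>j\<in>UNIV. \<psi> t * N j t) + \<psi> t * Fo t - (\<mu> * \<kappa>) * (\<psi> t * (indicator {0<..<T} t * w t)))"
      unfolding set_lebesgue_integral_def
    proof (rule Bochner_Integration.integral_cong[OF refl])
      fix t
      show "indicator {0<..<T} t *\<^sub>R (\<psi> t * (g t - \<mu> * \<kappa> * w t))
          = (\<Sum>j\<in>UNIV. \<psi> t * N j t) + \<psi> t * Fo t - (\<mu> * \<kappa>) * (\<psi> t * (indicator {0<..<T} t * w t))"
        using N_out[of t] Fo_out[of t]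
        by (cases "t \<in> {0<..<T}") (simp_all add: g_def sum_distrib_left[symmetric] algebra_simps)
    qed
    also have "\<dots> = (\<Sum>j\<in>UNIV. (LINT t|lborel. \<psi> t * N j t)) + (LINT t|lborel. \<psi> t * Fo t)
        - (\<mu> * \<kappa>) * (LINT t|lborel. \<psi> t * (indicator {0<..<T} t * w t))"
      using iN iF iw by simp
    finally have e1: "(LINT t:{0<..<T}|lborel. \<psi> t * (g t - \<mu> * \<kappa> * w t)) = \<dots>" .
    have e2: "(LINT t:{0<..<T}|lborel. pd 1 \<psi> t * w t) = (LINT t|lborel. pd 1 \<psi> t * (indicator {0<..<T} t * w t))"
      by (simp add: set_lebesgue_integral_def mult.left_commute)
    show "(LINT t:{0<..<T}|lborel. pd 1 \<psi> t * (LINT x:torus P|lborel. (u t x \<bullet> a) * \<tau> x))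
      + (LINT t:{0<..<T}|lborel. \<psi> t * (g t - \<mu> * \<kappa> * (LINT x:torus P|lborel. (u t x \<bullet> a) * \<tau> x)))
      + \<psi> 0 * (LINT x:torus P|lborel. (u0 x \<bullet> a) * \<tau> x) = 0"
      using main e1 e2 unfolding w_def[symmetric] w0_def[symmetric] by (simp add: algebra_simps)
  qed
qed

subsection \<open>Incompressibility\<close>

lemma Lp_per_component_integrable:
  fixes v :: "real^3 \<Rightarrow> real^3" and h :: "real^3 \<Rightarrow> real"
  assumes v: "Lp_per P 2 v" and h: "h \<in> borel_measurable borel" "\<And>x. \<bar>h x\<bar> \<le> B"
  shows "set_integrable lborel (torus P) (\<lambda>x. v x $ j * h x)"
proof -
  have vm: "v \<in> borel_measurable borel" and vi: "set_integrable lborel (torus P) (\<lambda>x. norm (v x) powr 2)"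
    using v by (auto simp: Lp_per_def)
  have vjm[measurable]: "(\<lambda>x. v x $ j) \<in> borel_measurable borel"
    by (rule measurable_compose[OF vm]) (intro borel_measurable_continuous_onI continuous_intros)
  have "set_integrable lborel (torus P) (\<lambda>x. v x $ j)"
  proof (rule set_integrable_bound)
    show "set_integrable lborel (torus P) (\<lambda>x. 1 + norm (v x) powr 2)"
      by (intro set_integral_add(1) vi torus_integrable_bounded[of _ 1]) auto
    show "set_borel_measurable lborel (torus P) (\<lambda>x. v x $ j)"
      unfolding set_borel_measurable_def by measurable
    show "AE x in lborel. x \<in> torus P \<longrightarrow> norm (v x $ j) \<le> norm (1 + norm (v x) powr 2)"
    proof (intro AE_I2 impI)
      fix x
      have "2 * norm (v x) \<le> 1 + (norm (v x))\<^sup>2" using sum_squares_bound[of 1 "norm (v x)"] by simp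
      then have "\<bar>v x $ j\<bar> \<le> 1 + (norm (v x))\<^sup>2"
        using norm_ge_zero[of "v x"] component_le_norm_cart[of "v x" j] by linarith
      then show "norm (v x $ j) \<le> norm (1 + norm (v x) powr 2)" by simp
    qed
  qed
  then have "integrable lborel (\<lambda>x. (indicator (torus P) x *\<^sub>R v x $ j) * h x)"
    unfolding set_integrable_def by (rule integrable_bounded_mult) (use h in simp_all)
  then show ?thesis by (simp add: set_integrable_def mult.assoc)
qed

lemma integral_zero_imp_zero:
  fixes s :: "real \<Rightarrow> real"
  assumes s: "continuous_on {0..T} s" and z: "\<And>b. 0 < b \<Longrightarrow> b < T \<Longrightarrow> (LINT t:{0<..b}|lborel. s t) = 0"
    and t: "0 < t" "t < T"
  shows "s t = 0"
proof -
  have "((\<lambda>u. LBINT y=0..u. s y) has_vector_derivative s t) (at t within {0..T})"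
    using interval_integral_FTC2[of 0 0 T s t] s t by (simp add: zero_ereal_def)
  then have "((\<lambda>u. LBINT y=0..u. s y) has_vector_derivative s t) (at t)"
    using t by (simp add: at_within_Icc_at)
  moreover have "((\<lambda>u. LBINT y=0..u. s y) has_vector_derivative 0) (at t)"
  proof (rule has_vector_derivative_transform_within_open[of "\<lambda>_. 0"])
    show "((\<lambda>_. 0) has_vector_derivative 0) (at t)" by simp
    show "0 = (LBINT y=0..u. s y)" if "u \<in> {0<..<T}" for u
      using that z[of u] interval_integral_Ioc[of 0 u s] by (simp add: zero_ereal_def)
  qed (use t in auto)
  ultimately show ?thesis by (rule vector_derivative_unique_at)
qed

lemma smooth_vec_lambda_gradient_Lp:
  assumes P: "P > 0" and \<tau>: "smooth \<tau>" "periodic P \<tau>"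
  shows "Lp_per P 2 (\<lambda>x. \<chi> j. pd (axis j 1) \<tau> x)"
proof -
  have c: "continuous_on UNIV (pd v \<tau>)" for v by (rule smooth_continuous[OF smooth_pd[OF \<tau>(1)]])
  then have cv: "continuous_on UNIV (\<lambda>x. \<chi> j. pd (axis j 1) \<tau> x)" by (intro continuous_intros)
  have per: "periodic P (\<lambda>x. \<chi> j. pd (axis j 1) \<tau> x)"
    using pd_periodic[OF \<tau>] by (simp add: periodic_def)
  have pern: "periodic P (\<lambda>x. norm (\<chi> j. pd (axis j 1) \<tau> x) powr 2)"
    using per by (simp add: periodic_def)
  have "continuous_on UNIV (\<lambda>x. norm (\<chi> j. pd (axis j 1) \<tau> x) powr 2)"
    using cv by (simp add: continuous_intros)
  then obtain B where "\<And>x. \<bar>norm (\<chi> j. pd (axis j 1) \<tau> x) powr 2\<bar> \<le> B"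
    using periodic_continuous_bounded[OF P pern] by blast
  then have "set_integrable lborel (torus P) (\<lambda>x. norm (\<chi> j. pd (axis j 1) \<tau> x) powr 2)"
    by (rule torus_integrable_bounded[rotated])
       (use borel_measurable_continuous_onI[OF cv] in measurable)
  then show ?thesis using per borel_measurable_continuous_onI[OF cv] by (simp add: Lp_per_def)
qed

text \<open>The weak divergence condition makes the integral of \<open>s\<close> over every interval
  starting at 0 vanish. Weak continuity of \<open>u\<close>, tested with the gradient of
  \<open>\<tau>\<close>, makes \<open>s\<close> continuous, so it vanishes at each positive time and
  not merely almost everywhere.\<close>

lemma divergence_slice:
  assumes P: "P > 0" and ws: "weak_solution_on P T \<mu> u0 f u p"
    and \<tau>: "smooth \<tau>" "periodic P \<tau>" and t: "0 < t" "t < T"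
  shows "(\<Sum>j\<in>UNIV. (LINT x:torus P|lborel. u t x $ j * pd (axis j 1) \<tau> x)) = 0"
proof -
  note D = weak_solution_onD[OF ws]
  define v where "v = (\<lambda>x. \<chi> j. pd (axis j 1) \<tau> x)"
  define s where "s t = (LINT x:torus P|lborel. u t x \<bullet> v x)" for t
  have sc: "continuous_on {0..T} s"
    using D(4) smooth_vec_lambda_gradient_Lp[OF P \<tau>] unfolding C_L2w_def s_def v_def by blast
  have ut: "Lp_per P 2 (u t)" if "t \<in> {0..T}" for t using D(4) that unfolding C_L2w_def by blast
  have s_eq: "s t = (\<Sum>j\<in>UNIV. (LINT x:torus P|lborel. u t x $ j * pd (axis j 1) \<tau> x))" if "t \<in> {0..T}" for t
  proof -
    have "set_integrable lborel (torus P) (\<lambda>x. u t x $ j * pd (axis j 1) \<tau> x)" for j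
    proof -
      obtain B where "\<And>x. \<bar>pd (axis j 1) \<tau> x\<bar> \<le> B"
        using periodic_continuous_bounded[OF P pd_periodic[OF \<tau>] smooth_continuous[OF smooth_pd[OF \<tau>(1)]]] by blast
      then show ?thesis
        by (rule Lp_per_component_integrable[OF ut[OF that] smooth_borel_measurable[OF smooth_pd[OF \<tau>(1)]]])
    qed
    then show ?thesis by (simp add: s_def v_def inner_vec_def set_integral_finite_sum(1))
  qed
  define \<zeta> where "\<zeta> = (\<lambda>x. tile P x * \<tau> x)"
  have pz: "periodization P \<zeta> \<tau>" unfolding \<zeta>_def by (rule periodization_tile[OF P \<tau>])
  then have sz: "smooth \<zeta>" by (simp add: periodization_def)
  note pz1 = periodization_pd[OF pz]
  define G where "G j = (\<lambda>z. window T u z \<bullet> axis j 1)" for j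
  have d: "density P (G j)" for j unfolding G_def by (rule density_inner[OF D(3)])
  have sl: "(LINT x:torus P|lborel. G j (t, x) * pd (axis j 1) \<tau> x)
      = indicator {0<..<T} t * (LINT x:torus P|lborel. u t x $ j * pd (axis j 1) \<tau> x)" for j t
    using window_slice[of "\<lambda>x. x \<bullet> axis j 1" P T u t "pd (axis j 1) \<tau>"]
    by (simp add: G_def inner_axis)
  \<comment> \<open>In weak form, the divergence condition says that the zero function is a
    primitive of \<open>s\<close> with initial value 0.\<close>
  have "0 = 0 + (LINT t:{0<..b}|lborel. s t)" if b: "0 < b" "b < T" for b
  proof (rule weak_primitive[where T=T and w="\<lambda>_. 0"])
    show "set_integrable lborel {0<..<T} s" by (rule set_integrable_continuous_Ioo[OF sc])
    fix \<psi> :: "real \<Rightarrow> real" assume \<psi>: "test_fun {..<T} \<psi>"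
    then have s\<psi>: "smooth \<psi>" by (simp add: test_fun_def)
    obtain B where B: "\<And>t. \<bar>\<psi> t\<bar> \<le> B" "\<And>t. \<bar>pd 1 \<psi> t\<bar> \<le> B"
      using test_fun_real_bounds[OF \<psi>] by blast
    note U = density_unfold[OF P d pz1 smooth_continuous[OF s\<psi>] B(1)]
    define \<phi> where "\<phi> = (\<lambda>z. \<psi> (fst z) * \<zeta> (snd z))"
    have dx: "pd (0, v) \<phi> = (\<lambda>z. \<psi> (fst z) * pd v \<zeta> (snd z))" for v
      unfolding \<phi>_def pd_separated[OF s\<psi> sz] by simp
    have "test_fun (spacetime T) \<phi>" unfolding \<phi>_def by (rule test_fun_separated[OF \<psi> pz])
    note D(2)[unfolded divergence_free_def, THEN spec[of _ \<phi>], THEN mp, OF this]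
    moreover have "indicator ({0<..<T} \<times> UNIV) z *\<^sub>R (case z of (t, x) \<Rightarrow> \<Sum>j\<in>UNIV. u t x $ j * d_x j \<phi> (t, x))
        = (\<Sum>j\<in>UNIV. G j z * (\<psi> (fst z) * pd (axis j 1) \<zeta> (snd z)))" for z
      by (cases z) (auto simp: G_def window_def dx inner_axis indicator_def)
    ultimately have "(\<Sum>j\<in>UNIV. (LINT z|lborel. G j z * (\<psi> (fst z) * pd (axis j 1) \<zeta> (snd z)))) = 0"
      using U(1) by (simp add: set_lebesgue_integral_def)
    then have "(\<Sum>j\<in>UNIV. (LINT t|lborel. \<psi> t * (LINT x:torus P|lborel. G j (t, x) * pd (axis j 1) \<tau> x))) = 0"
      by (simp only: U(3))
    also have "(\<Sum>j\<in>UNIV. (LINT t|lborel. \<psi> t * (LINT x:torus P|lborel. G j (t, x) * pd (axis j 1) \<tau> x)))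
        = (LINT t|lborel. (\<Sum>j\<in>UNIV. \<psi> t * (LINT x:torus P|lborel. G j (t, x) * pd (axis j 1) \<tau> x)))"
      using U(2) by simp
    also have "\<dots> = (LINT t:{0<..<T}|lborel. \<psi> t * s t)"
      unfolding set_lebesgue_integral_def[of lborel "{0<..<T}"]
    proof (rule Bochner_Integration.integral_cong[OF refl])
      fix t
      show "(\<Sum>j\<in>UNIV. \<psi> t * (LINT x:torus P|lborel. G j (t, x) * pd (axis j 1) \<tau> x))
          = indicator {0<..<T} t *\<^sub>R (\<psi> t * s t)"
        using s_eq[of t] unfolding sl by (auto simp: indicator_def sum_distrib_left)
    qed
    finally show "(LINT t:{0<..<T}|lborel. pd 1 \<psi> t * 0) + (LINT t:{0<..<T}|lborel. \<psi> t * s t) + \<psi> 0 * 0 = 0"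
      by (simp add: set_lebesgue_integral_def)
  qed (use b in auto)
  then have "s t = 0" by (intro integral_zero_imp_zero[OF sc _ t]) simp
  then show ?thesis using s_eq[of t] t by simp
qed

subsection \<open>The energy bound\<close>

text \<open>
  The weight \<open>exp (-1 / (T\<^sub>1 - t))\<close> in the energy inequality is dominated by \<open>T\<^sub>1\<^sup>2\<close> times minus its
  derivative, so that the work of the force is absorbed without Gronwall's inequality.
\<close>

lemma energy_bound:
  assumes P: "P > 0" and T: "T > 0" "T1 = T + 1" "T1 < T2" and \<mu>: "\<mu> \<ge> 0"
    and ws: "weak_solution_on P T2 \<mu> u0 f u p"
    and f: "Lq_Lp P T2 2 2 f" and u0: "Lp_per P 2 u0"
  shows "(LINT z:UNIV \<times> torus P|lborel. (norm (window T u z))\<^sup>2)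
     \<le> 4 * T1\<^sup>2 / flat 0 1 * ((LINT x:torus P|lborel. (norm (u0 x))\<^sup>2) / 2
         + T1\<^sup>2 * (LINT z:UNIV \<times> torus P|lborel. (norm (window T2 f z))\<^sup>2))"
proof -
  note D = weak_solution_onD[OF ws]
  have TT: "0 < T1" "T1 < T2" "T < T1" "T1 = T + 1" using T by auto
  have [measurable]: "window T2 u \<in> borel_measurable borel" "window T2 f \<in> borel_measurable borel"
    using Lq_Lp_window_measurable[OF D(3)] Lq_Lp_window_measurable[OF f] by simp_all
  \<comment> \<open>The second factor equals 1 from time -1 on and only makes the support compact.
    Differentiating the first adds two powers of \<open>1 / (T1 - t)\<close>, which is at least
    \<open>1 / T1\<close> on the interval.\<close>
  define \<psi> where "\<psi> = (\<lambda>t. flat 0 (-1 * t + T1) * step (1 * t + 2))"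
  have s\<psi>: "smooth \<psi>"
    unfolding \<psi>_def by (rule smooth_mult[OF smooth_affine_real[OF smooth_flat] smooth_affine_real[OF smooth_step]])
  have \<psi>0: "\<psi> t = 0" if "t \<ge> T1" for t using that by (simp add: \<psi>_def flat_def)
  have \<psi>pos: "\<psi> t = flat 0 (T1 - t)" if "t > -1" for t using that by (simp add: \<psi>_def step_1)
  have \<psi>nn: "\<psi> t \<ge> 0" for t unfolding \<psi>_def by (intro mult_nonneg_nonneg flat_nonneg step_range)
  have flat1: "flat 0 s \<le> 1" for s by (simp add: flat_def)
  have \<psi>1: "\<psi> t \<le> 1" for t
    unfolding \<psi>_def using flat_nonneg flat1 step_range by (intro mult_le_one) auto
  have test: "test_fun {..<T2} \<psi>"
    unfolding test_fun_def
  proof (intro conjI s\<psi> exI[of _ "{-2..T1}"] allI impI)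
    show "{-2..T1} \<subseteq> {..<T2}" using TT by auto
    fix t assume t: "t \<notin> {-2..T1}"
    show "\<psi> t = 0"
    proof (cases "t \<ge> T1")
      case False
      then have "1 * t + 2 \<le> 0" using t by auto
      then show ?thesis unfolding \<psi>_def by (simp only: step_0 mult_zero_right)
    qed (rule \<psi>0)
  qed (rule compact_Icc)
  have d\<psi>: "pd 1 \<psi> t = - flat 2 (T1 - t)" if "t > 0" for t
  proof -
    have "((\<lambda>t. flat 0 (T1 - t)) has_real_derivative - flat 2 (T1 - t)) (at t)"
    proof -
      have "((\<lambda>t. T1 - t) has_real_derivative -1) (at t)" by (auto intro!: derivative_eq_intros)
      from DERIV_chain2[where f="flat 0", OF flat_deriv[of 0 "T1 - t"] this] show ?thesis by (simp add: numeral_2_eq_2)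
    qed
    then have "(\<psi> has_real_derivative - flat 2 (T1 - t)) (at t)"
      by (rule has_field_derivative_transform_within_open[of _ _ _ "{-1<..}"]) (use that \<psi>pos in auto)
    from pd_real[OF this, of 1] show ?thesis by simp
  qed
  obtain B where B: "\<And>t. \<bar>\<psi> t\<bar> \<le> B" "\<And>t. \<bar>pd 1 \<psi> t\<bar> \<le> B" using test_fun_real_bounds[OF test] by blast
  note c\<psi> = smooth_continuous[OF s\<psi>] and c\<psi>' = smooth_continuous[OF smooth_pd[OF s\<psi>, of 1]]
  \<comment> \<open>The spatial factor of the test function is the partition of unity, whose
    periodization is the constant 1. Derivatives of that constant vanish, so the flux and Laplacian
    terms disappear after unfolding.\<close>
  have "periodic P (\<lambda>_::real^3. 1::real)" by (simp add: periodic_def)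
  from periodization_tile[OF P smooth_const this] have pz: "periodization P (tile P) (\<lambda>_. 1)" by simp
  have pd1: "pd v (\<lambda>_::real^3. c::real) = (\<lambda>_. 0)" for v c by (auto intro!: pd_eqI[where D="\<lambda>_. 0"])
  have pz1: "periodization P (pd v (tile P)) (\<lambda>_. 0)" for v using periodization_pd[OF pz, of v] by (simp add: pd1)
  have pz2: "periodization P (pd v (pd v (tile P))) (\<lambda>_. 0)" for v using periodization_pd[OF pz1, of v] by (simp add: pd1)
  define \<phi> where "\<phi> = (\<lambda>z. \<psi> (fst z) * tile P (snd z))"
  have \<phi>t: "test_fun (spacetime T2) \<phi>" unfolding \<phi>_def by (rule test_fun_separated[OF test pz])
  have \<phi>n: "\<phi> z \<ge> 0" for z unfolding \<phi>_def by (intro mult_nonneg_nonneg \<psi>nn tile_nonneg)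
  have dt: "pd (1, 0) \<phi> = (\<lambda>z. pd 1 \<psi> (fst z) * tile P (snd z))"
  proof -
    have "pd 0 (tile P) x = 0" for x
      using has_derivative_pd[OF smooth_differentiable[OF smooth_tile], of P x] linear_0 has_derivative_linear by metis
    then show ?thesis unfolding \<phi>_def pd_separated[OF s\<psi> smooth_tile] by simp
  qed
  have dx: "pd (0, v) \<phi> = (\<lambda>z. \<psi> (fst z) * pd v (tile P) (snd z))" for v
    unfolding \<phi>_def pd_separated[OF s\<psi> smooth_tile] by simp
  have dxx: "pd (0, v) (pd (0, v) \<phi>) = (\<lambda>z. \<psi> (fst z) * pd v (pd v (tile P)) (snd z))" for v
    unfolding dx pd_separated[OF s\<psi> smooth_pd[OF smooth_tile]] by simp
  define S where "S = (\<lambda>z. (norm (window T2 u z))\<^sup>2)"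
  define Q where "Q = (\<lambda>z. window T2 f z \<bullet> window T2 u z)"
  \<comment> \<open>The flux is windowed at \<open>T1\<close> and not at \<open>T2\<close>: its
    integrability is known on compact subsets of the strip below \<open>T2\<close>, while the weight
    vanishes from \<open>T1\<close> on.\<close>
  define Fx where "Fx j = (\<lambda>z. window T1 (energy_flux u p) z $ j)" for j
  have dS: "density P S" unfolding S_def using L2_sq_density[OF D(3)] by simp
  have dQ: "density P Q"
    unfolding Q_def
    by (rule density_bilinear[of P T2 f u "\<lambda>x y. x \<bullet> y"])
       (use f D(3) Cauchy_Schwarz_ineq2 in simp_all)
  have dF: "density P (Fx j)" for j
    unfolding density_def
  proof (intro conjI allI)
    have w2: "window T1 (energy_flux u p) z = indicator ({..<T1} \<times> UNIV) z *\<^sub>R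
        (((norm (window T2 u z))\<^sup>2 / 2 + window T2 p z) *\<^sub>R window T2 u z)" for z
      using TT by (auto simp: window_def energy_flux_def indicator_def mem_Times_iff)
    have [measurable]: "window T2 p \<in> borel_measurable borel"
      using pressure_density[OF ws] by (simp add: density_def)
    have [measurable]: "{..<T1} \<times> (UNIV :: (real^3) set) \<in> sets borel"
      by (intro borel_open open_Times) auto
    have wm: "window T1 (energy_flux u p) \<in> borel_measurable borel" unfolding w2[abs_def] by measurable
    show Fm: "Fx j \<in> borel_measurable borel"
      unfolding Fx_def by (rule measurable_compose[OF wm]) (intro borel_measurable_continuous_onI continuous_intros)
    show "periodic P (\<lambda>x. Fx j (t, x))" for t
      unfolding Fx_def w2
      using Lq_Lp_window_periodic[OF D(3), of t] pressure_density[OF ws]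
      by (simp add: periodic_def density_def indicator_def)
    obtain Du where Du: "energy_ineq T2 \<mu> u0 f u Du p" using D(5) by auto
    have K: "compact ({0..T1} \<times> torus P)" "{0..T1} \<times> torus P \<subseteq> spacetime T2"
      using TT by (auto simp: torus_def intro!: compact_Times)
    have i1: "set_integrable lborel (({0..T1} \<times> torus P) \<inter> ({0<..} \<times> UNIV)) (\<lambda>(t, x). energy_flux u p t x)"
      using Du K unfolding energy_ineq_def by (elim conjE) simp
    have "set_integrable lborel ({0<..<T1} \<times> torus P) (\<lambda>(t, x). energy_flux u p t x)"
    proof (rule set_integrable_subset[OF i1])
      show "{0<..<T1} \<times> torus P \<in> sets lborel"
        unfolding lborel_prod[symmetric] by (intro pair_measureI) auto
    qed auto
    then have "integrable lborel (\<lambda>z. (indicator ({0<..<T1} \<times> torus P) z *\<^sub>R (case z of (t, x) \<Rightarrow> energy_flux u p t x)) $ j)"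
      unfolding set_integrable_def by (rule integrable_bounded_linear[OF bounded_linear_vec_nth])
    also have "(\<lambda>z. (indicator ({0<..<T1} \<times> torus P) z *\<^sub>R (case z of (t, x) \<Rightarrow> energy_flux u p t x)) $ j)
        = (\<lambda>z. indicator (UNIV \<times> torus P) z *\<^sub>R Fx j z)"
      by (auto simp: Fx_def window_def indicator_def fun_eq_iff)
    finally show "set_integrable lborel (UNIV \<times> torus P) (Fx j)" by (simp add: set_integrable_def)
  qed
  obtain Du where Du: "energy_ineq T2 \<mu> u0 f u Du p" using D(5) by auto
  note US = density_unfold[OF P dS pz c\<psi>' B(2)]
  note UL = density_unfold[OF P dS pz2 c\<psi> B(1)]
  note UF = density_unfold[OF P dF pz1 c\<psi> B(1)]
  note UQ = density_unfold[OF P dQ pz c\<psi> B(1)]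
  have E1: "(LINT (t, x):{0<..<T2} \<times> UNIV|lborel. (norm (u t x))\<^sup>2 / 2 * d_t \<phi> (t, x))
      = (LINT z:UNIV \<times> torus P|lborel. S z * (pd 1 \<psi> (fst z) * 1)) / 2"
  proof -
    have "indicator ({0<..<T2} \<times> UNIV) z *\<^sub>R (case z of (t, x) \<Rightarrow> (norm (u t x))\<^sup>2 / 2 * d_t \<phi> (t, x))
        = (S z * (pd 1 \<psi> (fst z) * tile P (snd z))) / 2" for z
      by (cases z) (auto simp: S_def window_def dt indicator_def)
    then show ?thesis
      by (simp only: set_lebesgue_integral_def[of lborel "{0<..<T2} \<times> UNIV"] integral_divide_zero US(5))
  qed
  have E3: "(LINT (t, x):{0<..<T2} \<times> UNIV|lborel. \<Sum>j\<in>UNIV. energy_flux u p t x $ j * d_x j \<phi> (t, x)) = 0"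
  proof -
    have "indicator ({0<..<T2} \<times> UNIV) z *\<^sub>R (case z of (t, x) \<Rightarrow> \<Sum>j\<in>UNIV. energy_flux u p t x $ j * d_x j \<phi> (t, x))
        = (\<Sum>j\<in>UNIV. Fx j z * (\<psi> (fst z) * pd (axis j 1) (tile P) (snd z)))" for z
      using \<psi>0[of "fst z"] TT by (cases z) (auto simp: Fx_def window_def dx indicator_def not_less)
    then show ?thesis
      by (simp only: set_lebesgue_integral_def[of lborel "{0<..<T2} \<times> UNIV"] Bochner_Integration.integral_sum[OF UF(1)] UF(5))
        (simp add: set_lebesgue_integral_def)
  qed
  have E5: "(LINT (t, x):{0<..<T2} \<times> UNIV|lborel. (norm (u t x))\<^sup>2 / 2 * laplace_x \<phi> (t, x)) = 0"
  proof -
    have "indicator ({0<..<T2} \<times> UNIV) z *\<^sub>R (case z of (t, x) \<Rightarrow> (norm (u t x))\<^sup>2 / 2 * laplace_x \<phi> (t, x))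
        = (\<Sum>j\<in>UNIV. (S z * (\<psi> (fst z) * pd (axis j 1) (pd (axis j 1) (tile P)) (snd z))) / 2)" for z
      by (cases z) (auto simp: S_def window_def laplace_x_def dxx indicator_def sum_distrib_left)
    then show ?thesis
      by (simp only: set_lebesgue_integral_def[of lborel "{0<..<T2} \<times> UNIV"] integral_divide_zero
          Bochner_Integration.integral_sum[OF integrable_divide_zero[OF UL(1)]] UL(5))
        (simp add: set_lebesgue_integral_def)
  qed
  have E6: "(LINT (t, x):{0<..<T2} \<times> UNIV|lborel. (f t x \<bullet> u t x) * \<phi> (t, x))
      = (LINT z:UNIV \<times> torus P|lborel. Q z * (\<psi> (fst z) * 1))"
  proof -
    have "indicator ({0<..<T2} \<times> UNIV) z *\<^sub>R (case z of (t, x) \<Rightarrow> (f t x \<bullet> u t x) * \<phi> (t, x))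
        = Q z * (\<psi> (fst z) * tile P (snd z))" for z
      by (cases z) (auto simp: Q_def window_def \<phi>_def indicator_def)
    then show ?thesis
      by (simp only: set_lebesgue_integral_def[of lborel "{0<..<T2} \<times> UNIV"] UQ(5))
  qed
  define Y0 where "Y0 = (LINT x:torus P|lborel. (norm (u0 x))\<^sup>2)"
  have E2: "(LINT x|lborel. (norm (u0 x))\<^sup>2 / 2 * \<phi> (0, x)) = \<psi> 0 * Y0 / 2"
  proof -
    have "(\<lambda>x. (norm (u0 x))\<^sup>2) \<in> borel_measurable borel" "periodic P (\<lambda>x. (norm (u0 x))\<^sup>2)"
      "set_integrable lborel (torus P) (\<lambda>x. (norm (u0 x))\<^sup>2)"
      using u0 by (auto simp: Lp_per_def periodic_def)
    from unfold_space(2)[OF P this pz] have "(LINT x|lborel. (norm (u0 x))\<^sup>2 * tile P x) = Y0" by (simp add: Y0_def)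
    moreover have "(norm (u0 x))\<^sup>2 / 2 * \<phi> (0, x) = \<psi> 0 / 2 * ((norm (u0 x))\<^sup>2 * tile P x)" for x by (simp add: \<phi>_def)
    ultimately show ?thesis by (simp only: integral_mult_right_zero)
  qed
  \<comment> \<open>The dissipation has the favourable sign and is discarded. Together with the
    vanishing Laplacian term this frees the bound from \<open>\<mu>\<close>.\<close>
  have E4: "(LINT (t, x):{0<..<T2} \<times> UNIV|lborel. (norm (Du t x))\<^sup>2 * \<phi> (t, x)) \<ge> 0"
    unfolding set_lebesgue_integral_def using \<phi>n by (intro integral_nonneg_AE AE_I2) (auto split: prod.split)
  have "- (LINT (t, x):{0<..<T2} \<times> UNIV|lborel. (norm (u t x))\<^sup>2 / 2 * d_t \<phi> (t, x))
        - (LINT x|lborel. (norm (u0 x))\<^sup>2 / 2 * \<phi> (0, x))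
        - (LINT (t, x):{0<..<T2} \<times> UNIV|lborel.
             \<Sum>j\<in>UNIV. energy_flux u p t x $ j * d_x j \<phi> (t, x))
        + \<mu> * (LINT (t, x):{0<..<T2} \<times> UNIV|lborel. (norm (Du t x))\<^sup>2 * \<phi> (t, x))
        - \<mu> * (LINT (t, x):{0<..<T2} \<times> UNIV|lborel. (norm (u t x))\<^sup>2 / 2 * laplace_x \<phi> (t, x))
        \<le> (LINT (t, x):{0<..<T2} \<times> UNIV|lborel. (f t x \<bullet> u t x) * \<phi> (t, x))"
    using Du \<phi>t \<phi>n unfolding energy_ineq_def by (elim conjE) (simp del: split_paired_All)
  then have E: "- (LINT z:UNIV \<times> torus P|lborel. S z * (pd 1 \<psi> (fst z) * 1)) / 2 - \<psi> 0 * Y0 / 2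
      \<le> (LINT z:UNIV \<times> torus P|lborel. Q z * (\<psi> (fst z) * 1))"
    unfolding E1 E2 E3 E5 E6 using mult_nonneg_nonneg[OF \<mu> E4] by simp
  \<comment> \<open>\<open>flat 0 1\<close> is a lower bound for the weight at times in
    \<open>(0, T)\<close>, where \<open>T1 - t\<close> is at least 1; the denominator is what the
    Young splitting below leaves.\<close>
  define c where "c = flat 0 1 / (4 * T1\<^sup>2)"
  have f1: "flat 0 1 > 0" by (simp add: flat_pos)
  have iF: "set_integrable lborel (UNIV \<times> torus P) (\<lambda>z. (norm (window T2 f z))\<^sup>2)"
    using L2_sq_density[OF f] by (simp add: density_def)
  have iu: "set_integrable lborel (UNIV \<times> torus P) (\<lambda>z. (norm (window T u z))\<^sup>2)"
  proof -
    have "Lq_Lp P T2 2 2 u" using D(3) by simp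
    have "{..<T} \<times> (UNIV :: (real^3) set) \<in> sets lborel" by (simp add: open_Times)
    then have "indicat_real ({..<T} \<times> (UNIV :: (real^3) set)) \<in> borel_measurable lborel"
      by (rule borel_measurable_indicator)
    moreover have "integrable lborel (\<lambda>z. indicator (UNIV \<times> torus P) z *\<^sub>R S z)"
      using dS by (simp add: density_def set_integrable_def)
    ultimately have "integrable lborel (\<lambda>z. (indicator (UNIV \<times> torus P) z *\<^sub>R S z) * indicator ({..<T} \<times> UNIV) z)"
      by (intro integrable_bounded_mult[where B=1]) (simp_all only: abs_indicator indicator_le_1)
    also have "(\<lambda>z. (indicator (UNIV \<times> torus P) z *\<^sub>R S z) * indicator ({..<T} \<times> UNIV) z)
        = (\<lambda>z. indicator (UNIV \<times> torus P) z *\<^sub>R (norm (window T u z))\<^sup>2)"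
      using TT by (auto simp: S_def window_def indicator_def mem_Times_iff fun_eq_iff)
    finally show ?thesis by (simp add: set_integrable_def)
  qed
  have pt: "c * (norm (window T u z))\<^sup>2
      \<le> - (S z * (pd 1 \<psi> (fst z) * 1)) / 2 - Q z * (\<psi> (fst z) * 1) + T1\<^sup>2 * (norm (window T2 f z))\<^sup>2" for z
  proof (cases "0 < fst z \<and> fst z < T1")
    case True
    define t where "t = fst z"
    have t: "0 < t" "t < T1" using True by (auto simp: t_def)
    define a where "a = norm (window T2 u z)"
    define b where "b = norm (window T2 f z)"
    have ab: "a \<ge> 0" "b \<ge> 0" by (auto simp: a_def b_def)
    have Q1: "Q z \<le> b * a" unfolding Q_def a_def b_def by (rule norm_cauchy_schwarz)
    \<comment> \<open>The parameter is chosen so that the work of the force uses up half of the gain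
      \<open>\<psi> t * a\<^sup>2 / (2 * T1\<^sup>2)\<close> that the derivative of the weight
      provides.\<close>
    have young: "b * a \<le> a\<^sup>2 / (4 * T1\<^sup>2) + T1\<^sup>2 * b\<^sup>2"
      using sum_squares_bound[of "a / (2 * T1)" "T1 * b"] TT(1) by (simp add: power_mult_distrib power_divide mult.commute)
    have fl: "flat 0 (T1 - t) / T1\<^sup>2 \<le> flat 2 (T1 - t)"
    proof -
      have "(T1 - t)\<^sup>2 \<le> T1\<^sup>2" using t by (intro power_mono) auto
      then show ?thesis using t by (simp add: flat_def divide_left_mono)
    qed
    have p0: "\<psi> t = flat 0 (T1 - t)" "pd 1 \<psi> t = - flat 2 (T1 - t)" using t by (auto simp: \<psi>pos d\<psi>)
    have "c * (norm (window T u z))\<^sup>2 \<le> \<psi> t * a\<^sup>2 / (4 * T1\<^sup>2)"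
    proof (cases "t < T")
      case True
      then have "flat 0 1 \<le> \<psi> t" unfolding p0 using TT by (intro flat0_mono) auto
      moreover have "window T u z = window T2 u z" using True t TT by (simp add: window_def t_def)
      ultimately show ?thesis
        unfolding c_def a_def by (simp add: divide_right_mono mult_right_mono)
    next
      case False
      then have "window T u z = 0" by (auto simp: window_def t_def)
      then show ?thesis using \<psi>nn[of t] by simp
    qed
    also have "\<dots> = a\<^sup>2 * (\<psi> t / T1\<^sup>2) / 2 - \<psi> t * (a\<^sup>2 / (4 * T1\<^sup>2))" by (simp add: field_simps)
    also have "\<dots> \<le> a\<^sup>2 * flat 2 (T1 - t) / 2 - \<psi> t * (b * a - T1\<^sup>2 * b\<^sup>2)"
    proof -
      have "a\<^sup>2 * (\<psi> t / T1\<^sup>2) \<le> a\<^sup>2 * flat 2 (T1 - t)" unfolding p0 by (intro mult_left_mono fl) auto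
      moreover have "\<psi> t * (b * a - T1\<^sup>2 * b\<^sup>2) \<le> \<psi> t * (a\<^sup>2 / (4 * T1\<^sup>2))"
        using young by (intro mult_left_mono \<psi>nn) auto
      ultimately show ?thesis by (intro diff_mono divide_right_mono) auto
    qed
    also have "\<dots> = - (S z * pd 1 \<psi> t) / 2 - \<psi> t * (b * a) + \<psi> t * (T1\<^sup>2 * b\<^sup>2)"
      by (simp add: p0(2) S_def a_def right_diff_distrib)
    also have "\<dots> \<le> - (S z * pd 1 \<psi> t) / 2 - \<psi> t * Q z + 1 * (T1\<^sup>2 * b\<^sup>2)"
      using mult_left_mono[OF Q1 \<psi>nn[of t]] mult_right_mono[OF \<psi>1[of t], of "T1\<^sup>2 * b\<^sup>2"] by auto
    finally show ?thesis by (simp add: t_def b_def mult.commute)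
  next
    case False
    then have 0: "window T u z = 0" using TT by (auto simp: window_def)
    have *: "S z * pd 1 \<psi> (fst z) = 0 \<and> Q z * \<psi> (fst z) = 0"
    proof (cases "fst z \<le> 0")
      case True
      then show ?thesis by (auto simp: S_def Q_def window_def)
    next
      case g: False
      then have "fst z \<ge> T1" using False by auto
      then have "pd 1 \<psi> (fst z) = 0" "\<psi> (fst z) = 0" using g d\<psi>[of "fst z"] \<psi>0 by (auto simp: flat_def)
      then show ?thesis by simp
    qed
    show ?thesis by (simp only: mult_1_right *[THEN conjunct1] *[THEN conjunct2] 0) simp
  qed
  have half: "(- 1 / 2) * X = - X / 2" for X :: real by simp
  have iL: "set_integrable lborel (UNIV \<times> torus P) (\<lambda>z. c * (norm (window T u z))\<^sup>2)"
    using iu by (intro set_integrable_mult_right)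
  have iR: "set_integrable lborel (UNIV \<times> torus P) (\<lambda>z. (- 1 / 2) * (S z * (pd 1 \<psi> (fst z) * 1)) - Q z * (\<psi> (fst z) * 1) + T1\<^sup>2 * (norm (window T2 f z))\<^sup>2)"
    by (rule set_integral_add(1)[OF set_integral_diff(1)[OF set_integrable_mult_right[OF US(4)] UQ(4)] set_integrable_mult_right[OF iF]])
  have "c * (LINT z:UNIV \<times> torus P|lborel. (norm (window T u z))\<^sup>2)
      = (LINT z:UNIV \<times> torus P|lborel. c * (norm (window T u z))\<^sup>2)"
    by simp
  also have "\<dots> \<le> (LINT z:UNIV \<times> torus P|lborel. (- 1 / 2) * (S z * (pd 1 \<psi> (fst z) * 1)) - Q z * (\<psi> (fst z) * 1) + T1\<^sup>2 * (norm (window T2 f z))\<^sup>2)"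
    by (rule set_integral_mono[OF iL iR]) (simp only: half pt)
  also have "\<dots> = (LINT z:UNIV \<times> torus P|lborel. (- 1 / 2) * (S z * (pd 1 \<psi> (fst z) * 1)) - Q z * (\<psi> (fst z) * 1))
      + (LINT z:UNIV \<times> torus P|lborel. T1\<^sup>2 * (norm (window T2 f z))\<^sup>2)"
    by (rule set_integral_add(2)) (intro set_integral_diff set_integrable_mult_right US(4) UQ(4) iF)+
  also have "(LINT z:UNIV \<times> torus P|lborel. (- 1 / 2) * (S z * (pd 1 \<psi> (fst z) * 1)) - Q z * (\<psi> (fst z) * 1))
      = (LINT z:UNIV \<times> torus P|lborel. (- 1 / 2) * (S z * (pd 1 \<psi> (fst z) * 1))) - (LINT z:UNIV \<times> torus P|lborel. Q z * (\<psi> (fst z) * 1))"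
    by (rule set_integral_diff(2)) (intro set_integrable_mult_right US(4) UQ(4))+
  also have "(LINT z:UNIV \<times> torus P|lborel. (- 1 / 2) * (S z * (pd 1 \<psi> (fst z) * 1)))
      = (- 1 / 2) * (LINT z:UNIV \<times> torus P|lborel. S z * (pd 1 \<psi> (fst z) * 1))"
    by (rule set_integral_mult_right)
  also have "(LINT z:UNIV \<times> torus P|lborel. T1\<^sup>2 * (norm (window T2 f z))\<^sup>2)
      = T1\<^sup>2 * (LINT z:UNIV \<times> torus P|lborel. (norm (window T2 f z))\<^sup>2)"
    by (rule set_integral_mult_right)
  finally have "c * (LINT z:UNIV \<times> torus P|lborel. (norm (window T u z))\<^sup>2)
      \<le> \<psi> 0 * Y0 / 2 + T1\<^sup>2 * (LINT z:UNIV \<times> torus P|lborel. (norm (window T2 f z))\<^sup>2)"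
    using E by linarith
  also have "\<psi> 0 * Y0 / 2 \<le> Y0 / 2"
  proof -
    have "Y0 \<ge> 0" unfolding Y0_def set_lebesgue_integral_def by (intro integral_nonneg_AE) auto
    then show ?thesis using \<psi>1[of 0] mult_right_mono[of "\<psi> 0" 1 Y0] by simp
  qed
  finally have "(LINT z:UNIV \<times> torus P|lborel. (norm (window T u z))\<^sup>2)
      \<le> (Y0 / 2 + T1\<^sup>2 * (LINT z:UNIV \<times> torus P|lborel. (norm (window T2 f z))\<^sup>2)) / c"
    using f1 TT(1) by (subst pos_le_divide_eq) (simp_all add: c_def mult.commute)
  moreover have "X / c = 4 * T1\<^sup>2 / flat 0 1 * X" for X by (simp add: c_def)
  ultimately show ?thesis by (simp only: Y0_def)
qed

section \<open>Time shifts of the Fourier modes\<close>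

lemma smooth_sin_cos: "smooth (sin :: real \<Rightarrow> real)" "smooth (cos :: real \<Rightarrow> real)"
proof -
  have "Ck n (sin :: real \<Rightarrow> real) \<and> Ck n (cos :: real \<Rightarrow> real)" for n
  proof (induction n)
    case 0
    show ?case by (auto intro: continuous_intros)
  next
    case (Suc n)
    have s: "(sin has_real_derivative cos x) (at x)" "(cos has_real_derivative - sin x) (at x)" for x :: real
      by (auto intro: DERIV_sin DERIV_cos)
    show ?case
      using Suc Ck_Suc_real[OF s(1), of n] Ck_Suc_real[OF s(2), of n] Ck_uminus[of n sin] by blast
  qed
  then show "smooth (sin :: real \<Rightarrow> real)" "smooth (cos :: real \<Rightarrow> real)" by (simp_all add: smooth_def)
qed

lemma wave_function:
  fixes F F' :: "real \<Rightarrow> real"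
  assumes "smooth F" "\<And>y. (F has_real_derivative F' y) (at y)"
  shows "smooth (\<lambda>x. F (k \<bullet> x))" "pd v (\<lambda>x::real^3. F (k \<bullet> x)) = (\<lambda>x. (k \<bullet> v) * F' (k \<bullet> x))"
proof -
  have b: "bounded_linear (\<lambda>x. k \<bullet> x)" by (rule bounded_linear_inner_right)
  show "smooth (\<lambda>x. F (k \<bullet> x))" by (rule smooth_compose_linear0[OF b assms(1)])
  show "pd v (\<lambda>x::real^3. F (k \<bullet> x)) = (\<lambda>x. (k \<bullet> v) * F' (k \<bullet> x))"
  proof
    fix x
    show "pd v (\<lambda>x. F (k \<bullet> x)) x = (k \<bullet> v) * F' (k \<bullet> x)"
      using pd_compose_linear[OF b, of F x 0 v] smooth_differentiable[OF assms(1)] pd_real[OF assms(2), of "k \<bullet> v" "k \<bullet> x"]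
      by simp
  qed
qed

text \<open>\<open>\<tau>\<close> and \<open>\<sigma>\<close> stand for \<open>cos (k \<bullet> x)\<close> and \<open>sin (k \<bullet> x)\<close>, in either order.\<close>

lemma mode_shift:
  fixes k :: "real^3"
  assumes P: "P > 0" and T: "0 < h" "T < H"
    and ws: "weak_solution_on P H \<mu> u0 f u p" and \<mu>: "\<mu> \<ge> 0"
    and f: "Lq_Lp P H 2 2 f" and u0: "Lp_per P 2 u0"
    and \<tau>: "smooth \<tau>" "periodic P \<tau>" "\<And>x. \<bar>\<tau> x\<bar> \<le> 1"
    and \<sigma>: "smooth \<sigma>" "periodic P \<sigma>" "\<And>x. \<bar>\<sigma> x\<bar> \<le> 1"
    and e: "e * e = 1"
    and d\<tau>: "\<And>j. pd (axis j 1) \<tau> = (\<lambda>x. e * k $ j * \<sigma> x)"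
    and d\<sigma>: "\<And>j. pd (axis j 1) \<sigma> = (\<lambda>x. - e * k $ j * \<tau> x)"
    and A: "(LINT x:torus P|lborel. 1 + (norm (u0 x))\<^sup>2)
        + 3 * (LINT z:UNIV \<times> torus P|lborel. (norm (window H u z))\<^sup>2)
        + (LINT z:UNIV \<times> torus P|lborel. norm (window H f z)) \<le> A"
  shows "(\<integral>\<^sup>+t\<in>{0..T - h}. ennreal (((LINT x:torus P|lborel. u (t + h) x $ j * \<tau> x)
        - (LINT x:torus P|lborel. u t x $ j * \<tau> x))\<^sup>2) \<partial>lborel) \<le> ennreal (4 * (A * (1 + norm k))\<^sup>2 * h)"
proof -
  note D = weak_solution_onD[OF ws]
  \<comment> \<open>The projection of the \<open>j\<close>-th basis vector onto the plane orthogonal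
    to \<open>k\<close>. For \<open>k = 0\<close> the quotient is 0 by convention and
    \<open>a\<close> is the basis vector itself, so the mean needs no separate treatment.\<close>
  define a where "a = axis j 1 - (k $ j / (norm k)\<^sup>2) *\<^sub>R k"
  have kk: "k \<bullet> k = (norm k)\<^sup>2" by (simp add: power2_norm_eq_inner)
  have ka: "k \<bullet> a = 0"
    by (cases "k = 0") (simp_all add: a_def inner_diff_right inner_axis kk)
  have na: "norm a \<le> 1"
  proof -
    have "a \<bullet> a = a \<bullet> axis j 1 - (k $ j / (norm k)\<^sup>2) * (k \<bullet> a)"
      by (subst (2) a_def) (simp add: inner_diff_right inner_commute)
    also have "\<dots> = 1 - (k $ j)\<^sup>2 / (norm k)\<^sup>2"
      by (simp add: ka) (simp add: a_def inner_diff_left inner_axis_axis inner_axis power2_eq_square)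
    also have "\<dots> \<le> 1" by simp
    finally have "(norm a)\<^sup>2 \<le> 1\<^sup>2" by (simp add: power2_norm_eq_inner)
    then show ?thesis by (rule power2_le_imp_le) simp
  qed
  have ut: "Lp_per P 2 (u t)" if "t \<in> {0..H}" for t using D(4) that unfolding C_L2w_def by blast
  have \<tau>m: "\<tau> \<in> borel_measurable borel" by (rule smooth_borel_measurable[OF \<tau>(1)])
  define c where "c i t = (LINT x:torus P|lborel. u t x $ i * \<tau> x)" for i t
  define w where "w t = (LINT x:torus P|lborel. (u t x \<bullet> a) * \<tau> x)" for t
  have ci: "set_integrable lborel (torus P) (\<lambda>x. u t x $ i * \<tau> x)" if "t \<in> {0..H}" for i t
    by (rule Lp_per_component_integrable[OF ut[OF that] \<tau>m \<tau>(3)])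
  have wc: "w t = c j t" if t: "0 < t" "t < H" for t
  proof -
    have tt: "t \<in> {0..H}" using t by auto
    \<comment> \<open>Incompressibility is tested with the conjugate wave \<open>\<sigma>\<close>,
      because its gradient is a multiple of \<open>\<tau>\<close>. The coefficients against
      \<open>\<tau>\<close> are thus orthogonal to \<open>k\<close>, and pairing with
      \<open>a\<close> gives the same number as taking the \<open>j\<close>-th component.\<close>
    have "(\<Sum>i\<in>UNIV. (LINT x:torus P|lborel. u t x $ i * (- e * k $ i * \<tau> x))) = 0"
      using divergence_slice[OF P ws \<sigma>(1,2) t] unfolding d\<sigma> .
    moreover have "(LINT x:torus P|lborel. u t x $ i * (- e * k $ i * \<tau> x)) = - e * (k $ i * c i t)" for i
    proof -
      have "(LINT x:torus P|lborel. u t x $ i * (- e * k $ i * \<tau> x)) = (LINT x:torus P|lborel. (- e * k $ i) * (u t x $ i * \<tau> x))"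
        by (simp add: mult_ac)
      also have "\<dots> = (- e * k $ i) * c i t" unfolding c_def by (rule set_integral_mult_right)
      finally show ?thesis by simp
    qed
    ultimately have "- e * (\<Sum>i\<in>UNIV. k $ i * c i t) = 0" by (simp only: sum_distrib_left)
    then have div: "(\<Sum>i\<in>UNIV. k $ i * c i t) = 0" using e by auto
    have "w t = (LINT x:torus P|lborel. (\<Sum>i\<in>UNIV. a $ i * (u t x $ i * \<tau> x)))"
      by (simp add: w_def inner_vec_def sum_distrib_left sum_distrib_right mult_ac)
    also have "\<dots> = (\<Sum>i\<in>UNIV. a $ i * c i t)"
      by (subst set_integral_finite_sum(1)) (auto intro!: ci[OF tt] simp: c_def)
    also have "\<dots> = (\<Sum>i\<in>UNIV. axis j 1 $ i * c i t) - (k $ j / (norm k)\<^sup>2) * (\<Sum>i\<in>UNIV. k $ i * c i t)"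
      by (simp add: a_def left_diff_distrib sum_subtractf sum_distrib_left mult.assoc)
    also have "\<dots> = c j t" by (simp add: div axis_def if_distrib[of "\<lambda>x. x * _"] cong: if_cong)
    finally show ?thesis .
  qed
  have wcont: "continuous_on {0..H} w"
  proof -
    have "continuous_on UNIV (\<lambda>x. \<tau> x *\<^sub>R a)" by (intro continuous_intros smooth_continuous[OF \<tau>(1)])
    then have m: "(\<lambda>x. \<tau> x *\<^sub>R a) \<in> borel_measurable borel" by (rule borel_measurable_continuous_onI)
    have "\<bar>norm (\<tau> x *\<^sub>R a) powr 2\<bar> \<le> 1" for x
    proof -
      have "norm (\<tau> x *\<^sub>R a) \<le> 1" using \<tau>(3)[of x] na by (simp add: mult_le_one)
      then show ?thesis by (simp add: abs_square_le_1)
    qed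
    then have "set_integrable lborel (torus P) (\<lambda>x. norm (\<tau> x *\<^sub>R a) powr 2)"
      using \<tau>m by (intro torus_integrable_bounded[of _ 1]) auto
    then have "Lp_per P 2 (\<lambda>x. \<tau> x *\<^sub>R a)" using m \<tau>(2) by (simp add: Lp_per_def periodic_def)
    then have "continuous_on {0..H} (\<lambda>t. LINT x:torus P|lborel. u t x \<bullet> (\<tau> x *\<^sub>R a))"
      using D(4) unfolding C_L2w_def by blast
    then show ?thesis by (simp add: w_def[abs_def] mult.commute)
  qed
  have orth: "(\<Sum>i\<in>UNIV. a $ i * pd (axis i 1) \<tau> x) = 0" for x
  proof -
    have "(\<Sum>i\<in>UNIV. a $ i * pd (axis i 1) \<tau> x) = e * \<sigma> x * (k \<bullet> a)"
      by (simp add: d\<tau> inner_vec_def sum_distrib_left mult_ac)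
    then show ?thesis by (simp add: ka)
  qed
  have lap: "(\<Sum>i\<in>UNIV. pd (axis i 1) (pd (axis i 1) \<tau>) x) = - (norm k)\<^sup>2 * \<tau> x" for x
  proof -
    have "pd (axis i 1) (pd (axis i 1) \<tau>) x = - (k $ i * k $ i * \<tau> x)" for i
    proof -
      have "pd (axis i 1) (\<lambda>x. (e * k $ i) * \<sigma> x) x = (e * k $ i) * pd (axis i 1) \<sigma> x"
        by (rule pd_bounded_linear[OF bounded_linear_mult_right smooth_differentiable[OF \<sigma>(1)]])
      also have "\<dots> = - ((e * e) * (k $ i * k $ i * \<tau> x))" by (simp add: d\<sigma> mult_ac)
      finally show ?thesis by (simp add: d\<tau> e)
    qed
    then have "(\<Sum>i\<in>UNIV. pd (axis i 1) (pd (axis i 1) \<tau>) x) = - (\<Sum>i\<in>UNIV. k $ i * k $ i * \<tau> x)"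
      by (simp add: sum_negf)
    also have "\<dots> = - ((k \<bullet> k) * \<tau> x)" by (simp add: inner_vec_def sum_distrib_right)
    finally show ?thesis by (simp add: kk)
  qed
  have d\<tau>b: "\<bar>pd (axis i 1) \<tau> x\<bar> \<le> norm k" for i x
  proof -
    have "\<bar>e\<bar> = 1" using e by (metis abs_mult_self_eq abs_one abs_mult mult_cancel_left1 abs_ge_zero abs_square_eq_1 power2_eq_square)
    then have "\<bar>pd (axis i 1) \<tau> x\<bar> = \<bar>k $ i\<bar> * \<bar>\<sigma> x\<bar>" by (simp add: d\<tau> abs_mult)
    also have "\<dots> \<le> norm k * 1" by (intro mult_mono component_le_norm_cart \<sigma>(3)) auto
    finally show ?thesis by simp
  qed
  obtain g where gi: "set_integrable lborel {0<..<H} g"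
    and gb: "(LINT t:{0<..<H}|lborel. \<bar>g t\<bar>) \<le> 3 * norm k * (LINT z:UNIV \<times> torus P|lborel. (norm (window H u z))\<^sup>2)
          + (LINT z:UNIV \<times> torus P|lborel. norm (window H f z))"
    and weak: "\<And>\<psi>. test_fun {..<H} \<psi> \<Longrightarrow>
      (LINT t:{0<..<H}|lborel. pd 1 \<psi> t * w t)
      + (LINT t:{0<..<H}|lborel. \<psi> t * (g t - \<mu> * (norm k)\<^sup>2 * w t))
      + \<psi> 0 * (LINT x:torus P|lborel. (u0 x \<bullet> a) * \<tau> x) = 0"
    by (rule momentum_separated[OF P ws f u0 \<tau>(1,2) orth lap na \<tau>(3) d\<tau>b, folded w_def]) blast
  define BU where "BU = (LINT z:UNIV \<times> torus P|lborel. (norm (window H u z))\<^sup>2)"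
  define BF where "BF = (LINT z:UNIV \<times> torus P|lborel. norm (window H f z))"
  define B0 where "B0 = (LINT x:torus P|lborel. 1 + (norm (u0 x))\<^sup>2)"
  have nn: "BU \<ge> 0" "BF \<ge> 0" "B0 \<ge> 0"
    unfolding BU_def BF_def B0_def set_lebesgue_integral_def by (auto intro!: integral_nonneg_AE)
  have w0b: "\<bar>LINT x:torus P|lborel. (u0 x \<bullet> a) * \<tau> x\<bar> \<le> B0"
  proof -
    have um: "u0 \<in> borel_measurable borel" and ui: "set_integrable lborel (torus P) (\<lambda>x. (norm (u0 x))\<^sup>2)"
      using u0 by (auto simp: Lp_per_def)
    have i1: "set_integrable lborel (torus P) (\<lambda>x. 1 + (norm (u0 x))\<^sup>2)"
      by (intro set_integral_add(1) ui torus_integrable_bounded[of _ 1]) auto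
    have pt: "\<bar>(u0 x \<bullet> a) * \<tau> x\<bar> \<le> 1 + (norm (u0 x))\<^sup>2" for x
    proof -
      have "\<bar>u0 x \<bullet> a\<bar> \<le> norm (u0 x) * norm a" by (rule Cauchy_Schwarz_ineq2)
      also have "\<dots> \<le> norm (u0 x) * 1" using na by (intro mult_left_mono) auto
      finally have "\<bar>(u0 x \<bullet> a) * \<tau> x\<bar> \<le> norm (u0 x) * 1"
        unfolding abs_mult by (intro mult_mono \<tau>(3)) auto
      moreover have "2 * norm (u0 x) \<le> 1 + (norm (u0 x))\<^sup>2" using sum_squares_bound[of 1 "norm (u0 x)"] by simp
      ultimately show ?thesis using norm_ge_zero[of "u0 x"] by linarith
    qed
    have i2: "set_integrable lborel (torus P) (\<lambda>x. (u0 x \<bullet> a) * \<tau> x)"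
    proof (rule set_integrable_bound[OF i1])
      show "set_borel_measurable lborel (torus P) (\<lambda>x. (u0 x \<bullet> a) * \<tau> x)"
        unfolding set_borel_measurable_def using um \<tau>m by measurable
      show "AE x in lborel. x \<in> torus P \<longrightarrow> norm ((u0 x \<bullet> a) * \<tau> x) \<le> norm (1 + (norm (u0 x))\<^sup>2)"
        using order_trans[OF pt abs_ge_self] by (intro AE_I2 impI) (simp only: real_norm_def)
    qed
    have "\<bar>LINT x:torus P|lborel. (u0 x \<bullet> a) * \<tau> x\<bar> \<le> (LINT x:torus P|lborel. \<bar>(u0 x \<bullet> a) * \<tau> x\<bar>)"
      using set_integral_norm_bound[OF i2] by simp
    also have "\<dots> \<le> B0"
      unfolding B0_def by (rule set_integral_mono[OF set_integrable_abs[OF i2] i1 pt])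
    finally show ?thesis .
  qed
  \<comment> \<open>Only convection carries a factor \<open>norm k\<close>; the cruder common factor
    \<open>1 + norm k\<close> allows one constant \<open>A\<close> for all modes.\<close>
  have Ab: "\<bar>LINT x:torus P|lborel. (u0 x \<bullet> a) * \<tau> x\<bar> + (LINT t:{0<..<H}|lborel. \<bar>g t\<bar>) \<le> A * (1 + norm k)"
  proof -
    have "B0 + 3 * BU + BF \<le> A" using A by (simp add: B0_def BU_def BF_def)
    then have "(B0 + 3 * BU + BF) * (1 + norm k) \<le> A * (1 + norm k)" by (intro mult_right_mono) auto
    moreover have "B0 + (3 * norm k * BU + BF) \<le> (B0 + 3 * BU + BF) * (1 + norm k)"
      using nn mult_nonneg_nonneg[OF nn(3) norm_ge_zero[of k]] mult_nonneg_nonneg[OF nn(2) norm_ge_zero[of k]]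
      by (simp add: algebra_simps)
    ultimately show ?thesis using w0b gb unfolding BU_def BF_def by linarith
  qed
  have "(\<integral>\<^sup>+t\<in>{0..T - h}. ennreal ((c j (t + h) - c j t)\<^sup>2) \<partial>lborel)
      = (\<integral>\<^sup>+t\<in>{0..T - h}. ennreal ((w (t + h) - w t)\<^sup>2) \<partial>lborel)"
  proof (rule nn_integral_cong_AE)
    have "AE t in lborel. t \<noteq> (0::real)" by (rule AE_lborel_singleton)
    then show "AE t in lborel. ennreal ((c j (t + h) - c j t)\<^sup>2) * indicator {0..T - h} t
        = ennreal ((w (t + h) - w t)\<^sup>2) * indicator {0..T - h} t"
      by eventually_elim (use T wc in \<open>auto simp: indicator_def\<close>)
  qed
  also have "\<dots> \<le> ennreal (4 * (A * (1 + norm k))\<^sup>2 * h)"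
    by (rule weak_ode_shift[OF wcont gi _ weak T Ab]) (use \<mu> in auto)
  finally show ?thesis unfolding c_def .
qed

section \<open>Summation over wave vectors\<close>

text \<open>Comparison with the p-series through \<open>1 + c * n \<ge> d * (n + 1)\<close> on each
  half-line; the overlap at 0 does no harm for a union.\<close>

lemma int_powr_abs_summable:
  assumes "c > 0" "s > 1"
  shows "Infinite_Set_Sum.abs_summable_on (\<lambda>m::int. (1 + c * \<bar>real_of_int m\<bar>) powr (- s)) UNIV"
proof -
  define d where "d = min 1 c"
  have d: "d > 0" "d \<le> 1" "d \<le> c" using assms(1) by (auto simp: d_def)
  have N: "Infinite_Set_Sum.abs_summable_on (\<lambda>n::nat. (1 + c * real n) powr (- s)) UNIV"
    unfolding Infinite_Set_Sum.abs_summable_on_nat_iff'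
  proof (rule summable_comparison_test')
    have "summable (\<lambda>n. real n powr (- s))" using assms(2) by (simp add: summable_real_powr_iff)
    then have "summable (\<lambda>n. real (n + 1) powr (- s))" by (rule summable_ignore_initial_segment)
    then show "summable (\<lambda>n. d powr (- s) * real (n + 1) powr (- s))" by (rule summable_mult)
    fix n :: nat
    have "d * real (n + 1) \<le> 1 + c * real n"
      using d mult_right_mono[OF d(3), of "real n"] by (simp add: distrib_left)
    then have "(1 + c * real n) powr (- s) \<le> (d * real (n + 1)) powr (- s)"
      using d assms(2) by (intro powr_mono2') auto
    also have "\<dots> = d powr (- s) * real (n + 1) powr (- s)" by (rule powr_mult)
    finally show "norm (norm ((1 + c * real n) powr (- s))) \<le> d powr (- s) * real (n + 1) powr (- s)" by simp
  qed
  have "Infinite_Set_Sum.abs_summable_on (\<lambda>m::int. (1 + c * \<bar>real_of_int m\<bar>) powr (- s)) (range int)"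
    by (subst Infinite_Set_Sum.abs_summable_on_reindex_iff[of int, symmetric]) (use N in auto)
  moreover have "Infinite_Set_Sum.abs_summable_on (\<lambda>m::int. (1 + c * \<bar>real_of_int m\<bar>) powr (- s)) (range (\<lambda>n. - int n))"
    by (subst Infinite_Set_Sum.abs_summable_on_reindex_iff[of "\<lambda>n. - int n", symmetric]) (use N in \<open>auto simp: inj_on_def\<close>)
  moreover have "range int \<union> range (\<lambda>n. - int n) = UNIV"
  proof -
    have "m \<in> range int \<union> range (\<lambda>n. - int n)" for m :: int
      by (cases m rule: int_cases2) auto
    then show ?thesis by blast
  qed
  ultimately show ?thesis using Infinite_Set_Sum.abs_summable_on_union by metis
qed

text \<open>The exponent is shared equally among the three coordinates, with
  \<open>s = 1 + \<delta> / 3\<close> for each. As the norm dominates every component, the summand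
  is at most a product of one-variable terms, whose sum factors into three convergent
  series.\<close>

lemma wave_vector_sum_finite:
  assumes "P > 0" "\<delta> > 0"
  shows "(\<integral>\<^sup>+k. ennreal ((1 + norm k) powr (- (3 + \<delta>))) \<partial>count_space (wave_vectors P)) < \<infinity>"
proof -
  define c where "c = 2 * pi / P"
  have c: "c > 0" using assms(1) by (simp add: c_def)
  define s where "s = 1 + \<delta> / 3"
  have s: "s > 1" "3 * s = 3 + \<delta>" using assms(2) by (auto simp: s_def)
  define v where "v n = c *\<^sub>R (\<chi> i. real_of_int (n i))" for n :: "3 \<Rightarrow> int"
  have inj: "inj v" using c by (auto simp: v_def inj_def vec_eq_iff fun_eq_iff)
  have bij: "bij_betw v UNIV (wave_vectors P)"
    unfolding bij_betw_def using inj by (auto simp: v_def c_def wave_vectors_def)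
  have "Infinite_Set_Sum.abs_summable_on (\<lambda>n. \<Prod>i\<in>(UNIV::3 set). (1 + c * \<bar>real_of_int (n i)\<bar>) powr (- s)) (PiE UNIV (\<lambda>_. UNIV))"
    by (rule Infinite_Set_Sum.abs_summable_on_prod_PiE) (use int_powr_abs_summable[OF c s(1)] in auto)
  then have i: "integrable (count_space UNIV) (\<lambda>n. \<Prod>i\<in>(UNIV::3 set). (1 + c * \<bar>real_of_int (n i)\<bar>) powr (- s))"
    by (simp add: Infinite_Set_Sum.abs_summable_on_def)
  have "(\<integral>\<^sup>+k. ennreal ((1 + norm k) powr (- (3 + \<delta>))) \<partial>count_space (wave_vectors P))
      = (\<integral>\<^sup>+n. ennreal ((1 + norm (v n)) powr (- (3 + \<delta>))) \<partial>count_space UNIV)"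
    by (rule nn_integral_bij_count_space[OF bij, symmetric])
  also have "\<dots> \<le> (\<integral>\<^sup>+n. ennreal (\<Prod>i\<in>(UNIV::3 set). (1 + c * \<bar>real_of_int (n i)\<bar>) powr (- s)) \<partial>count_space UNIV)"
  proof (intro nn_integral_mono ennreal_leI)
    fix n
    have "(1 + norm (v n)) powr (- (3 + \<delta>)) = (\<Prod>i\<in>(UNIV::3 set). (1 + norm (v n)) powr (- s))"
    proof -
      have "(1 + norm (v n)) powr (- (3 + \<delta>)) = (1 + norm (v n)) powr (- s + - s + - s)" using s(2) by simp
      also have "\<dots> = ((1 + norm (v n)) powr (- s)) ^ 3"
        by (simp only: powr_add power3_eq_cube)
      finally show ?thesis by simp
    qed
    also have "\<dots> \<le> (\<Prod>i\<in>(UNIV::3 set). (1 + c * \<bar>real_of_int (n i)\<bar>) powr (- s))"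
    proof (intro prod_mono conjI)
      fix i
      have "\<bar>v n $ i\<bar> \<le> norm (v n)" by (rule component_le_norm_cart)
      then have "c * \<bar>real_of_int (n i)\<bar> \<le> norm (v n)" using c by (simp add: v_def abs_mult)
      then show "(1 + norm (v n)) powr (- s) \<le> (1 + c * \<bar>real_of_int (n i)\<bar>) powr (- s)"
        using s(1) c by (intro powr_mono2') (auto intro!: add_pos_nonneg)
    qed simp
    finally show "(1 + norm (v n)) powr (- (3 + \<delta>)) \<le> (\<Prod>i\<in>(UNIV::3 set). (1 + c * \<bar>real_of_int (n i)\<bar>) powr (- s))" .
  qed
  also have "\<dots> = ennreal (LINT n|count_space UNIV. (\<Prod>i\<in>(UNIV::3 set). (1 + c * \<bar>real_of_int (n i)\<bar>) powr (- s)))"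
    by (rule nn_integral_eq_integral[OF i]) (auto intro!: AE_I2 prod_nonneg)
  also have "\<dots> < \<infinity>" by simp
  finally show ?thesis .
qed

lemma countable_wave_vectors: "countable (wave_vectors P)"
proof -
  have "wave_vectors P = range (\<lambda>n::3 \<Rightarrow> int. (2 * pi / P) *\<^sub>R (\<chi> i. real_of_int (n i)))"
    by (auto simp: wave_vectors_def)
  then show ?thesis by (simp only: countable_image countableI_type)
qed

section \<open>The time shift estimate\<close>

text \<open>Passes from complex coefficients to real cosine and sine coefficients, the quantities to
  which \<open>mode_shift\<close> applies.\<close>

lemma norm_fourier_coeff:
  assumes v: "\<And>j. set_integrable lborel (torus P) (\<lambda>x. v x $ j)"
  shows "(norm (fourier_coeff P v k))\<^sup>2 = (\<Sum>j\<in>UNIV. (LINT x:torus P|lborel. v x $ j * cos (k \<bullet> x))\<^sup>2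
       + (LINT x:torus P|lborel. v x $ j * sin (k \<bullet> x))\<^sup>2) / (measure lborel (torus P))\<^sup>2"
proof -
  have "(norm (fourier_coeff P v k $ j))\<^sup>2 = ((LINT x:torus P|lborel. v x $ j * cos (k \<bullet> x))\<^sup>2
       + (LINT x:torus P|lborel. v x $ j * sin (k \<bullet> x))\<^sup>2) / (measure lborel (torus P))\<^sup>2" for j
  proof -
    define I where "I = (CLINT x:torus P|lborel. complex_of_real (v x $ j) * cis (- (k \<bullet> x)))"
    have i: "integrable lborel (\<lambda>x. indicator (torus P) x *\<^sub>R (complex_of_real (v x $ j) * cis (- (k \<bullet> x))))"
      using torus_mult_cis_integrable[OF v[of j], of "- k"] by (simp add: set_integrable_def)
    have "Re I = (LINT x:torus P|lborel. v x $ j * cos (k \<bullet> x))"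
      unfolding I_def set_lebesgue_integral_def by (subst integral_Re[OF i, symmetric]) simp
    moreover have "Im I = - (LINT x:torus P|lborel. v x $ j * sin (k \<bullet> x))"
      unfolding I_def set_lebesgue_integral_def by (subst integral_Im[OF i, symmetric]) simp
    moreover have "norm (fourier_coeff P v k $ j) = norm I / measure lborel (torus P)"
      by (simp add: fourier_coeff_nth I_def norm_mult norm_divide)
    ultimately show ?thesis by (simp add: power_divide cmod_power2)
  qed
  then show ?thesis by (simp add: norm_complex_vec_sq sum_divide_distrib)
qed

lemma K41w_mode:
  assumes "(SUP k\<in>S. ennreal (norm k powr r) * X k) \<le> ennreal C" "k \<in> S" "k \<noteq> 0" "C \<ge> 0"
  shows "X k \<le> ennreal (C * norm k powr (- r))"
proof -
  have "ennreal (norm k powr r) * X k \<le> ennreal C" using assms(1,2) by (meson SUP_upper2 order_refl order_trans)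
  then have "ennreal (norm k powr (- r)) * (ennreal (norm k powr r) * X k) \<le> ennreal (norm k powr (- r)) * ennreal C"
    by (rule mult_left_mono) simp
  moreover have "ennreal (norm k powr (- r)) * (ennreal (norm k powr r) * X k) = X k"
    using assms(3) by (simp add: mult.assoc[symmetric] ennreal_mult'[symmetric] powr_add[symmetric])
  ultimately show ?thesis using assms(4) by (simp add: ennreal_mult'[symmetric] mult.commute)
qed

text \<open>By Parseval the increment splits into modes, estimated by \<open>mode_shift\<close>
  below the cut-off \<open>K\<close> and by the decay \<open>high\<close> above it. Both bounds are
  rewritten as a constant times a summable power of \<open>1 + norm k\<close>, at the price of
  \<open>\<delta>1\<close> extra powers of \<open>K\<close> below and of \<open>\<delta>2\<close>,
  taken out of \<open>\<beta>\<close>, above.\<close>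

lemma shift_estimate:
  fixes f :: "real \<Rightarrow> real^3 \<Rightarrow> real^3"
  assumes P: "P > 0" and T: "T > 0" "T < H" and h: "0 < h" "h < T"
    and ws: "weak_solution_on P H \<mu> u0 f u p" and \<mu>: "\<mu> \<ge> 0"
    and f: "Lq_Lp P H 2 2 f" and u0: "Lp_per P 2 u0"
    and A: "(LINT x:torus P|lborel. 1 + (norm (u0 x))\<^sup>2)
        + 3 * (LINT z:UNIV \<times> torus P|lborel. (norm (window H u z))\<^sup>2)
        + (LINT z:UNIV \<times> torus P|lborel. norm (window H f z)) \<le> A"
    and C: "C \<ge> 0" and K: "K \<ge> 1"
    and high: "\<And>k. k \<in> wave_vectors P \<Longrightarrow> norm k \<ge> K \<Longrightarrow>
      (\<integral>\<^sup>+t\<in>{0..T}. ennreal ((norm (fourier_coeff P (u t) k))\<^sup>2) \<partial>lborel) \<le> ennreal (C * norm k powr (- (3 + \<beta>)))"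
    and \<delta>: "\<delta>1 > 0" "\<delta>2 > 0" "\<gamma> > 0" "\<beta> = \<gamma> + \<delta>2"
    and S1: "(\<integral>\<^sup>+k. ennreal ((1 + norm k) powr (- (3 + \<delta>1))) \<partial>count_space (wave_vectors P)) = ennreal S1" "S1 \<ge> 0"
    and S2: "(\<integral>\<^sup>+k. ennreal ((1 + norm k) powr (- (3 + \<delta>2))) \<partial>count_space (wave_vectors P)) = ennreal S2" "S2 \<ge> 0"
  shows "(\<integral>\<^sup>+t\<in>{0..T - h}. (\<integral>\<^sup>+x\<in>torus P. ennreal ((norm (u (t + h) x - u t x))\<^sup>2) \<partial>lborel) \<partial>lborel)
    \<le> ennreal (measure lborel (torus P) * (24 * A\<^sup>2 / (measure lborel (torus P))\<^sup>2 * 2 powr (5 + \<delta>1) * S1 * (h * K powr (5 + \<delta>1))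
        + 4 * C * 2 powr (3 + \<delta>2) * S2 * K powr (- \<gamma>)))"
proof -
  note D = weak_solution_onD[OF ws]
  define m where "m = measure lborel (torus P)"
  have m: "m > 0" unfolding m_def by (rule measure_torus_pos[OF P])
  have ut: "Lp_per P 2 (u t)" if "t \<in> {0..H}" for t using D(4) that unfolding C_L2w_def by blast
  have vi: "set_integrable lborel (torus P) (\<lambda>x. u t x $ j * g x)"
    if "t \<in> {0..H}" "g \<in> borel_measurable borel" "\<And>x. \<bar>g x\<bar> \<le> 1" for t j g
    by (rule Lp_per_component_integrable[OF ut[OF that(1)] that(2,3)])
  have vi1: "set_integrable lborel (torus P) (\<lambda>x. u t x $ j)" if "t \<in> {0..H}" for t j
    using vi[OF that, of "\<lambda>_. 1" j] by simp
  have tm: "(\<lambda>x::real^3. cos (k \<bullet> x)) \<in> borel_measurable borel" "(\<lambda>x::real^3. sin (k \<bullet> x)) \<in> borel_measurable borel" for k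
    by (intro borel_measurable_continuous_onI continuous_intros)+
  define cc where "cc k j t = (LINT x:torus P|lborel. u t x $ j * cos (k \<bullet> x))" for k j t
  define cs where "cs k j t = (LINT x:torus P|lborel. u t x $ j * sin (k \<bullet> x))" for k j t
  have cont: "continuous_on {0..H} (\<lambda>t. LINT x:torus P|lborel. u t x $ j * g x)"
    if g: "continuous_on UNIV g" "periodic P g" "\<And>x. \<bar>g x\<bar> \<le> 1" for g j
  proof -
    have c: "continuous_on UNIV (\<lambda>x. g x *\<^sub>R axis j (1::real) :: real^3)" by (intro continuous_intros g)
    have "set_integrable lborel (torus P) (\<lambda>x. norm (g x *\<^sub>R axis j (1::real) :: real^3) powr 2)"
      using borel_measurable_continuous_onI[OF g(1)] g(3)
      by (intro torus_integrable_bounded[of _ 1]) (auto simp: abs_square_le_1)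
    then have "Lp_per P 2 (\<lambda>x. g x *\<^sub>R axis j (1::real) :: real^3)"
      using g(2) borel_measurable_continuous_onI[OF c] by (simp add: Lp_per_def periodic_def)
    then have "continuous_on {0..H} (\<lambda>t. LINT x:torus P|lborel. u t x \<bullet> (g x *\<^sub>R axis j (1::real)))"
      using D(4) unfolding C_L2w_def by blast
    then show ?thesis by (simp add: inner_axis mult.commute)
  qed
  have trig: "continuous_on UNIV (\<lambda>x::real^3. cos (k \<bullet> x))" "continuous_on UNIV (\<lambda>x::real^3. sin (k \<bullet> x))"
      "\<And>x. \<bar>cos (k \<bullet> x)\<bar> \<le> 1" "\<And>x. \<bar>sin (k \<bullet> x)\<bar> \<le> 1" for k :: "real^3"
    by (auto intro!: continuous_intros)
  have trigp: "periodic P (\<lambda>x. cos (k \<bullet> x))" "periodic P (\<lambda>x. sin (k \<bullet> x))" if "k \<in> wave_vectors P" for k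
    by (rule periodic_inner_function[OF P that]; simp)+
  have ccc: "continuous_on {0..H} (cc k j)" "continuous_on {0..H} (cs k j)" if "k \<in> wave_vectors P" for k j
    unfolding cc_def[abs_def] cs_def[abs_def]
    by (rule cont[OF trig(1) trigp(1)[OF that] trig(3)], rule cont[OF trig(2) trigp(2)[OF that] trig(4)])
  define V where "V k t = (norm (fourier_coeff P (\<lambda>x. u (t + h) x - u t x) k))\<^sup>2" for k t
  define W where "W k t = (norm (fourier_coeff P (u t) k))\<^sup>2" for k t
  have W_eq: "W k t = (\<Sum>j\<in>UNIV. (cc k j t)\<^sup>2 + (cs k j t)\<^sup>2) / m\<^sup>2" if "t \<in> {0..H}" for k t
    unfolding W_def cc_def cs_def m_def by (rule norm_fourier_coeff[OF vi1[OF that]])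
  have V_eq: "V k t = (\<Sum>j\<in>UNIV. (cc k j (t + h) - cc k j t)\<^sup>2 + (cs k j (t + h) - cs k j t)\<^sup>2) / m\<^sup>2"
    if t: "t \<in> {0..T - h}" for k t
  proof -
    have t1: "t \<in> {0..H}" "t + h \<in> {0..H}" using t T h by auto
    have d: "(LINT x:torus P|lborel. (u (t + h) x - u t x) $ j * g x)
        = (LINT x:torus P|lborel. u (t + h) x $ j * g x) - (LINT x:torus P|lborel. u t x $ j * g x)"
      if "g \<in> borel_measurable borel" "\<And>x. \<bar>g x\<bar> \<le> 1" for g j
      by (simp add: left_diff_distrib set_integral_diff(2)[OF vi[OF t1(2) that] vi[OF t1(1) that]])
    have "set_integrable lborel (torus P) (\<lambda>x. (u (t + h) x - u t x) $ j)" for j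
      using set_integral_diff(1)[OF vi1[OF t1(2)] vi1[OF t1(1)]] by simp
    then show ?thesis
      unfolding V_def m_def cc_def cs_def
      by (subst norm_fourier_coeff) (simp_all only: d[OF tm(1) trig(3)] d[OF tm(2) trig(4)])
  qed
  \<comment> \<open>Weak continuity in time makes every Fourier coefficient continuous; this gives
    the measurability in \<open>t\<close> needed to exchange the sum over modes with the time
    integral.\<close>
  have Vm: "(\<lambda>t. ennreal (V k t) * indicator {0..T - h} t) \<in> borel_measurable lborel" if k: "k \<in> wave_vectors P" for k
  proof -
    have sh: "continuous_on {0..T - h} (\<lambda>t. g (t + h))" if "continuous_on {0..H} g" for g :: "real \<Rightarrow> real"
      by (rule continuous_on_compose2[OF that]) (use T h in \<open>auto intro!: continuous_intros\<close>)
    have "continuous_on {0..T - h} (\<lambda>t. (\<Sum>j\<in>UNIV. (cc k j (t + h) - cc k j t)\<^sup>2 + (cs k j (t + h) - cs k j t)\<^sup>2) / m\<^sup>2)"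
      using m h T by (intro continuous_intros sh ccc[OF k] continuous_on_subset[OF ccc(1)[OF k]] continuous_on_subset[OF ccc(2)[OF k]]) auto
    from borel_measurable_continuous_on_indicator[OF _ this]
    have "(\<lambda>t. indicator {0..T - h} t *\<^sub>R ((\<Sum>j\<in>UNIV. (cc k j (t + h) - cc k j t)\<^sup>2 + (cs k j (t + h) - cs k j t)\<^sup>2) / m\<^sup>2)) \<in> borel_measurable borel"
      by simp
    then have "(\<lambda>t. ennreal (indicator {0..T - h} t *\<^sub>R ((\<Sum>j\<in>UNIV. (cc k j (t + h) - cc k j t)\<^sup>2 + (cs k j (t + h) - cs k j t)\<^sup>2) / m\<^sup>2))) \<in> borel_measurable borel"
      by measurable
    also have "(\<lambda>t. ennreal (indicator {0..T - h} t *\<^sub>R ((\<Sum>j\<in>UNIV. (cc k j (t + h) - cc k j t)\<^sup>2 + (cs k j (t + h) - cs k j t)\<^sup>2) / m\<^sup>2)))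
        = (\<lambda>t. ennreal (V k t) * indicator {0..T - h} t)"
      by (auto simp: V_eq indicator_def)
    finally show ?thesis by simp
  qed
  have Wm: "(\<lambda>t. ennreal (W k t) * indicator {0..T} t) \<in> borel_measurable borel" if k: "k \<in> wave_vectors P" for k
  proof -
    have "continuous_on {0..T} (\<lambda>t. (\<Sum>j\<in>UNIV. (cc k j t)\<^sup>2 + (cs k j t)\<^sup>2) / m\<^sup>2)"
      using m T by (intro continuous_intros continuous_on_subset[OF ccc(1)[OF k]] continuous_on_subset[OF ccc(2)[OF k]]) auto
    from borel_measurable_continuous_on_indicator[OF _ this]
    have "(\<lambda>t. indicator {0..T} t *\<^sub>R ((\<Sum>j\<in>UNIV. (cc k j t)\<^sup>2 + (cs k j t)\<^sup>2) / m\<^sup>2)) \<in> borel_measurable borel" by simp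
    then have "(\<lambda>t. ennreal (indicator {0..T} t *\<^sub>R ((\<Sum>j\<in>UNIV. (cc k j t)\<^sup>2 + (cs k j t)\<^sup>2) / m\<^sup>2))) \<in> borel_measurable borel"
      by measurable
    also have "(\<lambda>t. ennreal (indicator {0..T} t *\<^sub>R ((\<Sum>j\<in>UNIV. (cc k j t)\<^sup>2 + (cs k j t)\<^sup>2) / m\<^sup>2)))
        = (\<lambda>t. ennreal (W k t) * indicator {0..T} t)"
      using T by (auto simp: W_eq indicator_def)
    finally show ?thesis .
  qed
  define I where "I k = (\<integral>\<^sup>+t\<in>{0..T - h}. ennreal (V k t) \<partial>lborel)" for k
  have low: "I k \<le> ennreal (24 * A\<^sup>2 / m\<^sup>2 * (1 + norm k)\<^sup>2 * h)" if k: "k \<in> wave_vectors P" for k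
  proof -
    define b where "b = 4 * (A * (1 + norm k))\<^sup>2 * h"
    have b0: "b \<ge> 0" using h by (simp add: b_def)
    note wf = wave_function[OF smooth_sin_cos(1) DERIV_sin] wave_function[OF smooth_sin_cos(2) DERIV_cos]
    have bc: "(\<integral>\<^sup>+t\<in>{0..T - h}. ennreal ((cc k j (t + h) - cc k j t)\<^sup>2) \<partial>lborel) \<le> ennreal b" for j
      unfolding cc_def b_def
      by (rule mode_shift[OF P h(1) T(2) ws \<mu> f u0 wf(3) trigp(1)[OF k] trig(3) wf(1) trigp(2)[OF k] trig(4), where e="-1"])
         (use A in \<open>simp_all add: wf(2,4) inner_axis\<close>)
    have bs: "(\<integral>\<^sup>+t\<in>{0..T - h}. ennreal ((cs k j (t + h) - cs k j t)\<^sup>2) \<partial>lborel) \<le> ennreal b" for j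
      unfolding cs_def b_def
      by (rule mode_shift[OF P h(1) T(2) ws \<mu> f u0 wf(1) trigp(2)[OF k] trig(4) wf(3) trigp(1)[OF k] trig(3), where e="1"])
         (use A in \<open>simp_all add: wf(2,4) inner_axis\<close>)
    have meas: "(\<lambda>t. ennreal ((g (t + h) - g t)\<^sup>2) * indicator {0..T - h} t) \<in> borel_measurable lborel"
      if g: "continuous_on {0..H} g" for g :: "real \<Rightarrow> real"
    proof -
      have "continuous_on {0..T - h} (\<lambda>t. (g (t + h) - g t)\<^sup>2)"
        by (intro continuous_intros continuous_on_compose2[OF g] continuous_on_subset[OF g]) (use T h in auto)
      from borel_measurable_continuous_on_indicator[OF _ this]
      have "(\<lambda>t. ennreal (indicator {0..T - h} t *\<^sub>R (g (t + h) - g t)\<^sup>2)) \<in> borel_measurable borel" by simp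
      also have "(\<lambda>t. ennreal (indicator {0..T - h} t *\<^sub>R (g (t + h) - g t)\<^sup>2)) = (\<lambda>t. ennreal ((g (t + h) - g t)\<^sup>2) * indicator {0..T - h} t)"
        by (auto simp: indicator_def)
      finally show ?thesis by simp
    qed
    have "I k = (\<integral>\<^sup>+t. ennreal (1 / m\<^sup>2) * (\<Sum>j\<in>UNIV. ennreal ((cc k j (t + h) - cc k j t)\<^sup>2) * indicator {0..T - h} t
        + ennreal ((cs k j (t + h) - cs k j t)\<^sup>2) * indicator {0..T - h} t) \<partial>lborel)"
      unfolding I_def
    proof (rule nn_integral_cong)
      fix t
      show "ennreal (V k t) * indicator {0..T - h} t = ennreal (1 / m\<^sup>2) * (\<Sum>j\<in>UNIV. ennreal ((cc k j (t + h) - cc k j t)\<^sup>2) * indicator {0..T - h} t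
        + ennreal ((cs k j (t + h) - cs k j t)\<^sup>2) * indicator {0..T - h} t)"
      proof (cases "t \<in> {0..T - h}")
        case True
        have "ennreal (V k t) = ennreal (1 / m\<^sup>2 * (\<Sum>j\<in>UNIV. (cc k j (t + h) - cc k j t)\<^sup>2 + (cs k j (t + h) - cs k j t)\<^sup>2))"
          by (simp add: V_eq[OF True])
        also have "\<dots> = ennreal (1 / m\<^sup>2) * ennreal (\<Sum>j\<in>UNIV. (cc k j (t + h) - cc k j t)\<^sup>2 + (cs k j (t + h) - cs k j t)\<^sup>2)"
          by (rule ennreal_mult') simp
        also have "ennreal (\<Sum>j\<in>UNIV. (cc k j (t + h) - cc k j t)\<^sup>2 + (cs k j (t + h) - cs k j t)\<^sup>2)
            = (\<Sum>j\<in>UNIV. ennreal ((cc k j (t + h) - cc k j t)\<^sup>2) + ennreal ((cs k j (t + h) - cs k j t)\<^sup>2))"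
          by (subst sum_ennreal[symmetric]) auto
        finally show ?thesis using True by simp
      qed simp
    qed
    also have "\<dots> = ennreal (1 / m\<^sup>2) * (\<Sum>j\<in>UNIV. (\<integral>\<^sup>+t\<in>{0..T - h}. ennreal ((cc k j (t + h) - cc k j t)\<^sup>2) \<partial>lborel)
        + (\<integral>\<^sup>+t\<in>{0..T - h}. ennreal ((cs k j (t + h) - cs k j t)\<^sup>2) \<partial>lborel))"
      using meas[OF ccc(1)[OF k]] meas[OF ccc(2)[OF k]]
      by (subst nn_integral_cmult) (auto simp: nn_integral_sum nn_integral_add intro!: borel_measurable_sum borel_measurable_add)
    also have "\<dots> \<le> ennreal (1 / m\<^sup>2) * (\<Sum>j\<in>(UNIV :: 3 set). ennreal b + ennreal b)"
      by (intro mult_left_mono sum_mono add_mono bc bs) auto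
    also have "\<dots> = ennreal (1 / m\<^sup>2 * (6 * b))"
    proof -
      have "(\<Sum>j\<in>(UNIV :: 3 set). ennreal b + ennreal b) = ennreal (\<Sum>j\<in>(UNIV :: 3 set). b + b)"
        using b0 sum_ennreal[of "UNIV :: 3 set" "\<lambda>_. b + b"] by (simp only: ennreal_plus[symmetric])
      also have "(\<Sum>j\<in>(UNIV :: 3 set). b + b) = 6 * b" by simp
      finally show ?thesis by (simp add: ennreal_mult'[symmetric])
    qed
    \<comment> \<open>The constant 24 is the 4 of the scalar estimate, times three components, times
      two for cosine and sine.\<close>
    also have "1 / m\<^sup>2 * (6 * b) = 24 * A\<^sup>2 / m\<^sup>2 * (1 + norm k)\<^sup>2 * h"
      by (simp add: b_def power_mult_distrib)
    finally show ?thesis .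
  qed
  have highI: "I k \<le> ennreal (4 * C * norm k powr (- (3 + \<beta>)))" if k: "k \<in> wave_vectors P" "norm k \<ge> K" for k
  proof -
    note [measurable] = Wm[OF k(1)]
    define w where "w t = ennreal (W k t) * indicator {0..T} t" for t
    have wm[measurable]: "w \<in> borel_measurable borel" unfolding w_def[abs_def] by (rule Wm[OF k(1)])
    have wb: "(\<integral>\<^sup>+t. w t \<partial>lborel) \<le> ennreal (C * norm k powr (- (3 + \<beta>)))"
      using high[OF k] unfolding w_def W_def .
    have "I k \<le> (\<integral>\<^sup>+t. 2 * w (h + t) + 2 * w t \<partial>lborel)"
      unfolding I_def
    proof (rule nn_integral_mono)
      fix t
      show "ennreal (V k t) * indicator {0..T - h} t \<le> 2 * w (h + t) + 2 * w t"
      proof (cases "t \<in> {0..T - h}")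
        case True
        have t1: "t \<in> {0..H}" "t + h \<in> {0..H}" using True T h by auto
        \<comment> \<open>At high frequency nothing is gained from a small \<open>h\<close>: the
          increment is split crudely, and \<open>t\<close> and \<open>t + h\<close> both stay in
          \<open>[0, T]\<close>, where the decay hypothesis applies to each.\<close>
        have sq: "(x - y)\<^sup>2 \<le> 2 * x\<^sup>2 + 2 * y\<^sup>2" for x y :: real
          using zero_le_power2[of "x + y"] by (simp add: power2_diff power2_sum)
        have "V k t \<le> (\<Sum>j\<in>UNIV. (2 * (cc k j (t + h))\<^sup>2 + 2 * (cc k j t)\<^sup>2) + (2 * (cs k j (t + h))\<^sup>2 + 2 * (cs k j t)\<^sup>2)) / m\<^sup>2"
          unfolding V_eq[OF True] by (intro divide_right_mono sum_mono add_mono sq) auto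
        also have "\<dots> = 2 * W k (t + h) + 2 * W k t"
          unfolding W_eq[OF t1(1)] W_eq[OF t1(2)]
          by (simp add: sum.distrib sum_distrib_left[symmetric] add_divide_distrib algebra_simps)
        finally have "ennreal (V k t) \<le> ennreal (2 * W k (t + h) + 2 * W k t)" by (rule ennreal_leI)
        also have "\<dots> = 2 * ennreal (W k (t + h)) + 2 * ennreal (W k t)"
          by (simp add: W_def ennreal_plus ennreal_mult')
        finally show ?thesis using True h by (simp add: w_def add.commute)
      qed simp
    qed
    also have "\<dots> = 2 * (\<integral>\<^sup>+t. w (h + t) \<partial>lborel) + 2 * (\<integral>\<^sup>+t. w t \<partial>lborel)"
      by (simp add: nn_integral_add nn_integral_cmult)
    also have "(\<integral>\<^sup>+t. w (h + t) \<partial>lborel) = (\<integral>\<^sup>+t. w t \<partial>lborel)"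
      using nn_integral_distr[of "(+) h" lborel borel w] by (simp add: lborel_distr_plus)
    also have "2 * (\<integral>\<^sup>+t. w t \<partial>lborel) + 2 * (\<integral>\<^sup>+t. w t \<partial>lborel) \<le> 2 * ennreal (C * norm k powr (- (3 + \<beta>))) + 2 * ennreal (C * norm k powr (- (3 + \<beta>)))"
      by (intro add_mono mult_left_mono wb) auto
    also have "\<dots> = ennreal (4 * C * norm k powr (- (3 + \<beta>)))"
    proof -
      have "2 * ennreal X + 2 * ennreal X = ennreal (4 * X)" if "X \<ge> 0" for X
      proof -
        have "2 * ennreal X = ennreal (2 * X)" by (simp add: ennreal_mult')
        then show ?thesis using that by (simp add: ennreal_plus[symmetric] del: ennreal_plus)
      qed
      from this[of "C * norm k powr (- (3 + \<beta>))"] show ?thesis using C by (simp add: mult.assoc)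
    qed
    finally show ?thesis .
  qed
  define E1 where "E1 = 24 * A\<^sup>2 / m\<^sup>2 * 2 powr (5 + \<delta>1) * (h * K powr (5 + \<delta>1))"
  define E2 where "E2 = 4 * C * 2 powr (3 + \<delta>2) * K powr (- \<gamma>)"
  have E0: "E1 \<ge> 0" "E2 \<ge> 0" using h C by (auto simp: E1_def E2_def)
  have Ib: "I k \<le> ennreal E1 * ennreal ((1 + norm k) powr (- (3 + \<delta>1))) + ennreal E2 * ennreal ((1 + norm k) powr (- (3 + \<delta>2)))"
    if k: "k \<in> wave_vectors P" for k
  proof (cases "norm k < K")
    case True
    \<comment> \<open>Below the cut-off \<open>1 + norm k\<close> is at most \<open>2 * K\<close>,
      as \<open>K \<ge> 1\<close>. Writing the exponent 2 as \<open>5 + \<delta>1\<close> minus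
      \<open>3 + \<delta>1\<close> leaves the summable weight behind.\<close>
    have "(1 + norm k)\<^sup>2 \<le> 2 powr (5 + \<delta>1) * K powr (5 + \<delta>1) * (1 + norm k) powr (- (3 + \<delta>1))"
    proof -
      have n: "0 < 1 + norm k" by (simp add: add_pos_nonneg)
      have "(1 + norm k) powr (5 + \<delta>1) \<le> (2 * K) powr (5 + \<delta>1)"
        using True K \<delta>(1) by (intro powr_mono2) auto
      then have "(1 + norm k) powr (5 + \<delta>1) * (1 + norm k) powr (- (3 + \<delta>1)) \<le> (2 * K) powr (5 + \<delta>1) * (1 + norm k) powr (- (3 + \<delta>1))"
        by (rule mult_right_mono) simp
      moreover have "(1 + norm k) powr (5 + \<delta>1) * (1 + norm k) powr (- (3 + \<delta>1)) = (1 + norm k)\<^sup>2"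
        using n by (simp add: powr_add[symmetric])
      moreover have "(2 * K) powr (5 + \<delta>1) = 2 powr (5 + \<delta>1) * K powr (5 + \<delta>1)"
        by (rule powr_mult)
      ultimately show ?thesis by simp
    qed
    then have "24 * A\<^sup>2 / m\<^sup>2 * h * (1 + norm k)\<^sup>2 \<le> 24 * A\<^sup>2 / m\<^sup>2 * h * (2 powr (5 + \<delta>1) * K powr (5 + \<delta>1) * (1 + norm k) powr (- (3 + \<delta>1)))"
      using h by (intro mult_left_mono) auto
    then have "24 * A\<^sup>2 / m\<^sup>2 * (1 + norm k)\<^sup>2 * h \<le> E1 * (1 + norm k) powr (- (3 + \<delta>1))"
      by (simp add: E1_def mult_ac)
    then have "I k \<le> ennreal (E1 * (1 + norm k) powr (- (3 + \<delta>1)))"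
      by (intro order_trans[OF low[OF k]] ennreal_leI)
    also have "\<dots> = ennreal E1 * ennreal ((1 + norm k) powr (- (3 + \<delta>1)))" by (rule ennreal_mult) (use E0 in auto)
    finally show ?thesis by (simp add: add_increasing2)
  next
    case False
    then have kK: "norm k \<ge> K" by simp
    then have n: "0 < norm k" "1 \<le> norm k" using K by auto
    have "- (3 + \<beta>) = - \<gamma> + - (3 + \<delta>2)" using \<delta>(4) by simp
    then have "norm k powr (- (3 + \<beta>)) = norm k powr (- \<gamma>) * norm k powr (- (3 + \<delta>2))"
      by (simp only: powr_add)
    also have "\<dots> \<le> K powr (- \<gamma>) * (2 powr (3 + \<delta>2) * (1 + norm k) powr (- (3 + \<delta>2)))"
    proof (intro mult_mono)
      show "norm k powr (- \<gamma>) \<le> K powr (- \<gamma>)" using kK K \<delta>(3) by (intro powr_mono2') auto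
      \<comment> \<open>Here \<open>norm k \<ge> 1\<close>, so \<open>1 + norm k\<close> is at most
        \<open>2 * norm k\<close>, and the weight changes by a constant factor only.\<close>
      have "norm k powr (- (3 + \<delta>2)) \<le> ((1 + norm k) / 2) powr (- (3 + \<delta>2))"
        using n \<delta>(2) by (intro powr_mono2') auto
      also have "\<dots> = 2 powr (3 + \<delta>2) * (1 + norm k) powr (- (3 + \<delta>2))"
      proof -
        have "((1 + norm k) / 2) powr (- (3 + \<delta>2)) = (1 + norm k) powr (- (3 + \<delta>2)) / 2 powr (- (3 + \<delta>2))"
          by (rule powr_divide)
        then show ?thesis by (simp only: powr_minus[of 2] divide_inverse inverse_inverse_eq mult.commute)
      qed
      finally show "norm k powr (- (3 + \<delta>2)) \<le> 2 powr (3 + \<delta>2) * (1 + norm k) powr (- (3 + \<delta>2))" .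
    qed auto
    finally have "4 * C * norm k powr (- (3 + \<beta>)) \<le> 4 * C * (K powr (- \<gamma>) * (2 powr (3 + \<delta>2) * (1 + norm k) powr (- (3 + \<delta>2))))"
      using C by (intro mult_left_mono) auto
    then have "4 * C * norm k powr (- (3 + \<beta>)) \<le> E2 * (1 + norm k) powr (- (3 + \<delta>2))"
      by (simp add: E2_def mult_ac)
    then have "I k \<le> ennreal (E2 * (1 + norm k) powr (- (3 + \<delta>2)))"
      by (intro order_trans[OF highI[OF k kK]] ennreal_leI)
    also have "\<dots> = ennreal E2 * ennreal ((1 + norm k) powr (- (3 + \<delta>2)))" by (rule ennreal_mult) (use E0 in auto)
    finally show ?thesis by (simp add: add_increasing)
  qed
  have "(\<integral>\<^sup>+t\<in>{0..T - h}. (\<integral>\<^sup>+x\<in>torus P. ennreal ((norm (u (t + h) x - u t x))\<^sup>2) \<partial>lborel) \<partial>lborel)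
      \<le> (\<integral>\<^sup>+t. (\<integral>\<^sup>+k. ennreal m * (ennreal (V k t) * indicator {0..T - h} t) \<partial>count_space (wave_vectors P)) \<partial>lborel)"
  proof (rule nn_integral_mono)
    fix t
    show "(\<integral>\<^sup>+x\<in>torus P. ennreal ((norm (u (t + h) x - u t x))\<^sup>2) \<partial>lborel) * indicator {0..T - h} t
        \<le> (\<integral>\<^sup>+k. ennreal m * (ennreal (V k t) * indicator {0..T - h} t) \<partial>count_space (wave_vectors P))"
    proof (cases "t \<in> {0..T - h}")
      case True
      have t1: "t \<in> {0..H}" "t + h \<in> {0..H}" using True T h by auto
      have "(\<lambda>x. u (t + h) x - u t x) \<in> borel_measurable borel"
        using ut[OF t1(1)] ut[OF t1(2)] by (intro borel_measurable_diff) (auto simp: Lp_per_def)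
      moreover have "set_integrable lborel (torus P) (\<lambda>x. (u (t + h) x - u t x) $ j)" for j
        using set_integral_diff(1)[OF vi1[OF t1(2)] vi1[OF t1(1)]] by simp
      ultimately show ?thesis
        using parseval_le[OF P, of "\<lambda>x. u (t + h) x - u t x"] True
        by (simp add: V_def m_def nn_integral_cmult)
    qed simp
  qed
  also have "\<dots> = (\<integral>\<^sup>+k. (\<integral>\<^sup>+t. ennreal m * (ennreal (V k t) * indicator {0..T - h} t) \<partial>lborel) \<partial>count_space (wave_vectors P))"
    by (rule nn_integral_count_space_nn_integral[OF countable_wave_vectors])
       (intro borel_measurable_times_ennreal borel_measurable_const Vm)
  also have "\<dots> = (\<integral>\<^sup>+k. ennreal m * I k \<partial>count_space (wave_vectors P))"
    unfolding I_def by (intro nn_integral_cong nn_integral_cmult Vm) simp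
  also have "\<dots> = ennreal m * (\<integral>\<^sup>+k. I k \<partial>count_space (wave_vectors P))"
    by (rule nn_integral_cmult) simp
  also have "(\<integral>\<^sup>+k. I k \<partial>count_space (wave_vectors P)) \<le> (\<integral>\<^sup>+k. ennreal E1 * ennreal ((1 + norm k) powr (- (3 + \<delta>1))) + ennreal E2 * ennreal ((1 + norm k) powr (- (3 + \<delta>2))) \<partial>count_space (wave_vectors P))"
    by (intro nn_integral_mono) (use Ib in auto)
  also have "\<dots> = ennreal E1 * ennreal S1 + ennreal E2 * ennreal S2"
  proof -
    have c: "(\<integral>\<^sup>+k. ennreal E * g k \<partial>count_space (wave_vectors P)) = ennreal E * (\<integral>\<^sup>+k. g k \<partial>count_space (wave_vectors P))"
      for E and g :: "real^3 \<Rightarrow> ennreal"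
      by (rule nn_integral_cmult) simp
    show ?thesis by (subst nn_integral_add, simp, simp) (simp only: c S1(1) S2(1))
  qed
  also have "\<dots> = ennreal (E1 * S1 + E2 * S2)"
    using E0 S1(2) S2(2) by (simp add: ennreal_mult ennreal_plus)
  finally have "(\<integral>\<^sup>+t\<in>{0..T - h}. (\<integral>\<^sup>+x\<in>torus P. ennreal ((norm (u (t + h) x - u t x))\<^sup>2) \<partial>lborel) \<partial>lborel)
      \<le> ennreal m * ennreal (E1 * S1 + E2 * S2)"
    by (simp add: mult_left_mono)
  also have "\<dots> = ennreal (m * (E1 * S1 + E2 * S2))" using m by (intro ennreal_mult'[symmetric]) auto
  also have "m * (E1 * S1 + E2 * S2) = m * (24 * A\<^sup>2 / m\<^sup>2 * 2 powr (5 + \<delta>1) * S1 * (h * K powr (5 + \<delta>1))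
        + 4 * C * 2 powr (3 + \<delta>2) * S2 * K powr (- \<gamma>))"
    by (simp add: E1_def E2_def mult_ac)
  finally show ?thesis unfolding m_def .
qed

text \<open>
  The estimate is applied at the cut-off \<open>K = h\<^bsup>-\<theta>/\<gamma>\<^esup>\<close> with \<open>2 \<alpha> < \<gamma> < \<beta>\<close>; the choice
  \<open>5 + \<delta>\<^sub>1 = 5 \<gamma> / (2 \<alpha>)\<close> turns both contributions into \<open>h\<^bsup>\<theta>\<^esup>\<close>, \<open>\<theta> = 2 \<alpha> / (5 + 2 \<alpha>)\<close>.
\<close>

theorem proposition4p1:
  fixes P \<alpha> \<beta> :: real
    and u0 :: "real^3 \<Rightarrow> real^3"
    and f :: "real \<Rightarrow> real^3 \<Rightarrow> real^3"
    and u :: "real \<Rightarrow> real \<Rightarrow> real^3 \<Rightarrow> real^3"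
    and p :: "real \<Rightarrow> real \<Rightarrow> real^3 \<Rightarrow> real"
  assumes "P > 0"
    and "Lp_per P 2 u0"
    and "\<forall>T>0. Lq_Lp P T 2 2 f"
    and "\<forall>\<mu>>0. weak_solution P \<mu> u0 f (u \<mu>) (p \<mu>)"
    and "\<beta> > 0"
    and "K41w P \<beta> u"
    and "0 < \<alpha>" "\<alpha> < \<beta> / 2"
  shows "\<forall>T>0. \<exists>M>0.
     (\<forall>\<^sub>F h in at_right 0. \<forall>\<mu>>0.
        (\<integral>\<^sup>+t\<in>{0..T - h}. (\<integral>\<^sup>+x\<in>torus P.
            ennreal ((norm (u \<mu> (t + h) x - u \<mu> t x))\<^sup>2) \<partial>lborel) \<partial>lborel)
        \<le> ennreal (M * h powr (2 * \<alpha> / (5 + 2 * \<alpha>)))) \<and>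
     ((\<lambda>h. M * h powr (2 * \<alpha> / (5 + 2 * \<alpha>))) \<longlongrightarrow> 0) (at_right 0)"
proof (intro allI impI)
  fix T :: real assume T: "T > 0"
  \<comment> \<open>The scalar equations yield information strictly before the end of the time
    interval, so a longer interval is used to cover \<open>[0, T]\<close>.\<close>
  define H where "H = T + 1"
  have H: "H > 0" "T < H" using T by (auto simp: H_def)
  \<comment> \<open>The midpoint of \<open>2 * \<alpha>\<close> and \<open>\<beta>\<close>; the room
    on either side makes \<open>\<delta>1\<close> and \<open>\<delta>2\<close> positive.\<close>
  define \<gamma> where "\<gamma> = \<alpha> + \<beta> / 2"
  define \<delta>1 where "\<delta>1 = 5 * \<gamma> / (2 * \<alpha>) - 5"
  define \<delta>2 where "\<delta>2 = \<beta> - \<gamma>"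
  define \<theta> where "\<theta> = 2 * \<alpha> / (5 + 2 * \<alpha>)"
  have \<gamma>: "\<gamma> > 0" "2 * \<alpha> < \<gamma>" "\<beta> = \<gamma> + \<delta>2" "\<delta>2 > 0"
    using assms(5,7,8) by (auto simp: \<gamma>_def \<delta>2_def field_simps)
  have \<delta>1: "\<delta>1 > 0" using \<gamma>(2) assms(7) by (simp add: \<delta>1_def field_simps)
  have \<theta>: "\<theta> > 0" using assms(7) by (simp add: \<theta>_def)
  define S where "S \<delta> = enn2real (\<integral>\<^sup>+k. ennreal ((1 + norm k) powr (- (3 + \<delta>))) \<partial>count_space (wave_vectors P))" for \<delta> :: real
  have S: "(\<integral>\<^sup>+k. ennreal ((1 + norm k) powr (- (3 + \<delta>))) \<partial>count_space (wave_vectors P)) = ennreal (S \<delta>)" "S \<delta> \<ge> 0"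
    if "\<delta> > 0" for \<delta>
    using wave_vector_sum_finite[OF assms(1) that] by (simp_all add: S_def)
  obtain C kstar where C: "C > 0" and kstar: "kstar > 0"
    and K41: "\<And>\<mu>. \<mu> > 0 \<Longrightarrow> (SUP k\<in>{k \<in> wave_vectors P. norm k \<ge> kstar}.
           ennreal (norm k powr (3 + \<beta>)) *
           (\<integral>\<^sup>+t\<in>{0..T}. ennreal ((norm (fourier_coeff P (u \<mu> t) k))\<^sup>2) \<partial>lborel)) \<le> ennreal C"
    using assms(6) T unfolding K41w_def by blast
  \<comment> \<open>The right-hand side of \<open>energy_bound\<close> on \<open>(0, H)\<close>,
    with the weight vanishing at \<open>H + 1\<close> and the solution taken up to
    \<open>H + 2\<close>. It depends on the data alone, and so do \<open>A\<close> and the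
    contribution of low frequencies to \<open>M\<close>.\<close>
  define E where "E = 4 * (H + 1)\<^sup>2 / flat 0 1 * ((LINT x:torus P|lborel. (norm (u0 x))\<^sup>2) / 2
         + (H + 1)\<^sup>2 * (LINT z:UNIV \<times> torus P|lborel. (norm (window (H + 2) f z))\<^sup>2))"
  define A where "A = (LINT x:torus P|lborel. 1 + (norm (u0 x))\<^sup>2) + 3 * E
        + (LINT z:UNIV \<times> torus P|lborel. norm (window H f z))"
  define m where "m = measure lborel (torus P)"
  have m: "m > 0" unfolding m_def by (rule measure_torus_pos[OF assms(1)])
  \<comment> \<open>The summand 1 guarantees that \<open>M\<close> is positive even if all the other
    contributions vanish.\<close>
  define M where "M = m * (24 * A\<^sup>2 / m\<^sup>2 * 2 powr (5 + \<delta>1) * S \<delta>1 + 4 * C * 2 powr (3 + \<delta>2) * S \<delta>2) + 1"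
  have M0: "m * (24 * A\<^sup>2 / m\<^sup>2 * 2 powr (5 + \<delta>1) * S \<delta>1 + 4 * C * 2 powr (3 + \<delta>2) * S \<delta>2) \<ge> 0"
    using m C S(2)[OF \<delta>1] S(2)[OF \<gamma>(4)] by (intro mult_nonneg_nonneg add_nonneg_nonneg) auto
  define r where "r = \<theta> / \<gamma>"
  have r: "r > 0" using \<theta> \<gamma>(1) by (simp add: r_def)
  define R where "R = max 1 kstar"
  \<comment> \<open>For \<open>h < b\<close> the shift is shorter than the time interval, and the
    cut-off \<open>h powr (- r)\<close> is at least 1 and at least \<open>kstar\<close>, where the
    spectral assumption takes over. Neither requirement involves \<open>\<mu>\<close>.\<close>
  define b where "b = min T (R powr (- (1 / r)))"
  have b: "b > 0" using T by (simp add: b_def R_def)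
  have main: "(\<integral>\<^sup>+t\<in>{0..T - h}. (\<integral>\<^sup>+x\<in>torus P. ennreal ((norm (u \<mu> (t + h) x - u \<mu> t x))\<^sup>2) \<partial>lborel) \<partial>lborel)
      \<le> ennreal (M * h powr \<theta>)" if h: "0 < h" "h < b" and \<mu>: "\<mu> > 0" for h \<mu>
  proof -
    have hT: "h < T" using h by (simp add: b_def)
    define K where "K = h powr (- r)"
    have K: "K \<ge> R"
    proof -
      have "(R powr (- (1 / r))) powr (- r) \<le> h powr (- r)"
        using h r by (intro powr_mono2') (auto simp: b_def)
      moreover have "(R powr (- (1 / r))) powr (- r) = R" using r by (simp add: powr_powr R_def)
      ultimately show ?thesis by (simp add: K_def)
    qed
    have ws: "weak_solution_on P X \<mu> u0 f (u \<mu>) (p \<mu>)" if "X > 0" for X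
      using assms(4) \<mu> that unfolding weak_solution_def by blast
    have "(LINT z:UNIV \<times> torus P|lborel. (norm (window H (u \<mu>) z))\<^sup>2) \<le> E"
      unfolding E_def using H \<mu> assms(3)
      by (intro energy_bound[OF assms(1) H(1) refl _ _ ws _ assms(2)]) auto
    then have A: "(LINT x:torus P|lborel. 1 + (norm (u0 x))\<^sup>2)
        + 3 * (LINT z:UNIV \<times> torus P|lborel. (norm (window H (u \<mu>) z))\<^sup>2)
        + (LINT z:UNIV \<times> torus P|lborel. norm (window H f z)) \<le> A"
      by (simp add: A_def)
    have high: "(\<integral>\<^sup>+t\<in>{0..T}. ennreal ((norm (fourier_coeff P (u \<mu> t) k))\<^sup>2) \<partial>lborel) \<le> ennreal (C * norm k powr (- (3 + \<beta>)))"
      if "k \<in> wave_vectors P" "norm k \<ge> K" for k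
    proof (rule K41w_mode[OF K41[OF \<mu>]])
      have "norm k \<ge> R" using that K by linarith
      then show "k \<in> {k \<in> wave_vectors P. norm k \<ge> kstar}" "k \<noteq> 0" using that(1) by (auto simp: R_def)
    qed (use C in simp)
    have "K \<ge> 1" using K by (simp add: R_def)
    from shift_estimate[OF assms(1) T H(2) h(1) hT ws[OF H(1)] _ _ assms(2) A _ this high \<delta>1 \<gamma>(4,1,3) S[OF \<delta>1] S[OF \<gamma>(4)]]
    have "(\<integral>\<^sup>+t\<in>{0..T - h}. (\<integral>\<^sup>+x\<in>torus P. ennreal ((norm (u \<mu> (t + h) x - u \<mu> t x))\<^sup>2) \<partial>lborel) \<partial>lborel)
      \<le> ennreal (m * (24 * A\<^sup>2 / m\<^sup>2 * 2 powr (5 + \<delta>1) * S \<delta>1 * (h * K powr (5 + \<delta>1))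
        + 4 * C * 2 powr (3 + \<delta>2) * S \<delta>2 * K powr (- \<gamma>)))"
      using \<mu> H(1) assms(3) C by (simp add: m_def)
    also have "h * K powr (5 + \<delta>1) = h powr \<theta>"
    proof -
      \<comment> \<open>\<open>\<gamma>\<close> cancels: \<open>r * (5 + \<delta>1)\<close> equals
        \<open>5 / (5 + 2 * \<alpha>)\<close>, and what remains of the first power of
        \<open>h\<close> is exactly \<open>h powr \<theta>\<close>.\<close>
      have "1 + - r * (5 + \<delta>1) = \<theta>"
      proof -
        have "5 + 2 * \<alpha> \<noteq> 0" using assms(7) by simp
        moreover have "r * (5 + \<delta>1) = 5 / (5 + 2 * \<alpha>)"
          using assms(7) \<gamma>(1) by (simp add: r_def \<theta>_def \<delta>1_def) (simp add: field_simps)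
        ultimately show ?thesis unfolding \<theta>_def minus_mult_left[symmetric] by (simp add: field_simps)
      qed
      then have "h powr \<theta> = h powr 1 * h powr (- r * (5 + \<delta>1))" by (metis powr_add)
      then show ?thesis using h(1) by (simp add: K_def powr_powr)
    qed
    also have "K powr (- \<gamma>) = h powr \<theta>" using \<gamma>(1) by (simp add: K_def powr_powr r_def)
    also have "m * (24 * A\<^sup>2 / m\<^sup>2 * 2 powr (5 + \<delta>1) * S \<delta>1 * h powr \<theta> + 4 * C * 2 powr (3 + \<delta>2) * S \<delta>2 * h powr \<theta>)
        = (M - 1) * h powr \<theta>"
      by (simp add: M_def algebra_simps)
    also have "ennreal ((M - 1) * h powr \<theta>) \<le> ennreal (M * h powr \<theta>)"
      by (intro ennreal_leI mult_right_mono) auto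
    finally show ?thesis .
  qed
  show "\<exists>M>0. (\<forall>\<^sub>F h in at_right 0. \<forall>\<mu>>0.
        (\<integral>\<^sup>+t\<in>{0..T - h}. (\<integral>\<^sup>+x\<in>torus P.
            ennreal ((norm (u \<mu> (t + h) x - u \<mu> t x))\<^sup>2) \<partial>lborel) \<partial>lborel)
        \<le> ennreal (M * h powr (2 * \<alpha> / (5 + 2 * \<alpha>)))) \<and>
     ((\<lambda>h. M * h powr (2 * \<alpha> / (5 + 2 * \<alpha>))) \<longlongrightarrow> 0) (at_right 0)"
    unfolding \<theta>_def[symmetric]
  proof (intro exI[of _ M] conjI)
    show "M > 0" using M0 by (simp add: M_def)
    have "\<forall>\<^sub>F h in at_right 0. h \<in> {0<..<b}" by (rule eventually_at_right_real[OF b])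
    then show "\<forall>\<^sub>F h in at_right 0. \<forall>\<mu>>0.
        (\<integral>\<^sup>+t\<in>{0..T - h}. (\<integral>\<^sup>+x\<in>torus P.
            ennreal ((norm (u \<mu> (t + h) x - u \<mu> t x))\<^sup>2) \<partial>lborel) \<partial>lborel)
        \<le> ennreal (M * h powr \<theta>)"
      by eventually_elim (use main in auto)
    have "((\<lambda>h::real. h powr \<theta>) \<longlongrightarrow> 0) (at_right 0)"
    proof (rule tendsto_zero_powrI)
      show "((\<lambda>h::real. h) \<longlongrightarrow> 0) (at_right 0)" by (rule tendsto_ident_at)
      show "\<forall>\<^sub>F h in at_right (0::real). 0 \<le> h"
        using eventually_at_right_less[of "0::real"] by eventually_elim simp
    qed (use \<theta> in auto)
    then show "((\<lambda>h. M * h powr \<theta>) \<longlongrightarrow> 0) (at_right 0)"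
      by (rule tendsto_mult_right_zero)
  qed
qed

end
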